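(* Let $m \geq 2$. For $1\leq \ell \leq m$, let $(\sigma^{\ell}_n)_{n\geq 1}$ be a sequence of random permutations such that $\sigma^{\ell}_n \in \mathfrak{S}_n$ for every $n\geq 1$. For $k \geq 1$, let $t^n_k:=\#_k\left(\prod_{\ell=1}^m \sigma^{\ell}_n\right)$. Assume that: (1) for every $n\geq 1$, the random permutations $\sigma^1_n, \dots, \sigma^{m}_n$ are independent; (2) for all $\ell\in\{1,\dots,m\}$ except possibly one, the following holds: for every $n\geq 1$ and every $\sigma \in \mathfrak{S}_n$, $\sigma^{-1}\sigma_n^\ell\sigma\overset{d}{=}\sigma_n^\ell$; (3) there exist $1\leq i < j\leq m$ such that for every $k \geq 1$, $$\lim_{n\to\infty} \mathbb{E}\left(\left(\frac{\#_1 \,\sigma^{i}_n}{\sqrt n}\right)^k\right)=0, \qquad \lim_{n\to\infty} \mathbb{E}\left(\left(\frac{\#_1 \,\sigma^{j}_n}{\sqrt n}\right)^k\right) =0,$$ and moreover $$\lim_{n\to\infty} \frac{\mathbb{E}(\#_2\,\sigma^i_n)}{n} =0, \qquad \lim_{n\to\infty} \frac{\mathbb{E}(\#_2\,\sigma^j_n)}{n} =0.$$ Then for every $k\geq 1$, the random vector $(t^n_1,t^n_2,\dots,t^n_k)$ converges in distribution, as $n\to\infty$, to $(\xi_1,\xi_2,\dots,\xi_k)$, where $\xi_1,\dots,\xi_k$ are independent and $\xi_d$ has the Poisson distribution with parameter $\frac1d$ for each $d$.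
   Context: $\mathfrak{S}_n$ is the group of permutations of $\{1,\dots,n\}$. For $\sigma\in\mathfrak{S}_n$ and $k\ge 1$, $\#_k\,\sigma$ is the number of cycles of $\sigma$ of length $k$ (so $\#_1\sigma$ is the number of fixed points). $\overset{d}{=}$ denotes equality in distribution. The product $\prod_{\ell=1}^m\sigma_n^\ell$ is the composition $\sigma_n^1\sigma_n^2\cdots\sigma_n^m$ in this order. *)

theory Defs
  imports "HOL-Probability.Probability" "HOL-Combinatorics.Orbits"
begin

text \<open>Permutations of {1,...,n} are represented as functions that are the identity outside {1,...,n}.\<close>

abbreviation Perms :: "nat \<Rightarrow> (nat \<Rightarrow> nat) set" where
  "Perms n \<equiv> {p. p permutes {1..n}}"

text \<open>The restriction to subsets of {1,...,n} excludes the spurious fixed points outside that set.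
  Fixed points inside it count as cycles of length 1.\<close>

definition num_cycles :: "nat \<Rightarrow> nat \<Rightarrow> (nat \<Rightarrow> nat) \<Rightarrow> nat" where
  "num_cycles n k p = card {C. C \<subseteq> {1..n} \<and> cyclic_on p C \<and> card C = k}"

definition perm_prod :: "nat \<Rightarrow> (nat \<Rightarrow> nat \<Rightarrow> nat) \<Rightarrow> nat \<Rightarrow> nat" where
  "perm_prod m p = foldr (\<circ>) (map p [1..<Suc m]) id"

definition conjugation_invariant :: "'a measure \<Rightarrow> nat \<Rightarrow> ('a \<Rightarrow> nat \<Rightarrow> nat) \<Rightarrow> bool" where
  "conjugation_invariant M n X \<longleftrightarrow>
     (\<forall>\<sigma>\<in>Perms n. distr M (count_space (Perms n)) (\<lambda>\<omega>. inv \<sigma> \<circ> X \<omega> \<circ> \<sigma>)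
                = distr M (count_space (Perms n)) X)"

text \<open>Weak convergence of measures on a topological space.  The library's \<open>weak_conv_m\<close> covers
  measures on the real line only.\<close>

definition weak_conv_top :: "'b topology \<Rightarrow> (nat \<Rightarrow> 'b measure) \<Rightarrow> 'b measure \<Rightarrow> bool" where
  "weak_conv_top T \<mu> \<nu> \<longleftrightarrow>
     (\<forall>f :: 'b \<Rightarrow> real. continuous_map T euclideanreal f \<and> bounded (f ` topspace T) \<longrightarrow>
        (\<lambda>n. integral\<^sup>L (\<mu> n) f) \<longlonglongrightarrow> integral\<^sup>L \<nu> f)"

text \<open>Since the dimension k is a term and not a type, Euclidean k-space is the set of extensional
  functions on {1,...,k}, with the product topology and the product of the Borel sigma-algebras
  (for finitely many factors the latter is the Borel sigma-algebra of the former).\<close>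

abbreviation Rk_top :: "nat \<Rightarrow> (nat \<Rightarrow> real) topology" where
  "Rk_top k \<equiv> product_topology (\<lambda>_. euclideanreal) {1..k}"

abbreviation Rk_borel :: "nat \<Rightarrow> (nat \<Rightarrow> real) measure" where
  "Rk_borel k \<equiv> PiM {1..k} (\<lambda>_. borel)"

definition cycle_vector :: "nat \<Rightarrow> nat \<Rightarrow> (nat \<Rightarrow> nat) \<Rightarrow> nat \<Rightarrow> real" where
  "cycle_vector n k p = (\<lambda>d\<in>{1..k}. real (num_cycles n d p))"

text \<open>The joint law of independent variables \<open>\<xi>\<^sub>1, \<dots>, \<xi>\<^sub>k\<close> with \<open>\<xi>\<^sub>d\<close> Poisson distributed
  with parameter \<open>1/d\<close>, viewed as real-valued variables.\<close>

definition poisson_vector_law :: "nat \<Rightarrow> (nat \<Rightarrow> real) measure" where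
  "poisson_vector_law k =
     PiM {1..k} (\<lambda>d. distr (measure_pmf (poisson_pmf (1 / real d))) borel real)"

end

theory Submission
  imports Defs "HOL-Real_Asymp.Real_Asymp"
begin

text \<open>The joint binomial moments of the cycle counts of a permutation \<open>\<pi>\<close> of \<open>{1..n}\<close> count, up to an
explicit constant, the copies in \<open>\<pi>\<close> of a fixed permutation \<open>g\<close> of a finite set \<open>I\<close>: the injections
\<open>u\<close> with \<open>\<pi> (u x) = u (g x)\<close> on \<open>I\<close> (\<open>card_embeddings\<close>).  The constant is such that convergence of
all moments to those of independent Poisson variables with parameters \<open>1/d\<close> says precisely that the
expected number of copies tends to \<open>1\<close>, for every \<open>g\<close>.

Cycle counts are class functions and all factors but one are conjugation invariant, so the factors
\<open>a\<close> and \<open>b\<close> at the positions \<open>i < j\<close> may both be conjugated by independent uniform permutations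
\<open>W2\<close> and \<open>W1\<close> without changing the expectation, even if one of them is the exceptional factor
(\<open>sum_conj_by_two_factors\<close>).  After this, all other factors are treated as deterministic, and the
product reads \<open>P W2\<^sup>-\<^sup>1 a W2 Q W1\<^sup>-\<^sup>1 b W1 R\<close>.  What has to be shown is that, for injections \<open>x\<close> and
\<open>y\<close> of \<open>N\<close> indices, the product \<open>W2\<^sup>-\<^sup>1 a W2 Q W1\<^sup>-\<^sup>1 b W1\<close> sends every \<open>x i\<close> to \<open>y i\<close> with
probability \<open>n\<^sup>-\<^sup>N (1 + o(1))\<close>.

Sum over the intermediate points \<open>z i = W1\<^sup>-\<^sup>1 b W1 (x i)\<close>.  For the roughly \<open>n\<^sup>N\<close> tuples \<open>z\<close> for which
\<open>z\<close> avoids \<open>x\<close> and \<open>Q z\<close> avoids \<open>y\<close>, both factors hit their targets with probability about \<open>n\<^sup>-\<^sup>N\<close>,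
which is the main term.  If \<open>s > 0\<close> of the points \<open>z i\<close> collide with earlier points, only about
\<open>n\<^sup>N\<^sup>-\<^sup>s\<close> choices of \<open>z\<close> remain, but a random conjugate may hit its targets with a larger probability,
because \<open>x i \<mapsto> z i\<close> may close up into cycles.  A closed cycle of length \<open>d\<close> costs a factor
(points of \<open>b\<close> in \<open>d\<close>-cycles)\<open>/ n\<^sup>d\<close>.  If \<open>b\<close> has at most \<open>\<eta> \<surd>n\<close> fixed points and at most \<open>\<eta> n\<close>
points in 2-cycles, where \<open>\<eta> \<ge> n\<^sup>-\<^sup>1\<^sup>/\<^sup>2\<close>, this is at most \<open>\<eta> n\<^sup>-\<^sup>d\<^sup>/\<^sup>2\<close> for every \<open>d\<close>, so each of the two factors gains at
most \<open>\<eta> n\<^sup>s\<^sup>/\<^sup>2\<close>.  The product of the gains, \<open>\<eta>\<^sup>2 n\<^sup>s\<close>, compensates the loss in the number of tuples up to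
the factor \<open>\<eta>\<^sup>2\<close>, which tends to \<open>0\<close> (\<open>card_intertwiners_upper\<close>, \<open>card_conj_pairs_upper\<close>).  This
explains the two thresholds in the hypotheses: \<open>\<surd>n\<close> for fixed points and \<open>n\<close> for 2-cycles.

By Markov's inequality there is a deterministic sequence \<open>\<eta> \<longlonglongrightarrow> 0\<close> such that the factors \<open>i\<close> and \<open>j\<close>
satisfy these two bounds with probability tending to \<open>1\<close>.  Discarding the complementary event does not
affect integrals of bounded functions in the limit, and on the remaining event all binomial moments
converge.  The Bonferroni inequalities turn this into convergence of the point probabilities
(\<open>poisson_limit_of_binomial_moments\<close>), and since the limits have total mass \<open>1\<close>, no mass escapes and
weak convergence follows (\<open>weighted_average_tendsto\<close>).\<close>

section \<open>Cycles and equivariant embeddings\<close>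

definition period_pts :: "nat \<Rightarrow> ('a \<Rightarrow> 'a) \<Rightarrow> 'a set \<Rightarrow> 'a set" where
  "period_pts d p A = {x \<in> A. card (orbit p x) = d}"

definition cycles_of_length :: "nat \<Rightarrow> ('a \<Rightarrow> 'a) \<Rightarrow> 'a set \<Rightarrow> 'a set set" where
  "cycles_of_length d p A = {C. C \<subseteq> A \<and> cyclic_on p C \<and> card C = d}"

text \<open>The copies of the permutation \<open>g\<close> of \<open>X\<close> inside the permutation \<open>p\<close> of \<open>A\<close>.  They are extensional
functions, so that there are finitely many of them.\<close>

definition embeddings :: "'i set \<Rightarrow> ('i \<Rightarrow> 'i) \<Rightarrow> 'a set \<Rightarrow> ('a \<Rightarrow> 'a) \<Rightarrow> ('i \<Rightarrow> 'a) set" where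
  "embeddings X g A p = {u \<in> X \<rightarrow>\<^sub>E A. inj_on u X \<and> (\<forall>x\<in>X. p (u x) = u (g x))}"

lemma permutation_of_permutes: "p permutes A \<Longrightarrow> finite A \<Longrightarrow> permutation p"
  using permutation_permutes by blast

lemma orbit_subset_invariant:
  assumes "g ` X \<subseteq> X" "x \<in> X"
  shows "orbit g x \<subseteq> X"
proof
  fix y assume "y \<in> orbit g x"
  then show "y \<in> X" by induct (use assms in auto)
qed

lemma orbit_eq_of_mem:
  assumes "permutation g" "y \<in> orbit g x"
  shows "orbit g y = orbit g x"
  using orbit_cyclic_eq3[OF cyclic_on_orbit'[OF assms(1)] assms(2)] .

lemma card_orbit_pos:
  assumes "permutation g"
  shows "card (orbit g x) > 0" "finite (orbit g x)"
proof -
  show "finite (orbit g x)"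
    by (rule finite_orbit[OF permutation_self_in_orbit[OF assms]])
  then show "card (orbit g x) > 0" using orbit_nonempty[of g x] by (simp add: card_gt_0_iff)
qed

lemma invariant_Diff_orbit:
  assumes g: "permutation g" and X: "g ` X \<subseteq> X"
  shows "g ` (X - orbit g x) \<subseteq> X - orbit g x"
proof -
  have "y \<in> orbit g x" if "g y \<in> orbit g x" for y
  proof -
    have "orbit g y = orbit g x"
      using orbit_eq_of_mem[OF g that] permutation_orbit_step[OF g, of y] by simp
    then show ?thesis using permutation_self_in_orbit[OF g, of y] by simp
  qed
  then show ?thesis using X by auto
qed

lemma funpow_eq_iff_mod_orbit:
  assumes p: "permutation p"
  shows "(p ^^ i) x = (p ^^ j) x \<longleftrightarrow> i mod card (orbit p x) = j mod card (orbit p x)"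
proof -
  have x: "x \<in> orbit p x" by (rule permutation_self_in_orbit[OF p])
  define d where "d = funpow_dist1 p x x"
  have inj: "inj_on (\<lambda>n. (p ^^ n) x) {0..<d}"
    unfolding d_def by (rule inj_on_funpow_dist1[OF x])
  have orb: "orbit p x = (\<lambda>n. (p ^^ n) x) ` {0..<d}"
    unfolding d_def by (rule orbit_conv_funpow_dist1[OF x])
  have card: "card (orbit p x) = d"
    unfolding orb using inj by (simp add: card_image)
  have per: "(p ^^ d) x = x" unfolding d_def by (rule funpow_dist1_prop[OF x])
  have d: "d > 0" by (simp add: d_def)
  have m: "(p ^^ (k mod d)) x = (p ^^ k) x" for k
    by (rule funpow_mod_eq[OF per])
  show ?thesis unfolding card
  proof
    assume "(p ^^ i) x = (p ^^ j) x"
    then have "(p ^^ (i mod d)) x = (p ^^ (j mod d)) x" by (simp add: m)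
    then show "i mod d = j mod d" using inj d by (auto simp: inj_on_def)
  next
    assume "i mod d = j mod d"
    then show "(p ^^ i) x = (p ^^ j) x" by (metis m)
  qed
qed

text \<open>A cycle is determined up to isomorphism by its length, and the isomorphism can be chosen to send a
given point to any given point.  This is the freedom that the factor \<open>d\<close> in the embedding count
comes from.\<close>

lemma equal_length_orbits_isomorphic:
  assumes g: "permutation g" and p: "permutation p"
    and eq: "card (orbit g x) = card (orbit p a)"
  obtains h where "inj_on h (orbit g x)" "h ` orbit g x = orbit p a" "h x = a"
    "\<And>y. y \<in> orbit g x \<Longrightarrow> p (h y) = h (g y)"
proof -
  \<comment> \<open>The exponent is determined modulo the common length, so the choice does not matter.\<close>
  define h where "h y = (p ^^ (SOME i. (g ^^ i) x = y)) a" for y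
  have h: "h ((g ^^ i) x) = (p ^^ i) a" for i
  proof -
    have "(g ^^ (SOME j. (g ^^ j) x = (g ^^ i) x)) x = (g ^^ i) x"
      by (rule someI[of _ i]) simp
    then show ?thesis
      unfolding h_def using funpow_eq_iff_mod_orbit[OF g] funpow_eq_iff_mod_orbit[OF p] eq by metis
  qed
  have orb: "y \<in> orbit g x \<longleftrightarrow> (\<exists>i. y = (g ^^ i) x)" for y
    using orbit_altdef_permutation[OF g, of x] by auto
  have orb': "y \<in> orbit p a \<longleftrightarrow> (\<exists>i. y = (p ^^ i) a)" for y
    using orbit_altdef_permutation[OF p, of a] by auto
  show ?thesis
  proof
    show "inj_on h (orbit g x)"
    proof (rule inj_onI)
      fix y z assume "y \<in> orbit g x" "z \<in> orbit g x" "h y = h z"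
      then show "y = z"
        using orb h funpow_eq_iff_mod_orbit[OF g] funpow_eq_iff_mod_orbit[OF p] eq by metis
    qed
    show "h ` orbit g x = orbit p a" using orb orb' h by (auto simp: image_iff) metis+
    show "h x = a" using h[of 0] by simp
    show "p (h y) = h (g y)" if "y \<in> orbit g x" for y
    proof -
      from that obtain i where i: "y = (g ^^ i) x" using orb by auto
      show ?thesis using h[of i] h[of "Suc i"] i by simp
    qed
  qed
qed

lemma equivariant_orbit_image:
  assumes g: "permutation g" and X: "g ` X \<subseteq> X" and u: "\<And>x. x \<in> X \<Longrightarrow> p (u x) = u (g x)"
    and x: "x \<in> X"
  shows "u ` orbit g x = orbit p (u x)"
  using orbit_inverse[OF permutation_self_in_orbit[OF g], of x p u] u
    orbit_subset_invariant[OF X x] by blast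

lemma embeddings_card_orbit:
  assumes g: "permutation g" and X: "g ` X \<subseteq> X" and u: "u \<in> embeddings X g A p" and x: "x \<in> X"
  shows "card (orbit p (u x)) = card (orbit g x)"
proof -
  have "u ` orbit g x = orbit p (u x)"
    using u by (intro equivariant_orbit_image[OF g X _ x]) (auto simp: embeddings_def)
  moreover have "inj_on u (orbit g x)"
    using u orbit_subset_invariant[OF X x] by (auto simp: embeddings_def intro: inj_on_subset)
  ultimately show ?thesis by (metis card_image)
qed

lemma finite_embeddings: "finite X \<Longrightarrow> finite A \<Longrightarrow> finite (embeddings X g A p)"
  unfolding embeddings_def by (rule finite_subset[of _ "X \<rightarrow>\<^sub>E A"]) (auto intro: finite_PiE)

text \<open>An embedding preserves the length of the cycle through a point, so it uses up exactly as many points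
of period \<open>d\<close> in \<open>A\<close> as there are in \<open>X\<close>.\<close>

lemma card_free_periodic_points:
  assumes g: "permutation g" and X: "finite X" "g ` X \<subseteq> X" and A: "finite A"
    and u: "u \<in> embeddings X g A p"
  shows "card {a \<in> period_pts d p A. a \<notin> u ` X}
    = card (period_pts d p A) - card (period_pts d g X)"
proof -
  have sub: "u ` period_pts d g X \<subseteq> period_pts d p A"
    using u embeddings_card_orbit[OF g X(2) u] by (auto simp: period_pts_def embeddings_def)
  have "{a \<in> period_pts d p A. a \<notin> u ` X} = period_pts d p A - u ` period_pts d g X"
    using embeddings_card_orbit[OF g X(2) u] by (auto simp: period_pts_def)
  moreover have "inj_on u (period_pts d g X)"
    using u by (auto simp: embeddings_def period_pts_def intro: inj_on_subset)
  moreover have "finite (u ` period_pts d g X)" using X by (auto simp: period_pts_def)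
  ultimately show ?thesis using sub by (simp add: card_Diff_subset card_image)
qed

text \<open>An embedding of \<open>X\<close> is an embedding of \<open>X\<close> without the cycle \<open>C\<close>, together with the image of one
point of \<open>C\<close>: that image determines the embedding on all of \<open>C\<close>, and it can be any point of the same
period that is not yet used.\<close>

lemma card_embeddings_remove_orbit:
  assumes g: "permutation g" and X: "finite X" "g ` X \<subseteq> X" and A: "finite A" "p permutes A"
    and x: "x \<in> X"
  defines "C \<equiv> orbit g x"
  shows "card (embeddings X g A p) = card (embeddings (X - C) g A p)
    * (card (period_pts (card C) p A) - card (period_pts (card C) g (X - C)))"
proof -
  have p: "permutation p" using A permutation_of_permutes by blast
  have CX: "C \<subseteq> X" unfolding C_def by (rule orbit_subset_invariant[OF X(2) x])
  have xC: "x \<in> C" unfolding C_def by (rule permutation_self_in_orbit[OF g])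
  have X': "finite (X - C)" "g ` (X - C) \<subseteq> X - C"
    using X invariant_Diff_orbit[OF g X(2)] by (auto simp: C_def)
  have gC: "g y \<in> C" if "y \<in> C" for y using that by (auto simp: C_def intro: orbit.step)
  define F where "F v = {a \<in> period_pts (card C) p A. a \<notin> v ` (X - C)}" for v :: "'a \<Rightarrow> 'b"
  define R where "R = (\<lambda>u :: 'a \<Rightarrow> 'b. (restrict u (X - C), u x))"
  have "bij_betw R (embeddings X g A p) (Sigma (embeddings (X - C) g A p) F)"
  proof (rule bij_betw_imageI)
    show "inj_on R (embeddings X g A p)"
    proof (rule inj_onI)
      fix u v assume u: "u \<in> embeddings X g A p" and v: "v \<in> embeddings X g A p" and eq: "R u = R v"
      have ux: "u x = v x" using eq by (simp add: R_def)
      have C: "u y = v y \<and> y \<in> X" if "y \<in> orbit g x" for y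
        using that
      proof induct
        case base
        have "p (u x) = u (g x)" "p (v x) = v (g x)" using u v x by (auto simp: embeddings_def)
        then show ?case using ux x X by auto
      next
        case (step y)
        have "p (u y) = u (g y)" "p (v y) = v (g y)" using u v step by (auto simp: embeddings_def)
        then show ?case using step X by auto
      qed
      have nC: "u y = v y" if "y \<in> X - C" for y
      proof -
        have "restrict u (X - C) y = restrict v (X - C) y" using eq by (simp add: R_def)
        then show ?thesis using that by simp
      qed
      show "u = v"
      proof
        fix y show "u y = v y"
        proof (cases "y \<in> X")
          case True
          then show ?thesis using C nC by (cases "y \<in> C") (auto simp: C_def)
        next
          case False
          then show ?thesis using u v by (auto simp: embeddings_def PiE_def extensional_def)
        qed
      qed
    qed
  next
    have sub: "R u \<in> Sigma (embeddings (X - C) g A p) F" if u: "u \<in> embeddings X g A p" for u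
    proof -
      have inj: "inj_on u X" using u by (simp add: embeddings_def)
      have r: "restrict u (X - C) \<in> embeddings (X - C) g A p"
        unfolding embeddings_def
      proof (intro CollectI conjI ballI)
        show "restrict u (X - C) \<in> X - C \<rightarrow>\<^sub>E A" using u by (auto simp: embeddings_def)
        show "inj_on (restrict u (X - C)) (X - C)"
          using inj_on_subset[OF inj, of "X - C"] by (simp add: inj_on_restrict_eq)
        fix y assume y: "y \<in> X - C"
        then have "g y \<in> X - C" using X' by blast
        then show "p (restrict u (X - C) y) = restrict u (X - C) (g y)"
          using u y by (simp add: embeddings_def)
      qed
      have "u x \<in> F (restrict u (X - C))"
        unfolding F_def period_pts_def
      proof (intro CollectI conjI)
        show "u x \<in> A" using u x by (auto simp: embeddings_def)
        show "card (orbit p (u x)) = card C"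
          unfolding C_def by (rule embeddings_card_orbit[OF g X(2) u x])
        show "u x \<notin> restrict u (X - C) ` (X - C)"
        proof
          assume "u x \<in> restrict u (X - C) ` (X - C)"
          then obtain y where "y \<in> X - C" "u x = u y" by auto
          then show False using inj x xC by (auto simp: inj_on_def)
        qed
      qed
      then show ?thesis using r by (simp add: R_def)
    qed
    show "R ` embeddings X g A p = Sigma (embeddings (X - C) g A p) F"
    proof (intro equalityI subsetI)
      fix y assume "y \<in> R ` embeddings X g A p" then show "y \<in> Sigma (embeddings (X - C) g A p) F"
        using sub by auto
    next
      fix va assume "va \<in> Sigma (embeddings (X - C) g A p) F"
      then obtain v a where va: "va = (v, a)" and v: "v \<in> embeddings (X - C) g A p"
        and a: "a \<in> A" "card (orbit p a) = card C" "a \<notin> v ` (X - C)"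
        by (auto simp: F_def period_pts_def)
      obtain h where h: "inj_on h C" "h ` C = orbit p a" "h x = a"
        "\<And>y. y \<in> C \<Longrightarrow> p (h y) = h (g y)"
        using equal_length_orbits_isomorphic[OF g p, of x a] a(2) unfolding C_def by metis
      define u where "u y = (if y \<in> C then h y else v y)" for y
      have disj: "h y \<noteq> v z" if "y \<in> C" "z \<in> X - C" for y z
      proof
        assume "h y = v z"
        moreover have "h y \<in> orbit p a" using h(2) that(1) by blast
        ultimately have "v z \<in> orbit p a" by simp
        then have "a \<in> orbit p (v z)"
          using orbit_eq_of_mem[OF p] permutation_self_in_orbit[OF p, of a] by metis
        also have "orbit p (v z) = v ` orbit g z"
          using v that by (intro equivariant_orbit_image[OF g X'(2), symmetric]) (auto simp: embeddings_def)
        also have "\<dots> \<subseteq> v ` (X - C)"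
          using orbit_subset_invariant[OF X'(2) that(2)] by auto
        finally show False using a(3) by simp
      qed
      have orbA: "orbit p a \<subseteq> A" using permutes_orbit_subset[OF A(2) a(1)] .
      have "u \<in> embeddings X g A p"
        unfolding embeddings_def
      proof (intro CollectI conjI ballI)
        show "u \<in> X \<rightarrow>\<^sub>E A"
        proof (rule PiE_I)
          fix y assume "y \<in> X"
          then show "u y \<in> A"
            using v h(2) orbA by (cases "y \<in> C") (auto simp: u_def embeddings_def)
        next
          fix y assume "y \<notin> X"
          then show "u y = undefined"
            using v CX by (auto simp: u_def embeddings_def PiE_def extensional_def)
        qed
        show "inj_on u X"
        proof (rule inj_onI)
          fix y z assume yz: "y \<in> X" "z \<in> X" "u y = u z"
          have v_inj: "inj_on v (X - C)" using v by (simp add: embeddings_def)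
          consider "y \<in> C" "z \<in> C" | "y \<in> C" "z \<notin> C" | "y \<notin> C" "z \<in> C" | "y \<notin> C" "z \<notin> C"
            by blast
          then show "y = z"
          proof cases
            case 1 then show ?thesis using yz inj_onD[OF h(1)] by (simp add: u_def)
          next
            case 2 then show ?thesis using yz disj[of y z] by (simp add: u_def)
          next
            case 3 then show ?thesis using yz disj[of z y] by (simp add: u_def)
          next
            case 4 then show ?thesis using yz inj_onD[OF v_inj] by (simp add: u_def)
          qed
        qed
        fix y assume y: "y \<in> X"
        show "p (u y) = u (g y)"
        proof (cases "y \<in> C")
          case True
          then show ?thesis using h(4) gC by (simp add: u_def)
        next
          case False
          then have "y \<in> X - C" "g y \<in> X - C" using y X'(2) by blast+
          then show ?thesis using v by (simp add: u_def embeddings_def)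
        qed
      qed
      moreover have "R u = va"
      proof -
        have "v \<in> extensional (X - C)" using v by (auto simp: embeddings_def PiE_def)
        then have "restrict u (X - C) = v"
          by (intro ext) (auto simp: u_def restrict_def extensional_def)
        then show ?thesis using h(3) xC by (simp add: R_def u_def va)
      qed
      ultimately show "va \<in> R ` embeddings X g A p" by (metis image_eqI)
    qed
  qed
  then have "card (embeddings X g A p) = card (Sigma (embeddings (X - C) g A p) F)"
    by (rule bij_betw_same_card)
  also have "\<dots> = (\<Sum>v\<in>embeddings (X - C) g A p. card (F v))"
    using finite_embeddings[OF X'(1) A(1)] A by (intro card_SigmaI) (auto simp: F_def period_pts_def)
  also have "\<dots> = (\<Sum>v\<in>embeddings (X - C) g A p.
      card (period_pts (card C) p A) - card (period_pts (card C) g (X - C)))"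
    by (intro sum.cong refl) (simp add: F_def card_free_periodic_points[OF g X' A(1)])
  finally show ?thesis by simp
qed

lemma card_period_pts:
  assumes g: "permutation g" and X: "finite X" "g ` X \<subseteq> X" and d: "d > 0"
  shows "card (period_pts d g X) = d * card (cycles_of_length d g X)"
proof -
  have "period_pts d g X = \<Union> (cycles_of_length d g X)"
  proof (intro equalityI subsetI)
    fix x assume "x \<in> period_pts d g X"
    then have "orbit g x \<in> cycles_of_length d g X"
      using orbit_subset_invariant[OF X(2)] cyclic_on_orbit'[OF g]
      by (auto simp: period_pts_def cycles_of_length_def)
    then show "x \<in> \<Union> (cycles_of_length d g X)"
      using permutation_self_in_orbit[OF g, of x] by blast
  next
    fix x assume "x \<in> \<Union> (cycles_of_length d g X)"
    then obtain C where "C \<subseteq> X" "cyclic_on g C" "card C = d" "x \<in> C"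
      by (auto simp: cycles_of_length_def)
    moreover from this have "orbit g x = C" using orbit_cyclic_eq3 by metis
    ultimately show "x \<in> period_pts d g X" by (auto simp: period_pts_def)
  qed
  moreover have "finite (cycles_of_length d g X)"
    using X by (auto simp: cycles_of_length_def)
  moreover have "C \<inter> D = {}"
    if C: "C \<in> cycles_of_length d g X" and D: "D \<in> cycles_of_length d g X" and ne: "C \<noteq> D" for C D
  proof (rule ccontr)
    assume "C \<inter> D \<noteq> {}"
    then obtain y where "y \<in> C" "y \<in> D" by auto
    then have "orbit g y = C" "orbit g y = D"
      using C D by (simp_all add: cycles_of_length_def orbit_cyclic_eq3)
    then show False using ne by simp
  qed
  moreover have "card C = d" "finite C" if "C \<in> cycles_of_length d g X" for C
    using that X by (auto simp: cycles_of_length_def intro: finite_subset)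
  ultimately show ?thesis
    using card_partition[of "cycles_of_length d g X" d] X by (auto simp: period_pts_def)
qed

lemma cycles_of_length_remove_orbit:
  assumes g: "permutation g" and X: "finite X" "g ` X \<subseteq> X" and x: "x \<in> X"
  defines "C \<equiv> orbit g x"
  shows "card (cycles_of_length d g X)
    = card (cycles_of_length d g (X - C)) + (if d = card C then 1 else 0)"
proof -
  have "cycles_of_length d g X = cycles_of_length d g (X - C) \<union> (if d = card C then {C} else {})"
  proof (intro equalityI subsetI)
    fix D assume D: "D \<in> cycles_of_length d g X"
    show "D \<in> cycles_of_length d g (X - C) \<union> (if d = card C then {C} else {})"
    proof (cases "D \<inter> C = {}")
      case True
      then show ?thesis using D by (auto simp: cycles_of_length_def)
    next
      case False
      then obtain y where "y \<in> D" "y \<in> C" by auto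
      then have "D = C"
        using D orbit_cyclic_eq3[of g D y] orbit_eq_of_mem[OF g, of y x]
        by (auto simp: cycles_of_length_def C_def)
      then show ?thesis using D by (auto simp: cycles_of_length_def)
    qed
  next
    fix D assume "D \<in> cycles_of_length d g (X - C) \<union> (if d = card C then {C} else {})"
    then show "D \<in> cycles_of_length d g X"
      using orbit_subset_invariant[OF X(2) x] cyclic_on_orbit'[OF g, of x]
      by (auto simp: cycles_of_length_def C_def split: if_splits)
  qed
  moreover have "C \<notin> cycles_of_length d g (X - C)"
    using orbit_nonempty[of g x] by (auto simp: cycles_of_length_def C_def)
  moreover have "finite (cycles_of_length d g (X - C))"
    using X by (auto simp: cycles_of_length_def)
  ultimately show ?thesis by auto
qed

text \<open>Removing the cycles of \<open>g\<close> one at a time, the \<open>i\<close>-th cycle of length \<open>d\<close> can go to any of the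
remaining cycles of \<open>p\<close> of that length, with \<open>d\<close> choices for the image of a base point.\<close>

proposition card_embeddings:
  assumes g: "permutation g" and X: "finite X" "g ` X \<subseteq> X" and A: "finite A" "p permutes A"
    and D: "finite D" "\<And>x. x \<in> X \<Longrightarrow> card (orbit g x) \<in> D"
  shows "card (embeddings X g A p) =
    (\<Prod>d\<in>D. \<Prod>i<card (cycles_of_length d g X). d * (card (cycles_of_length d p A) - i))"
  using X D(2)
proof (induction "card X" arbitrary: X rule: less_induct)
  case (less X)
  show ?case
  proof (cases "X = {}")
    case True
    then have "cycles_of_length d g X = {}" for d
      by (auto simp: cycles_of_length_def cyclic_on_def)
    moreover have "embeddings X g A p = {\<lambda>_. undefined}"
      using True by (auto simp: embeddings_def)
    ultimately show ?thesis by simp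
  next
    case False
    then obtain x where x: "x \<in> X" by auto
    define C where "C = orbit g x"
    define d0 where "d0 = card C"
    have p: "permutation p" using A permutation_of_permutes by blast
    have CX: "C \<subseteq> X" unfolding C_def by (rule orbit_subset_invariant[OF less.prems(2) x])
    have xC: "x \<in> C" unfolding C_def by (rule permutation_self_in_orbit[OF g])
    have X': "finite (X - C)" "g ` (X - C) \<subseteq> X - C"
      using less.prems invariant_Diff_orbit[OF g less.prems(2)] by (auto simp: C_def)
    have pA: "p ` A \<subseteq> A" using permutes_image[OF A(2)] by simp
    have d0: "d0 > 0" "d0 \<in> D"
      using card_orbit_pos[OF g, of x] less.prems(3)[OF x] by (auto simp: d0_def C_def)
    let ?n = "\<lambda>d. card (cycles_of_length d g (X - C))" and ?m = "\<lambda>d. card (cycles_of_length d p A)"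
    have IH: "card (embeddings (X - C) g A p) = (\<Prod>d\<in>D. \<Prod>i<?n d. d * (?m d - i))"
    proof (rule less.hyps)
      show "card (X - C) < card X"
        using x xC less.prems by (intro psubset_card_mono) auto
    qed (use X' less.prems in auto)
    have "card (embeddings X g A p) =
        (\<Prod>d\<in>D. \<Prod>i<?n d. d * (?m d - i)) * (d0 * (?m d0 - ?n d0))"
      using card_embeddings_remove_orbit[OF g less.prems(1,2) A x]
        card_period_pts[OF g X' d0(1)] card_period_pts[OF p A(1) pA d0(1)]
      unfolding C_def[symmetric] d0_def[symmetric] IH by (simp add: diff_mult_distrib2)
    also have "\<dots> = (\<Prod>d\<in>D. (\<Prod>i<?n d. d * (?m d - i)) *
        (if d = d0 then d0 * (?m d0 - ?n d0) else 1))"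
      using D(1) d0(2) by (simp add: prod.distrib)
    also have "\<dots> = (\<Prod>d\<in>D. \<Prod>i<card (cycles_of_length d g X). d * (?m d - i))"
      using cycles_of_length_remove_orbit[OF g less.prems(1,2) x]
      unfolding C_def[symmetric] d0_def[symmetric]
      by (intro prod.cong refl) (auto simp: mult_ac)
    finally show ?thesis .
  qed
qed

section \<open>Conjugates with prescribed values\<close>

text \<open>The permutations \<open>W\<close> for which the conjugate \<open>W\<^sup>-\<^sup>1 b W\<close> sends \<open>x i\<close> to \<open>z i\<close> for all \<open>i\<close>.
The equation is written without inverses.\<close>

definition intertwiners :: "'a set \<Rightarrow> ('a \<Rightarrow> 'a) \<Rightarrow> 'i set \<Rightarrow> ('i \<Rightarrow> 'a) \<Rightarrow> ('i \<Rightarrow> 'a) \<Rightarrow> ('a \<Rightarrow> 'a) set"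
  where "intertwiners A b I x z = {W. W permutes A \<and> (\<forall>i\<in>I. b (W (x i)) = W (z i))}"

text \<open>The factor by which the probability that a random conjugate has \<open>N\<close> prescribed values may exceed
\<open>n\<^sup>-\<^sup>N\<close> when \<open>s\<close> of the values lie among the arguments; \<open>r\<close> stands for \<open>\<surd>n\<close>.\<close>

definition excess_bound :: "real \<Rightarrow> real \<Rightarrow> nat \<Rightarrow> real" where
  "excess_bound \<eta> r s = (if s = 0 then 1 else \<eta> * r ^ s)"

text \<open>With \<open>r = \<surd>n\<close> and \<open>1 \<le> \<eta> r\<close> this bounds the number of fixed points by \<open>\<eta> \<surd>n\<close> and the number of
points in 2-cycles by \<open>\<eta> n\<close>; for \<open>d \<ge> 3\<close> the bound is at least \<open>n\<close>.  A single inequality for all \<open>d\<close> lets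
the contributions of several cycles be multiplied.\<close>

definition sparse_cycles :: "real \<Rightarrow> real \<Rightarrow> 'a set \<Rightarrow> ('a \<Rightarrow> 'a) \<Rightarrow> bool" where
  "sparse_cycles \<eta> r A p \<longleftrightarrow> (\<forall>d\<ge>1. real (card (period_pts d p A)) \<le> \<eta> * r ^ d)"

lemma excess_bound_le_power:
  assumes "0 \<le> \<eta>" "\<eta> \<le> 1" "1 \<le> r"
  shows "excess_bound \<eta> r s \<le> r ^ s"
  using assms by (simp add: excess_bound_def mult_left_le_one_le)

lemma excess_bound_nonneg: "0 \<le> \<eta> \<Longrightarrow> 0 \<le> r \<Longrightarrow> 0 \<le> excess_bound \<eta> r s"
  by (simp add: excess_bound_def)

lemma excess_bound_mono:
  assumes "0 \<le> \<eta>" "1 \<le> \<eta> * r" "1 \<le> r" "s \<le> t"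
  shows "excess_bound \<eta> r s \<le> excess_bound \<eta> r t"
proof (cases "s = 0 \<and> t \<noteq> 0")
  case True
  have "1 \<le> \<eta> * r ^ 1" using assms by simp
  also have "\<dots> \<le> \<eta> * r ^ t"
    using assms True by (intro mult_left_mono power_increasing) auto
  finally show ?thesis using True by (simp add: excess_bound_def)
next
  case False
  then show ?thesis using assms by (auto simp: excess_bound_def intro!: mult_left_mono power_increasing)
qed

lemma finite_intertwiners: "finite A \<Longrightarrow> finite (intertwiners A b I x z)"
  by (rule finite_subset[OF _ finite_permutations[of A]]) (auto simp: intertwiners_def)

lemma intertwiners_insert:
  "intertwiners A b (insert j I) x z = {W \<in> intertwiners A b I x z. b (W (x j)) = W (z j)}"
  by (auto simp: intertwiners_def)

text \<open>Composing \<open>W\<close> with the transposition of \<open>c\<close> and \<open>w\<close> exchanges the two events, since it fixes all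
points that the other conditions speak about.  So a value that is not among the points already fixed
is as likely as any other such value.\<close>

lemma card_intertwiners_swap:
  assumes A: "finite A" and c: "c \<in> A" "c \<noteq> a" "c \<notin> x ` I" "c \<notin> z ` I"
    and w: "w \<in> A" "w \<noteq> a" "w \<notin> x ` I" "w \<notin> z ` I"
  shows "card {W \<in> intertwiners A b I x z. b (W a) = W c} =
    card {W \<in> intertwiners A b I x z. b (W a) = W w}"
proof -
  define t where "t = Transposition.transpose c w"
  have t: "t permutes A" unfolding t_def using c w by (intro permutes_swap_id) auto
  have tx: "t a = a" "t c = w" "t w = c" "\<And>i. i \<in> I \<Longrightarrow> t (x i) = x i" "\<And>i. i \<in> I \<Longrightarrow> t (z i) = z i"
    using c w by (auto simp: t_def Transposition.transpose_def)
  let ?L = "\<lambda>w. {W \<in> intertwiners A b I x z. b (W a) = W w}"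
  have inv: "(\<lambda>W. W \<circ> t) ((\<lambda>W. W \<circ> t) W) = W" for W by (simp add: fun_eq_iff t_def)
  have "W \<circ> t \<in> ?L w" if "W \<in> ?L c" for W
    using that permutes_compose[OF t, of W] by (simp add: intertwiners_def tx)
  moreover have "W \<circ> t \<in> ?L c" if "W \<in> ?L w" for W
    using that permutes_compose[OF t, of W] by (simp add: intertwiners_def tx)
  ultimately have "bij_betw (\<lambda>W. W \<circ> t) (?L c) (?L w)"
    by (intro bij_betw_byWitness[where f' = "\<lambda>W. W \<circ> t"] ballI inv image_subsetI)
  then show ?thesis by (rule bij_betw_same_card)
qed

lemma sum_card_intertwiners:
  assumes A: "finite A" and b: "b permutes A" and a: "a \<in> A"
  shows "(\<Sum>w\<in>A. card {W \<in> intertwiners A b I x z. b (W a) = W w}) = card (intertwiners A b I x z)"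
proof -
  have "intertwiners A b I x z = (\<Union>w\<in>A. {W \<in> intertwiners A b I x z. b (W a) = W w})"
  proof (intro equalityI subsetI)
    fix W assume W: "W \<in> intertwiners A b I x z"
    then have Wp: "W permutes A" by (simp add: intertwiners_def)
    have "b (W a) \<in> A" using a Wp b by (simp add: permutes_in_image)
    then have "inv W (b (W a)) \<in> A" using permutes_in_image[OF permutes_inv[OF Wp]] by simp
    moreover have "b (W a) = W (inv W (b (W a)))" using permutes_inverses[OF Wp] by simp
    ultimately show "W \<in> (\<Union>w\<in>A. {W \<in> intertwiners A b I x z. b (W a) = W w})"
      using W by blast
  qed auto
  moreover have "{W \<in> intertwiners A b I x z. b (W a) = W w} \<inter>
      {W \<in> intertwiners A b I x z. b (W a) = W w'} = {}" if "w \<noteq> w'" for w w'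
    using that permutes_inj by (fastforce simp: intertwiners_def inj_eq)
  ultimately show ?thesis
    using A finite_intertwiners[OF A, of b I x z] by (subst card_UN_disjoint[symmetric]) auto
qed

text \<open>The events that the new argument \<open>a\<close> goes to \<open>w\<close> are disjoint, and they are equally likely for all but
at most \<open>2 |I| + 1\<close> values \<open>w\<close>.\<close>

lemma card_intertwiners_extend_le:
  assumes A: "finite A" and I: "finite I" and b: "b permutes A"
    and a: "a \<in> A" and c: "c \<in> A" "c \<noteq> a" "c \<notin> x ` I" "c \<notin> z ` I"
  shows "(card A - (2 * card I + 1)) * card {W \<in> intertwiners A b I x z. b (W a) = W c}
    \<le> card (intertwiners A b I x z)"
proof -
  let ?L = "\<lambda>w. {W \<in> intertwiners A b I x z. b (W a) = W w}"
  define F where "F = insert a (x ` I \<union> z ` I)"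
  have "card F \<le> Suc (card (x ` I \<union> z ` I))" unfolding F_def by (rule card_insert_le_m1) auto
  also have "\<dots> \<le> Suc (card (x ` I) + card (z ` I))" by (simp add: card_Un_le)
  also have "\<dots> \<le> 2 * card I + 1" using card_image_le[OF I, of x] card_image_le[OF I, of z] by simp
  finally have F: "card F \<le> 2 * card I + 1" .
  have finF: "finite F" using I by (simp add: F_def)
  have "card A - (2 * card I + 1) \<le> card (A - F)"
    using F diff_card_le_card_Diff[OF finF, of A] by linarith
  then have "(card A - (2 * card I + 1)) * card (?L c) \<le> card (A - F) * card (?L c)"
    by (rule mult_right_mono) simp
  also have "\<dots> = (\<Sum>w\<in>A - F. card (?L w))"
  proof -
    have "card (?L w) = card (?L c)" if "w \<in> A - F" for w
      using that c by (intro card_intertwiners_swap[OF A]) (auto simp: F_def)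
    then show ?thesis by simp
  qed
  also have "\<dots> \<le> (\<Sum>w\<in>A. card (?L w))" using A by (intro sum_mono2) auto
  also have "\<dots> = card (intertwiners A b I x z)" by (rule sum_card_intertwiners[OF A b a])
  finally show ?thesis .
qed

text \<open>The same decomposition, read as a lower bound for a fresh value \<open>c\<close>.  The sum collects the values \<open>w\<close>
that are not interchangeable with \<open>c\<close>; they lie among the arguments, and the values in \<open>z ` I\<close> are
impossible by injectivity.\<close>

lemma card_intertwiners_le_extend:
  assumes A: "finite A" and I: "finite I" and b: "b permutes A"
    and a: "a \<in> A" "a \<notin> x ` I" and c: "c \<in> A" "c \<noteq> a" "c \<notin> x ` I" "c \<notin> z ` I"
    and xA: "x ` I \<subseteq> A"
  shows "card (intertwiners A b I x z)
    \<le> card A * card {W \<in> intertwiners A b I x z. b (W a) = W c}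
      + (\<Sum>w\<in>insert a (x ` I) - z ` I. card {W \<in> intertwiners A b I x z. b (W a) = W w})"
proof -
  let ?L = "\<lambda>w. {W \<in> intertwiners A b I x z. b (W a) = W w}"
  define E where "E = insert a (x ` I) - z ` I"
  have E: "E \<subseteq> A" "finite E" using a xA I by (auto simp: E_def)
  have empty: "?L w = {}" if "w \<in> z ` I" for w
  proof (rule ccontr)
    assume "?L w \<noteq> {}"
    then obtain W where W: "W \<in> intertwiners A b I x z" "b (W a) = W w" by auto
    from that obtain i where i: "i \<in> I" "w = z i" by auto
    have "b (W a) = b (W (x i))" using W i by (simp add: intertwiners_def)
    then have "W a = W (x i)" using permutes_inj[OF b] by (simp add: inj_eq)
    moreover have "inj W" using W permutes_inj by (auto simp: intertwiners_def)
    ultimately have "a = x i" by (simp add: inj_eq)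
    then show False using a i by auto
  qed
  have "card (intertwiners A b I x z) = (\<Sum>w\<in>A. card (?L w))"
    by (rule sum_card_intertwiners[OF A b a(1), symmetric])
  also have "\<dots> = (\<Sum>w\<in>A - E. card (?L w)) + (\<Sum>w\<in>E. card (?L w))"
    using sum.subset_diff[OF E(1) A] by blast
  also have "(\<Sum>w\<in>A - E. card (?L w)) \<le> (\<Sum>w\<in>A - E. card (?L c))"
  proof (rule sum_mono)
    fix w assume w: "w \<in> A - E"
    show "card (?L w) \<le> card (?L c)"
    proof (cases "w \<in> z ` I")
      case True then show ?thesis by (simp only: empty[OF True] card.empty le0)
    next
      case False
      then show ?thesis using w c
        by (intro eq_imp_le card_intertwiners_swap[OF A]) (auto simp: E_def)
    qed
  qed
  also have "\<dots> \<le> card A * card (?L c)" using A by (simp add: card_mono)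
  finally show ?thesis by (simp add: E_def)
qed

lemma card_permutes_prescribed_le:
  assumes A: "finite A" and I: "finite I" and u: "inj_on u I" "u ` I \<subseteq> A" and N: "card I \<le> N"
  shows "(card A - N) ^ card I * card {W. W permutes A \<and> (\<forall>i\<in>I. W (x i) = u i)} \<le> fact (card A)"
  using I u N
proof (induction I rule: finite_induct)
  case empty
  then show ?case using card_permutations[OF refl A] by simp
next
  case (insert j I)
  let ?P = "{W. W permutes A \<and> (\<forall>i\<in>I. W (x i) = u i)}"
  let ?E = "\<lambda>w. {W. W permutes A \<and> (\<forall>i\<in>I. W (x i) = u i) \<and> W (x j) = w}"
  have finP: "finite ?P" by (rule finite_subset[OF _ finite_permutations[OF A]]) auto
  have uj: "u j \<in> A - u ` I" using insert by (auto simp: inj_on_def)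
  have swap: "card (?E w) = card (?E (u j))" if w: "w \<in> A - u ` I" for w
  proof -
    define t where "t = Transposition.transpose (u j) w"
    have t: "t permutes A" unfolding t_def using uj w by (intro permutes_swap_id) auto
    have "u i \<noteq> u j \<and> u i \<noteq> w" if "i \<in> I" for i using that w uj by (auto simp: image_iff)
    then have tu: "t (u j) = w" "t w = u j" "\<And>i. i \<in> I \<Longrightarrow> t (u i) = u i"
      by (auto simp: t_def Transposition.transpose_def)
    have inv: "(\<lambda>W. t \<circ> W) ((\<lambda>W. t \<circ> W) W) = W" for W :: "'a \<Rightarrow> 'a" by (simp add: fun_eq_iff t_def)
    have "t \<circ> W \<in> ?E (u j)" if "W \<in> ?E w" for W
      using that permutes_compose[OF _ t, of W] by (simp add: tu)
    moreover have "t \<circ> W \<in> ?E w" if "W \<in> ?E (u j)" for W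
      using that permutes_compose[OF _ t, of W] by (simp add: tu)
    ultimately have "bij_betw (\<lambda>W. t \<circ> W) (?E w) (?E (u j))"
      by (intro bij_betw_byWitness[where f' = "\<lambda>W. t \<circ> W"] ballI inv image_subsetI)
    then show ?thesis by (rule bij_betw_same_card)
  qed
  have "(card A - N) * card (?E (u j)) \<le> card (A - u ` I) * card (?E (u j))"
  proof (rule mult_right_mono)
    show "card A - N \<le> card (A - u ` I)"
    proof -
      have "card (u ` I) \<le> N" using card_image_le[of I u] insert by simp
      then show ?thesis using diff_card_le_card_Diff[of "u ` I" A] insert.hyps by simp
    qed
  qed simp
  also have "\<dots> = (\<Sum>w\<in>A - u ` I. card (?E w))" using swap by simp
  also have "\<dots> = card (\<Union>w\<in>A - u ` I. ?E w)"
  proof (rule card_UN_disjoint[symmetric])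
    show "\<forall>w\<in>A - u ` I. finite (?E w)"
      by (intro ballI finite_subset[OF _ finP]) auto
  qed (use A in auto)
  also have "\<dots> \<le> card ?P" by (rule card_mono[OF finP]) auto
  finally have step: "(card A - N) * card (?E (u j)) \<le> card ?P" .
  have "(card A - N) ^ card (insert j I) * card {W. W permutes A \<and> (\<forall>i\<in>insert j I. W (x i) = u i)}
    = (card A - N) ^ card I * ((card A - N) * card (?E (u j)))"
  proof -
    have "{W. W permutes A \<and> (\<forall>i\<in>insert j I. W (x i) = u i)} = ?E (u j)" by auto
    then show ?thesis using insert by (simp add: mult_ac)
  qed
  also have "\<dots> \<le> (card A - N) ^ card I * card ?P" using step by (rule mult_left_mono) simp
  also have "\<dots> \<le> fact (card A)" using insert by auto
  finally show ?case .
qed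

text \<open>If the prescribed values permute the arguments, \<open>W\<close> restricted to the arguments is an embedding of
this permutation into \<open>b\<close>, and few \<open>W\<close> share the same restriction.\<close>

lemma card_intertwiners_closed_le:
  assumes A: "finite A" and I: "finite I" and N: "card I \<le> N"
    and x: "inj_on x I" "x ` I \<subseteq> A" and g: "\<And>i. i \<in> I \<Longrightarrow> z i = x (g i)" "g ` I \<subseteq> I"
  shows "(card A - N) ^ card I * card (intertwiners A b I x z)
    \<le> fact (card A) * card (embeddings I g A b)"
proof -
  let ?P = "\<lambda>u. {W. W permutes A \<and> (\<forall>i\<in>I. W (x i) = u i)}"
  have "intertwiners A b I x z \<subseteq> (\<Union>u\<in>embeddings I g A b. ?P u)"
  proof
    fix W assume W: "W \<in> intertwiners A b I x z"
    then have Wp: "W permutes A" by (simp add: intertwiners_def)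
    have "inj_on (\<lambda>i. W (x i)) I"
      using comp_inj_on[OF x(1) inj_on_subset[OF permutes_inj[OF Wp]]] by (simp add: comp_def)
    moreover have "b (W (x i)) = W (x (g i))" "g i \<in> I" "W (x i) \<in> A" if i: "i \<in> I" for i
    proof -
      show "b (W (x i)) = W (x (g i))" using W i g(1)[OF i] by (simp add: intertwiners_def)
      show "g i \<in> I" using g(2) i by blast
      have "x i \<in> A" using x(2) i by blast
      then show "W (x i) \<in> A" by (simp add: permutes_in_image[OF Wp])
    qed
    ultimately have "restrict (\<lambda>i. W (x i)) I \<in> embeddings I g A b"
      unfolding embeddings_def by (simp add: inj_on_restrict_eq)
    moreover have "W \<in> ?P (restrict (\<lambda>i. W (x i)) I)" using Wp by simp
    ultimately show "W \<in> (\<Union>u\<in>embeddings I g A b. ?P u)" by blast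
  qed
  moreover have fin: "finite (?P u)" for u
    by (rule finite_subset[OF _ finite_permutations[OF A]]) auto
  have finE: "finite (embeddings I g A b)" by (rule finite_embeddings[OF I A])
  ultimately have "card (intertwiners A b I x z) \<le> card (\<Union>u\<in>embeddings I g A b. ?P u)"
    using fin by (intro card_mono finite_UN_I) 
  also have "\<dots> \<le> (\<Sum>u\<in>embeddings I g A b. card (?P u))" by (rule card_UN_le[OF finE])
  finally have "card (intertwiners A b I x z) \<le> (\<Sum>u\<in>embeddings I g A b. card (?P u))" .
  then have "(card A - N) ^ card I * card (intertwiners A b I x z)
      \<le> (card A - N) ^ card I * (\<Sum>u\<in>embeddings I g A b. card (?P u))"
    by (rule mult_left_mono) simp
  also have "\<dots> = (\<Sum>u\<in>embeddings I g A b. (card A - N) ^ card I * card (?P u))"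
    by (rule sum_distrib_left)
  also have "\<dots> \<le> (\<Sum>u\<in>embeddings I g A b. fact (card A))"
    by (intro sum_mono card_permutes_prescribed_le A I N) (auto simp: embeddings_def)
  finally show ?thesis by (simp add: mult.commute)
qed

text \<open>Each cycle of length \<open>d\<close> contributes at most \<open>\<eta> r\<^sup>d\<close>.  Of the resulting powers of \<open>\<eta>\<close> a single one is
kept.\<close>

lemma card_embeddings_le_excess_bound:
  assumes g: "permutation g" and X: "finite X" "g ` X \<subseteq> X" and A: "finite A" "p permutes A"
    and \<eta>: "0 \<le> \<eta>" "\<eta> \<le> 1" "1 \<le> r"
    and few: "sparse_cycles \<eta> r A p"
  shows "real (card (embeddings X g A p)) \<le> excess_bound \<eta> r (card X)"
  using X
proof (induction "card X" arbitrary: X rule: less_induct)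
  case (less X)
  show ?case
  proof (cases "X = {}")
    case True
    then have "embeddings X g A p = {\<lambda>_. undefined}"
      by (auto simp: embeddings_def)
    then show ?thesis using True by (simp add: excess_bound_def)
  next
    case False
    then obtain x where x: "x \<in> X" by auto
    define C where "C = orbit g x"
    have CX: "C \<subseteq> X" unfolding C_def by (rule orbit_subset_invariant[OF less.prems(2) x])
    have xC: "x \<in> C" unfolding C_def by (rule permutation_self_in_orbit[OF g])
    have X': "finite (X - C)" "g ` (X - C) \<subseteq> X - C"
      using less.prems invariant_Diff_orbit[OF g less.prems(2)] by (auto simp: C_def)
    have C: "card C \<ge> 1" "finite C" using card_orbit_pos[OF g, of x] by (simp_all add: C_def Suc_le_eq)
    have cX: "card X = card (X - C) + card C"
      using card_Diff_subset[OF C(2) CX] card_mono[OF less.prems(1) CX] by linarith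
    have IH: "real (card (embeddings (X - C) g A p)) \<le> excess_bound \<eta> r (card (X - C))"
    proof (rule less.hyps)
      show "card (X - C) < card X" using C(1) cX by linarith
    qed (fact X')+
    have "card (embeddings X g A p) \<le> card (embeddings (X - C) g A p) * card (period_pts (card C) p A)"
      using card_embeddings_remove_orbit[OF g less.prems A x] by (simp add: C_def)
    then have "real (card (embeddings X g A p))
        \<le> real (card (embeddings (X - C) g A p)) * real (card (period_pts (card C) p A))"
      unfolding of_nat_mult[symmetric] of_nat_le_iff .
    also have "\<dots> \<le> r ^ card (X - C) * (\<eta> * r ^ card C)"
    proof (rule mult_mono)
      show "real (card (embeddings (X - C) g A p)) \<le> r ^ card (X - C)"
        using IH excess_bound_le_power[OF \<eta>] by (rule order.trans)
      show "real (card (period_pts (card C) p A)) \<le> \<eta> * r ^ card C" using few C(1) by (simp add: sparse_cycles_def)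
      show "0 \<le> r ^ card (X - C)" using \<eta>(3) by simp
    qed simp
    also have "\<dots> = excess_bound \<eta> r (card X)"
      using C(1) unfolding excess_bound_def cX by (auto simp: power_add)
    finally show ?thesis .
  qed
qed

text \<open>Prescribed values outside the arguments are removed one at a time, each at the cost of a factor
\<open>1 / (n - 2N)\<close>.  What is left is a permutation of the remaining arguments, whose number is at most the
number of values that were among the arguments to begin with.\<close>

proposition card_intertwiners_upper:
  assumes A: "finite A" and b: "b permutes A" and I: "finite I" "card I \<le> N" and n: "2 * N \<le> card A"
    and x: "inj_on x I" "x ` I \<subseteq> A" and z: "inj_on z I" "z ` I \<subseteq> A"
    and \<eta>: "0 \<le> \<eta>" "\<eta> \<le> 1" "1 \<le> \<eta> * r" "1 \<le> r"
    and few: "sparse_cycles \<eta> r A b"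
  shows "real (card A - 2 * N) ^ card I * card (intertwiners A b I x z)
    \<le> fact (card A) * excess_bound \<eta> r (card {i \<in> I. z i \<in> x ` I})"
  using I x z
proof (induction "card I" arbitrary: I)
  case 0
  then have "I = {}" by simp
  then show ?case using card_permutations[OF refl A] by (simp add: intertwiners_def excess_bound_def)
next
  case (Suc k I)
  have r: "r \<ge> 0" using \<eta> by simp
  show ?case
  proof (cases "z ` I \<subseteq> x ` I")
    case True
    define g where "g i = (if i \<in> I then inv_into I x (z i) else i)" for i
    have g: "x (g i) = z i" "g i \<in> I" if "i \<in> I" for i
      using that True by (auto simp: g_def f_inv_into_f inv_into_into image_subset_iff)
    have gI: "g ` I \<subseteq> I" using g by auto
    have "inj_on g I"
    proof (rule inj_onI)
      fix i k assume ik: "i \<in> I" "k \<in> I" "g i = g k"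
      then have "z i = z k" using g(1)[of i] g(1)[of k] by simp
      then show "i = k" using ik Suc.prems(5) by (simp add: inj_onD)
    qed
    then have gp: "g permutes I"
      using endo_inj_surj[OF Suc.prems(1) gI] by (intro bij_imp_permutes) (auto simp: bij_betw_def g_def)
    have s: "{i \<in> I. z i \<in> x ` I} = I" using True by auto
    have "real (card A - 2 * N) ^ card I * card (intertwiners A b I x z)
      \<le> real (card A - N) ^ card I * card (intertwiners A b I x z)"
      by (intro mult_right_mono power_mono) auto
    also have "\<dots> = real ((card A - N) ^ card I * card (intertwiners A b I x z))" by simp
    also have "\<dots> \<le> real (fact (card A) * card (embeddings I g A b))"
      using card_intertwiners_closed_le[OF A Suc.prems(1,2,3,4) g(1)[symmetric] gI, of b]
      unfolding of_nat_le_iff .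
    also have "\<dots> = fact (card A) * real (card (embeddings I g A b))" by simp
    also have "\<dots> \<le> fact (card A) * excess_bound \<eta> r (card I)"
      using gI Suc.prems(1)
      by (intro mult_left_mono card_embeddings_le_excess_bound[OF _ _ _ A b] permutation_of_permutes[OF gp] \<eta> few) auto
    finally show ?thesis unfolding s .
  next
    case False
    then obtain j where j: "j \<in> I" "z j \<notin> x ` I" by auto
    define J where "J = I - {j}"
    have J: "I = insert j J" "j \<notin> J" "finite J" "card J = k"
      using j Suc by (auto simp: J_def)
    have zj: "z j \<noteq> x j" "z j \<notin> x ` J" "z j \<notin> z ` J"
      using j J Suc.prems(5) by (auto simp: inj_on_def)
    have IH: "real (card A - 2 * N) ^ card J * card (intertwiners A b J x z)
      \<le> fact (card A) * excess_bound \<eta> r (card {i \<in> J. z i \<in> x ` J})"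
      using J Suc by (intro Suc.hyps(1)) (auto simp: inj_on_def)
    have "(card A - (2 * card J + 1)) * card (intertwiners A b I x z) \<le> card (intertwiners A b J x z)"
      unfolding J(1) intertwiners_insert using j J zj Suc.prems
      by (intro card_intertwiners_extend_le[OF A J(3) b]) auto
    moreover have "card A - 2 * N \<le> card A - (2 * card J + 1)"
      using J Suc by simp
    ultimately have "(card A - 2 * N) * card (intertwiners A b I x z) \<le> card (intertwiners A b J x z)"
      by (meson le_trans mult_le_mono1)
    then have step: "real (card A - 2 * N) * real (card (intertwiners A b I x z))
        \<le> real (card (intertwiners A b J x z))"
      unfolding of_nat_mult[symmetric] of_nat_le_iff .
    have "real (card A - 2 * N) ^ card I * card (intertwiners A b I x z)
      = real (card A - 2 * N) ^ card J * (real (card A - 2 * N) * card (intertwiners A b I x z))"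
      using J by simp
    also have "\<dots> \<le> real (card A - 2 * N) ^ card J * card (intertwiners A b J x z)"
      using step by (rule mult_left_mono) simp
    also have "\<dots> \<le> fact (card A) * excess_bound \<eta> r (card {i \<in> J. z i \<in> x ` J})" by (rule IH)
    also have "\<dots> \<le> fact (card A) * excess_bound \<eta> r (card {i \<in> I. z i \<in> x ` I})"
      using Suc.prems(1) J by (intro mult_left_mono excess_bound_mono \<eta> card_mono) auto
    finally show ?thesis .
  qed
qed

section \<open>Products of two random conjugates\<close>

text \<open>Adding the pairs \<open>x j \<mapsto> z j\<close> one at a time, all fresh values are equally likely, so the probability
drops by a factor of about \<open>n\<close> unless the value falls among the arguments.  The probability of the latter is
controlled by the upper bound with a single collision.\<close>

proposition card_intertwiners_lower:
  fixes \<eta> r :: real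
  assumes A: "finite A" and b: "b permutes A" and I: "finite I" "card I \<le> N" and n: "2 * N \<le> card A"
    and x: "inj_on x I" "x ` I \<subseteq> A" and z: "inj_on z I" "z ` I \<subseteq> A"
    and disj: "x ` I \<inter> z ` I = {}"
    and \<eta>: "0 \<le> \<eta>" "\<eta> \<le> 1" "1 \<le> \<eta> * r" "1 \<le> r" "r \<le> card A"
    and few: "sparse_cycles \<eta> r A b"
    and double: "\<forall>k\<le>N. real (card A) ^ k \<le> 2 * real (card A - 2 * N) ^ k"
  shows "fact (card A) * (1 - 2 * real N * \<eta> * real (card I))
    \<le> real (card A) ^ card I * card (intertwiners A b I x z)"
  using I x z disj
proof (induction I rule: finite_induct)
  case empty
  then show ?case using card_permutations[OF refl A] by (simp add: intertwiners_def)
next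
  case (insert j I)
  define n where "n = card A"
  let ?K = "\<lambda>w. card {W \<in> intertwiners A b I x z. b (W (x j)) = W w}"
  define E where "E = insert (x j) (x ` I) - z ` I"
  have n0: "real n > 0" using \<eta> by (simp add: n_def)
  have cI: "card (insert j I) = Suc (card I)" using insert by simp
  have xj: "x j \<in> A" "x j \<notin> x ` I" using insert.prems insert.hyps by (auto simp: inj_on_def)
  have zj: "z j \<in> A" "z j \<noteq> x j" "z j \<notin> x ` I" "z j \<notin> z ` I"
    using insert.prems insert.hyps by (auto simp: inj_on_def)
  have IH: "fact n * (1 - 2 * real N * \<eta> * real (card I)) \<le> real n ^ card I * card (intertwiners A b I x z)"
    unfolding n_def using insert.prems cI by (intro insert.IH) (auto simp: inj_on_def)
  have "card (intertwiners A b I x z) \<le> n * ?K (z j) + (\<Sum>w\<in>E. ?K w)"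
    unfolding n_def E_def
    by (rule card_intertwiners_le_extend[OF A insert.hyps(1) b xj zj]) (use insert.prems in auto)
  from of_nat_mono[OF this, where 'a = real]
  have le: "real (card (intertwiners A b I x z)) \<le> n * real (?K (z j)) + (\<Sum>w\<in>E. real (?K w))"
    by simp
  have Kw: "real n ^ card I * ?K w \<le> 2 * \<eta> * fact n" if w: "w \<in> E" for w
  proof -
    have wz: "w \<notin> z ` I" and wx: "w \<in> insert (x j) (x ` I)" using w by (auto simp: E_def)
    define z' where "z' = z(j := w)"
    have z': "z' j = w" "\<And>i. i \<in> I \<Longrightarrow> z' i = z i" using insert.hyps by (auto simp: z'_def)
    have int: "intertwiners A b (insert j I) x z' = {W \<in> intertwiners A b I x z. b (W (x j)) = W w}"
      using z' by (auto simp: intertwiners_def)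
    have im: "z' ` I = z ` I" using z'(2) by simp
    have "inj_on z I" using insert.prems by simp
    then have "inj_on z' I" using z'(2) by (metis inj_on_cong)
    then have inj: "inj_on z' (insert j I)"
      using wz insert.hyps by (simp add: im z')
    have sub: "z' ` insert j I \<subseteq> A" using insert.prems wx xj by (auto simp: im z')
    \<comment> \<open>The value \<open>w\<close> is the only collision, so the upper bound exceeds the generic one only by \<open>\<eta> r\<close>.\<close>
    have "{i \<in> insert j I. z' i \<in> x ` insert j I} = {j}"
    proof -
      have "z' i \<notin> x ` insert j I" if "i \<in> I" for i
      proof -
        have "z i \<in> z ` insert j I" using that by simp
        then have "z i \<notin> x ` insert j I" using insert.prems(6) by blast
        then show ?thesis using z'(2)[OF that] by simp
      qed
      moreover have "z' j \<in> x ` insert j I" using wx z'(1) by simp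
      ultimately show ?thesis by blast
    qed
    then have "real (card A - 2 * N) ^ Suc (card I) * ?K w \<le> fact n * (\<eta> * r)"
      using card_intertwiners_upper[OF A b _ _ n insert.prems(2,3) inj sub \<eta>(1-4) few] insert
      unfolding int by (simp add: n_def excess_bound_def)
    then have "2 * (real (card A - 2 * N) ^ Suc (card I) * ?K w) \<le> 2 * (fact n * (\<eta> * r))" by simp
    moreover have "real n ^ Suc (card I) * ?K w \<le> 2 * real (card A - 2 * N) ^ Suc (card I) * ?K w"
      unfolding n_def using double[rule_format, of "Suc (card I)"] insert.prems(1) cI
      by (intro mult_right_mono) simp_all
    ultimately have "real n * (real n ^ card I * ?K w) \<le> 2 * (fact n * (\<eta> * r))"
      by (simp add: mult_ac)
    also have "\<dots> \<le> 2 * (fact n * (\<eta> * n))"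
      using \<eta> by (intro mult_left_mono) (auto simp: n_def)
    also have "\<dots> = real n * (2 * \<eta> * fact n)" by simp
    finally show ?thesis using n0 by simp
  qed
  have cE: "card E \<le> N"
  proof -
    have "card E \<le> card (insert (x j) (x ` I))"
      unfolding E_def using insert.hyps by (intro card_mono) auto
    also have "\<dots> \<le> card (insert j I)"
      using card_image_le[of "insert j I" x] insert.hyps by simp
    finally show ?thesis using insert.prems by simp
  qed
  have "(\<Sum>w\<in>E. real n ^ card I * real (?K w)) \<le> (\<Sum>w\<in>E. 2 * \<eta> * fact n)"
    using Kw by (intro sum_mono) auto
  also have "\<dots> = real (card E) * (2 * \<eta> * fact n)" by simp
  also have "\<dots> \<le> real N * (2 * \<eta> * fact n)"
    using cE \<eta> by (intro mult_right_mono) auto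
  finally have err: "real n ^ card I * (\<Sum>w\<in>E. real (?K w)) \<le> real N * (2 * \<eta> * fact n)"
    by (simp add: sum_distrib_left)
  have "real n ^ card I * real (card (intertwiners A b I x z))
      \<le> real n ^ card I * (n * real (?K (z j)) + (\<Sum>w\<in>E. real (?K w)))"
    using le by (rule mult_left_mono) simp
  also have "\<dots> = real n ^ card (insert j I) * ?K (z j) + real n ^ card I * (\<Sum>w\<in>E. real (?K w))"
    unfolding cI by (simp add: algebra_simps)
  finally have "fact n * (1 - 2 * real N * \<eta> * real (card I)) - real N * (2 * \<eta> * fact n)
      \<le> real n ^ card (insert j I) * ?K (z j)"
    using IH err by linarith
  then show ?case
    unfolding intertwiners_insert cI n_def[symmetric] by (simp add: algebra_simps)
qed

definition conj_pairs :: "'a set \<Rightarrow> ('a \<Rightarrow> 'a) \<Rightarrow> ('a \<Rightarrow> 'a) \<Rightarrow> ('a \<Rightarrow> 'a) \<Rightarrow> 'i set \<Rightarrow> ('i \<Rightarrow> 'a) \<Rightarrow> ('i \<Rightarrow> 'a)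
    \<Rightarrow> (('a \<Rightarrow> 'a) \<times> ('a \<Rightarrow> 'a)) set"
  where "conj_pairs A a Q b I x y = {(W1, W2). W1 permutes A \<and> W2 permutes A \<and>
    (\<forall>i\<in>I. (inv W2 \<circ> a \<circ> W2) (Q ((inv W1 \<circ> b \<circ> W1) (x i))) = y i)}"

text \<open>Decomposition according to the intermediate points \<open>z i = W1\<^sup>-\<^sup>1 b W1 (x i)\<close>.  The second condition
\<open>W2\<^sup>-\<^sup>1 a W2 (Q (z i)) = y i\<close> is rewritten with the inverse of \<open>a\<close>, so that both conditions
have known arguments \<open>x\<close>, \<open>y\<close> and values that depend on \<open>z\<close>.\<close>

lemma card_conj_pairs:
  assumes A: "finite A" and a: "a permutes A" and b: "b permutes A" and Q: "Q permutes A"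
    and I: "finite I" and x: "inj_on x I" "x ` I \<subseteq> A"
  shows "card (conj_pairs A a Q b I x y) = (\<Sum>z\<in>{z \<in> I \<rightarrow>\<^sub>E A. inj_on z I}.
    card (intertwiners A b I x z) * card (intertwiners A (inv a) I y (\<lambda>i. Q (z i))))"
proof -
  let ?Z = "{z \<in> I \<rightarrow>\<^sub>E A. inj_on z I}"
  let ?S = "\<lambda>z. intertwiners A b I x z \<times> intertwiners A (inv a) I y (\<lambda>i. Q (z i))"
  have mid: "b (W (x i)) = W w \<longleftrightarrow> (inv W \<circ> b \<circ> W) (x i) = w" if "W permutes A" for W i w
    using permutes_inv_eq[OF that] by auto
  have out: "inv a (W v) = W w \<longleftrightarrow> (inv W \<circ> a \<circ> W) w = v" if "W permutes A" for W v w
    using permutes_inv_eq[OF that] permutes_inv_eq[OF a] by auto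
  have "conj_pairs A a Q b I x y = (\<Union>z\<in>?Z. ?S z)"
  proof (intro equalityI subsetI)
    fix V assume V: "V \<in> conj_pairs A a Q b I x y"
    obtain W1 W2 where W: "V = (W1, W2)" by (cases V)
    have p: "W1 permutes A" "W2 permutes A" using V W by (auto simp: conj_pairs_def)
    define c where "c = inv W1 \<circ> b \<circ> W1"
    have c: "c permutes A" unfolding c_def by (intro permutes_compose permutes_inv p b)
    define z where "z = restrict (c \<circ> x) I"
    have "inj_on (c \<circ> x) I"
      using x by (intro comp_inj_on inj_on_subset[OF permutes_inj[OF c]]) auto
    moreover have "c (x i) \<in> A" if "i \<in> I" for i
      using that x by (auto simp: permutes_in_image[OF c])
    ultimately have "z \<in> ?Z" by (simp add: z_def inj_on_restrict_eq)
    moreover have "V \<in> ?S z"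
      using V p by (simp add: W intertwiners_def mid out z_def c_def conj_pairs_def)
    ultimately show "V \<in> (\<Union>z\<in>?Z. ?S z)" by blast
  next
    fix V assume "V \<in> (\<Union>z\<in>?Z. ?S z)"
    then obtain z W1 W2 where V: "V = (W1, W2)" and W: "W1 \<in> intertwiners A b I x z"
      "W2 \<in> intertwiners A (inv a) I y (\<lambda>i. Q (z i))" by auto
    then have p: "W1 permutes A" "W2 permutes A" by (auto simp: intertwiners_def)
    have "(inv W1 \<circ> b \<circ> W1) (x i) = z i" "(inv W2 \<circ> a \<circ> W2) (Q (z i)) = y i" if "i \<in> I" for i
      using W that mid[OF p(1)] out[OF p(2)] by (simp_all add: intertwiners_def)
    then show "V \<in> conj_pairs A a Q b I x y"
      using p unfolding conj_pairs_def V by simp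
  qed
  moreover have "?S z \<inter> ?S z' = {}" if zz: "z \<in> ?Z" "z' \<in> ?Z" "z \<noteq> z'" for z z'
  proof (rule ccontr)
    assume "?S z \<inter> ?S z' \<noteq> {}"
    then obtain W where W: "W \<in> intertwiners A b I x z" "W \<in> intertwiners A b I x z'" by auto
    have "z i = z' i" for i
    proof (cases "i \<in> I")
      case True
      then have "W (z i) = W (z' i)" using W by (simp add: intertwiners_def)
      moreover have "inj W" using W permutes_inj by (auto simp: intertwiners_def)
      ultimately show ?thesis by (simp add: inj_eq)
    next
      case False
      then show ?thesis using zz by (auto simp: PiE_def extensional_def)
    qed
    then show False using zz(3) by auto
  qed
  moreover have "finite ?Z"
    by (rule finite_subset[of _ "I \<rightarrow>\<^sub>E A"]) (auto intro: finite_PiE I A)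
  moreover have "finite (?S z)" for z by (intro finite_cartesian_product finite_intertwiners A)
  ultimately have "card (conj_pairs A a Q b I x y) = (\<Sum>z\<in>?Z. card (?S z))"
    using card_UN_disjoint[of ?Z ?S] by simp
  then show ?thesis by (simp add: card_cartesian_product)
qed

lemma sparse_cycles_inv:
  assumes "permutation a" "sparse_cycles \<eta> r A a"
  shows "sparse_cycles \<eta> r A (inv a)"
  using orbit_inv_eq[OF assms(1)] assms(2) by (simp add: sparse_cycles_def period_pts_def)

text \<open>The coordinates of \<open>z\<close> are independent, so the generating function of the number of hits factorizes.\<close>

lemma sum_power_hits:
  fixes q :: real
  assumes I: "finite I" and A: "finite A" and H: "H \<subseteq> A"
  shows "(\<Sum>z\<in>I \<rightarrow>\<^sub>E A. q ^ card {i \<in> I. z i \<in> H}) = (q * card H + (card A - card H)) ^ card I"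
proof -
  have "(\<Sum>z\<in>I \<rightarrow>\<^sub>E A. q ^ card {i \<in> I. z i \<in> H})
      = (\<Sum>z\<in>I \<rightarrow>\<^sub>E A. \<Prod>i\<in>I. if z i \<in> H then q else 1)"
    using I by (simp add: prod.If_cases Int_def)
  also have "\<dots> = (\<Prod>i\<in>I. \<Sum>w\<in>A. if w \<in> H then q else 1)"
    by (rule prod_sum_PiE[symmetric]) (use I A in auto)
  also have "(\<Sum>w\<in>A. if w \<in> H then q else 1) = q * card H + (card A - card H)"
    using A H by (simp add: sum.If_cases Int_absorb1 Int_Diff card_Diff_subset[OF finite_subset[OF H A] H]
        Diff_eq[symmetric] card_mono of_nat_diff mult.commute)
  finally show ?thesis by simp
qed

lemma excess_bound_square_le:
  assumes "0 \<le> \<eta>" "0 \<le> r"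
  shows "(excess_bound \<eta> r s)\<^sup>2 \<le> 1 + \<eta>\<^sup>2 * (r\<^sup>2) ^ s"
  using assms by (auto simp: excess_bound_def power_mult_distrib power_mult[symmetric] mult.commute)

text \<open>Both probabilities are bounded in terms of the number \<open>s z\<close> of indices whose intermediate point lies
in the set \<open>H\<close> of at most \<open>2N\<close> points that are already present.  The average of \<open>n\<close> to the power \<open>s z\<close> over all
\<open>z\<close> is bounded, because a coordinate falls into \<open>H\<close> with probability at most \<open>2N / n\<close>.\<close>

proposition card_conj_pairs_upper:
  fixes \<eta> r :: real
  assumes A: "finite A" and a: "a permutes A" and b: "b permutes A" and Q: "Q permutes A"
    and I: "finite I" and n: "2 * card I \<le> card A"
    and x: "inj_on x I" "x ` I \<subseteq> A" and y: "inj_on y I" "y ` I \<subseteq> A"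
    and \<eta>: "0 \<le> \<eta>" "\<eta> \<le> 1" "1 \<le> \<eta> * r" "1 \<le> r" "r\<^sup>2 = card A"
    and few: "sparse_cycles \<eta> r A a" "sparse_cycles \<eta> r A b"
  shows "real (card A - 2 * card I) ^ (2 * card I) * card (conj_pairs A a Q b I x y)
    \<le> (fact (card A))\<^sup>2 * real (card A) ^ card I * (1 + \<eta>\<^sup>2 * real (2 * card I + 1) ^ card I)"
proof -
  define N where "N = card I"
  define n where "n = card A"
  let ?Z = "{z \<in> I \<rightarrow>\<^sub>E A. inj_on z I}"
  let ?K1 = "\<lambda>z. real (card (intertwiners A b I x z))"
    and ?K2 = "\<lambda>z. real (card (intertwiners A (inv a) I y (\<lambda>i. Q (z i))))"
  define H where "H = x ` I \<union> inv Q ` (y ` I)"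
  have HA: "H \<subseteq> A" using x y permutes_in_image[OF permutes_inv[OF Q]] by (auto simp: H_def)
  have cH: "card H \<le> 2 * N"
  proof -
    have "card H \<le> card (x ` I) + card (inv Q ` (y ` I))" unfolding H_def by (rule card_Un_le)
    also have "\<dots> \<le> card I + card I"
      unfolding image_image using I by (intro add_mono card_image_le)
    finally show ?thesis by (simp add: N_def)
  qed
  define s where "s z = card {i \<in> I. z i \<in> H}" for z
  have n1: "real n \<ge> 1" using \<eta>(4,5) by (simp add: n_def flip: \<eta>(5))
  have K1: "real (n - 2 * N) ^ N * ?K1 z \<le> fact n * excess_bound \<eta> r (s z)" if z: "z \<in> ?Z" for z
  proof -
    have "real (n - 2 * N) ^ N * ?K1 z \<le> fact n * excess_bound \<eta> r (card {i \<in> I. z i \<in> x ` I})"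
      unfolding n_def N_def using z
      by (intro card_intertwiners_upper[OF A b I order.refl n x _ _ \<eta>(1-4) few(2)]) auto
    also have "\<dots> \<le> fact n * excess_bound \<eta> r (s z)"
      unfolding s_def using I by (intro mult_left_mono excess_bound_mono \<eta> card_mono) (auto simp: H_def)
    finally show ?thesis .
  qed
  have K2: "real (n - 2 * N) ^ N * ?K2 z \<le> fact n * excess_bound \<eta> r (s z)" if z: "z \<in> ?Z" for z
  proof -
    have "inj_on (Q \<circ> z) I"
      using z by (intro comp_inj_on inj_on_subset[OF permutes_inj[OF Q]]) auto
    moreover have "(\<lambda>i. Q (z i)) ` I \<subseteq> A" using z permutes_in_image[OF Q] by auto
    ultimately have "real (n - 2 * N) ^ N * ?K2 z
        \<le> fact n * excess_bound \<eta> r (card {i \<in> I. Q (z i) \<in> y ` I})"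
      unfolding n_def N_def
      by (intro card_intertwiners_upper[OF A permutes_inv[OF a] I _ n y _ _ \<eta>(1-4)]
          sparse_cycles_inv[OF permutation_of_permutes[OF a A] few(1)]) (simp_all add: comp_def)
    also have "\<dots> \<le> fact n * excess_bound \<eta> r (s z)"
    proof -
      have "z i \<in> H" if "Q (z i) \<in> y ` I" for i
      proof -
        have "inv Q (Q (z i)) \<in> inv Q ` (y ` I)" using that by (rule imageI)
        then show ?thesis using permutes_inverses[OF Q] by (simp add: H_def)
      qed
      then show ?thesis
        unfolding s_def using I by (intro mult_left_mono excess_bound_mono \<eta> card_mono) auto
    qed
    finally show ?thesis .
  qed
  have "real (n - 2 * N) ^ (2 * N) * card (conj_pairs A a Q b I x y)
    = (\<Sum>z\<in>?Z. (real (n - 2 * N) ^ N * ?K1 z) * (real (n - 2 * N) ^ N * ?K2 z))"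
    unfolding card_conj_pairs[OF A a b Q I x] mult_2 power_add
    by (simp add: sum_distrib_left mult_ac)
  also have "\<dots> \<le> (\<Sum>z\<in>?Z. (fact n * excess_bound \<eta> r (s z)) * (fact n * excess_bound \<eta> r (s z)))"
  proof (rule sum_mono)
    fix z assume z: "z \<in> ?Z"
    show "(real (n - 2 * N) ^ N * ?K1 z) * (real (n - 2 * N) ^ N * ?K2 z)
        \<le> (fact n * excess_bound \<eta> r (s z)) * (fact n * excess_bound \<eta> r (s z))"
      by (rule mult_mono[OF K1[OF z] K2[OF z]]) (use excess_bound_nonneg[of \<eta> r] \<eta> in simp_all)
  qed
  also have "\<dots> = (\<Sum>z\<in>?Z. (fact n)\<^sup>2 * (excess_bound \<eta> r (s z))\<^sup>2)"
    by (simp add: power2_eq_square mult_ac)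
  also have "\<dots> \<le> (\<Sum>z\<in>I \<rightarrow>\<^sub>E A. (fact n)\<^sup>2 * (excess_bound \<eta> r (s z))\<^sup>2)"
    using I A by (intro sum_mono2) (auto intro: finite_PiE)
  also have "\<dots> \<le> (\<Sum>z\<in>I \<rightarrow>\<^sub>E A. (fact n)\<^sup>2 * (1 + \<eta>\<^sup>2 * real n ^ s z))"
    using excess_bound_square_le[of \<eta> r] \<eta> by (intro sum_mono mult_left_mono) (auto simp: n_def)
  also have "\<dots> = (fact n)\<^sup>2 * (real n ^ N + \<eta>\<^sup>2 * (\<Sum>z\<in>I \<rightarrow>\<^sub>E A. real n ^ s z))"
    using I by (simp add: sum.distrib sum_distrib_left[symmetric] card_funcsetE n_def N_def)
  also have "(\<Sum>z\<in>I \<rightarrow>\<^sub>E A. real n ^ s z) = (real n * card H + (n - card H)) ^ N"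
    unfolding s_def using sum_power_hits[OF I A HA, of "real n"] card_mono[OF A HA]
    by (simp add: n_def N_def of_nat_diff)
  also have "(fact n)\<^sup>2 * (real n ^ N + \<eta>\<^sup>2 * \<dots>) \<le> (fact n)\<^sup>2 * (real n ^ N + \<eta>\<^sup>2 * (real n * real (2 * N + 1)) ^ N)"
  proof -
    have "real n * card H + real (n - card H) \<le> real n * (2 * N) + real n"
      using cH by (intro add_mono mult_left_mono) auto
    then show ?thesis
      by (intro mult_left_mono add_left_mono power_mono) (auto simp: algebra_simps)
  qed
  also have "\<dots> = (fact n)\<^sup>2 * real n ^ N * (1 + \<eta>\<^sup>2 * real (2 * N + 1) ^ N)"
    unfolding power_mult_distrib by (simp add: distrib_left mult_ac)
  finally show ?thesis by (simp add: n_def N_def)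
qed

lemma card_injections_ge:
  assumes I: "finite I" and B: "finite B" and k: "k + card I \<le> card B"
  shows "k ^ card I \<le> card {f \<in> I \<rightarrow>\<^sub>E B. inj_on f I}"
proof -
  have "k ^ card I = (\<Prod>i\<in>{0..<card I}. k)" by simp
  also have "\<dots> \<le> (\<Prod>i\<in>{0..<card I}. card B - i)"
    using k by (intro prod_mono) auto
  also have "\<dots> = card {f \<in> I \<rightarrow>\<^sub>E B. inj_on f I}"
    using card_inj_on_subset_funcset[OF I B subset_refl] by simp
  finally show ?thesis .
qed

text \<open>It is enough to count the intermediate tuples that avoid all points already present: almost all
tuples are of this kind.\<close>

proposition card_conj_pairs_lower:
  fixes \<eta> r :: real
  assumes A: "finite A" and a: "a permutes A" and b: "b permutes A" and Q: "Q permutes A"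
    and I: "finite I" and n: "3 * card I \<le> card A"
    and x: "inj_on x I" "x ` I \<subseteq> A" and y: "inj_on y I" "y ` I \<subseteq> A"
    and \<eta>: "0 \<le> \<eta>" "\<eta> \<le> 1" "1 \<le> \<eta> * r" "1 \<le> r" "r \<le> card A"
    and few: "sparse_cycles \<eta> r A a" "sparse_cycles \<eta> r A b"
    and double: "\<forall>k\<le>card I. real (card A) ^ k \<le> 2 * real (card A - 2 * card I) ^ k"
    and small: "2 * real (card I) ^ 2 * \<eta> \<le> 1"
  shows "(fact (card A))\<^sup>2 * real (card A - 3 * card I) ^ card I * (1 - 2 * real (card I) ^ 2 * \<eta>)\<^sup>2
    \<le> real (card A) ^ (2 * card I) * card (conj_pairs A a Q b I x y)"
proof -
  define N where "N = card I"
  define n where "n = card A"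
  let ?Z = "{z \<in> I \<rightarrow>\<^sub>E A. inj_on z I}"
  let ?K1 = "\<lambda>z. real (card (intertwiners A b I x z))"
    and ?K2 = "\<lambda>z. real (card (intertwiners A (inv a) I y (\<lambda>i. Q (z i))))"
  define H where "H = x ` I \<union> inv Q ` (y ` I)"
  have HA: "H \<subseteq> A" using x y permutes_in_image[OF permutes_inv[OF Q]] by (auto simp: H_def)
  have cH: "card H \<le> 2 * N"
  proof -
    have "card H \<le> card (x ` I) + card (inv Q ` (y ` I))" unfolding H_def by (rule card_Un_le)
    also have "\<dots> \<le> card I + card I"
      unfolding image_image using I by (intro add_mono card_image_le)
    finally show ?thesis by (simp add: N_def)
  qed
  let ?G = "{z \<in> I \<rightarrow>\<^sub>E (A - H). inj_on z I}"
  have GZ: "?G \<subseteq> ?Z" by (auto simp: PiE_iff)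
  have finZ: "finite ?Z" by (rule finite_subset[of _ "I \<rightarrow>\<^sub>E A"]) (auto intro: finite_PiE I A)
  define c where "c = fact n * (1 - 2 * real N ^ 2 * \<eta>)"
  have c: "fact (card A) * (1 - 2 * real (card I) * \<eta> * real (card I)) = c"
    by (simp add: c_def n_def N_def power2_eq_square)
  have c0: "c \<ge> 0" using small by (simp add: c_def N_def)
  have n2: "2 * card I \<le> card A" using n by simp
  have K1: "c \<le> real n ^ N * ?K1 z" if z: "z \<in> ?G" for z
  proof -
    have zA: "z ` I \<subseteq> A" "z ` I \<inter> H = {}" using z by auto
    then have "x ` I \<inter> z ` I = {}" by (auto simp: H_def)
    then show ?thesis
      using card_intertwiners_lower[OF A b I order.refl n2 x _ zA(1) _ \<eta> few(2) double] z
      unfolding c n_def N_def by blast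
  qed
  have K2: "c \<le> real n ^ N * ?K2 z" if z: "z \<in> ?G" for z
  proof -
    have zA: "z ` I \<subseteq> A" "z ` I \<inter> H = {}" using z by auto
    have inj: "inj_on (\<lambda>i. Q (z i)) I"
      using z comp_inj_on[of z I Q, OF _ inj_on_subset[OF permutes_inj[OF Q]]]
      by (simp add: comp_def)
    have QA: "(\<lambda>i. Q (z i)) ` I \<subseteq> A"
      using zA(1) by (intro image_subsetI) (auto simp: permutes_in_image[OF Q])
    have Qy: "Q (z i) \<notin> y ` I" if "i \<in> I" for i
    proof
      assume "Q (z i) \<in> y ` I"
      then have "inv Q (Q (z i)) \<in> inv Q ` (y ` I)" by (rule imageI)
      then have "z i \<in> H" using permutes_inverses[OF Q] by (simp add: H_def)
      then show False using zA that by blast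
    qed
    have disj: "y ` I \<inter> (\<lambda>i. Q (z i)) ` I = {}"
    proof (rule equals0I)
      fix w assume "w \<in> y ` I \<inter> (\<lambda>i. Q (z i)) ` I"
      then obtain i where "i \<in> I" "w = Q (z i)" "w \<in> y ` I" by blast
      then show False using Qy by simp
    qed
    have few': "sparse_cycles \<eta> r A (inv a)"
      by (rule sparse_cycles_inv[OF permutation_of_permutes[OF a A] few(1)])
    show ?thesis
      using card_intertwiners_lower[OF A permutes_inv[OF a] I order.refl n2 y inj QA disj \<eta> few' double]
      unfolding c n_def N_def .
  qed
  have cG: "real (n - 3 * N) ^ N \<le> card ?G"
  proof -
    have "n - 3 * N + card I \<le> card (A - H)"
      using cH n card_Diff_subset[OF finite_subset[OF HA A] HA] unfolding n_def N_def by linarith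
    then have "(n - 3 * N) ^ N \<le> card ?G"
      unfolding N_def using card_injections_ge[OF I, of "A - H"] A by simp
    then show ?thesis unfolding of_nat_power[symmetric] of_nat_le_iff .
  qed
  have "(fact n)\<^sup>2 * real (n - 3 * N) ^ N * (1 - 2 * real N ^ 2 * \<eta>)\<^sup>2 = real (n - 3 * N) ^ N * c\<^sup>2"
    by (simp add: c_def power_mult_distrib)
  also have "\<dots> \<le> card ?G * c\<^sup>2" using cG by (intro mult_right_mono) auto
  also have "\<dots> = (\<Sum>z\<in>?G. c * c)" by (simp add: power2_eq_square)
  also have "\<dots> \<le> (\<Sum>z\<in>?G. (real n ^ N * ?K1 z) * (real n ^ N * ?K2 z))"
    using K1 K2 c0 by (intro sum_mono mult_mono) auto
  also have "\<dots> \<le> (\<Sum>z\<in>?Z. (real n ^ N * ?K1 z) * (real n ^ N * ?K2 z))"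
    using finZ GZ by (intro sum_mono2) auto
  also have "\<dots> = real n ^ (2 * N) * card (conj_pairs A a Q b I x y)"
    unfolding card_conj_pairs[OF A a b Q I x] mult_2 power_add
    by (simp add: sum_distrib_left mult_ac)
  finally show ?thesis by (simp add: n_def N_def)
qed

section \<open>Binomial moments of averaged products\<close>

lemma sum_embeddings_eq_sum_conj_pairs:
  assumes A: "finite A" and I: "finite I" and P: "P permutes A"
  shows "(\<Sum>W1\<in>{W. W permutes A}. \<Sum>W2\<in>{W. W permutes A}.
      card (embeddings I g A (P \<circ> (inv W2 \<circ> a \<circ> W2) \<circ> Q \<circ> (inv W1 \<circ> b \<circ> W1) \<circ> R)))
    = (\<Sum>u\<in>{u \<in> I \<rightarrow>\<^sub>E A. inj_on u I}. card (conj_pairs A a Q b I (R \<circ> u) (inv P \<circ> u \<circ> g)))"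
proof -
  let ?S = "{W. W permutes A}" and ?Z = "{u \<in> I \<rightarrow>\<^sub>E A. inj_on u I}"
  let ?p = "\<lambda>W1 W2. P \<circ> (inv W2 \<circ> a \<circ> W2) \<circ> Q \<circ> (inv W1 \<circ> b \<circ> W1) \<circ> R"
  define c where "c u W = (\<forall>i\<in>I. ?p (fst W) (snd W) (u i) = u (g i))" for u and W :: "('a \<Rightarrow> 'a) \<times> ('a \<Rightarrow> 'a)"
  have fin: "finite ?S" "finite ?Z"
    using finite_permutations[OF A] finite_subset[of ?Z "I \<rightarrow>\<^sub>E A"] finite_PiE[OF I, of "\<lambda>_. A"] A by auto
  have "(\<Sum>W1\<in>?S. \<Sum>W2\<in>?S. card (embeddings I g A (?p W1 W2)))
      = (\<Sum>W\<in>?S \<times> ?S. card (embeddings I g A (?p (fst W) (snd W))))"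
    by (simp add: sum.cartesian_product split_beta)
  also have "\<dots> = (\<Sum>W\<in>?S \<times> ?S. \<Sum>u\<in>?Z. if c u W then 1 else 0)"
  proof (rule sum.cong[OF refl])
    fix W
    have "embeddings I g A (?p (fst W) (snd W)) = {u \<in> ?Z. c u W}"
      by (auto simp: embeddings_def c_def)
    then show "card (embeddings I g A (?p (fst W) (snd W))) = (\<Sum>u\<in>?Z. if c u W then 1 else 0)"
      using fin by (simp add: sum.If_cases Int_def)
  qed
  also have "\<dots> = (\<Sum>u\<in>?Z. \<Sum>W\<in>?S \<times> ?S. if c u W then 1 else 0)" by (rule sum.swap)
  also have "\<dots> = (\<Sum>u\<in>?Z. card (conj_pairs A a Q b I (R \<circ> u) (inv P \<circ> u \<circ> g)))"
  proof (rule sum.cong[OF refl])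
    fix u
    have "P v = w \<longleftrightarrow> v = inv P w" for v w using permutes_inv_eq[OF P, of w v] by metis
    then have "conj_pairs A a Q b I (R \<circ> u) (inv P \<circ> u \<circ> g) = {W \<in> ?S \<times> ?S. c u W}"
      by (auto simp: conj_pairs_def c_def)
    then show "(\<Sum>W\<in>?S \<times> ?S. if c u W then 1 else 0) = card (conj_pairs A a Q b I (R \<circ> u) (inv P \<circ> u \<circ> g))"
      using fin by (simp add: sum.If_cases Int_def)
  qed
  finally show ?thesis .
qed

text \<open>With \<open>g = id\<close> this covers the arguments \<open>R \<circ> u\<close>, and with a general \<open>g\<close> the values
\<open>P\<^sup>-\<^sup>1 \<circ> u \<circ> g\<close> of the conditions on an embedding \<open>u\<close>.\<close>

lemma permuted_injection:
  assumes p: "p permutes A" and g: "g permutes I" and u: "inj_on u I" "u ` I \<subseteq> A"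
  shows "inj_on (p \<circ> u \<circ> g) I" "(p \<circ> u \<circ> g) ` I \<subseteq> A"
proof -
  have gI: "g ` I = I" by (rule permutes_image[OF g])
  have "inj_on (u \<circ> g) I"
    by (rule comp_inj_on[OF inj_on_subset[OF permutes_inj[OF g]]]) (simp_all add: gI u)
  then show "inj_on (p \<circ> u \<circ> g) I"
    unfolding comp_assoc by (rule comp_inj_on[OF _ inj_on_subset[OF permutes_inj[OF p]]]) simp
  have "(p \<circ> u \<circ> g) ` I = p ` u ` I" unfolding image_comp[symmetric] gI ..
  also have "\<dots> \<subseteq> p ` A" using u(2) by (rule image_mono)
  finally show "(p \<circ> u \<circ> g) ` I \<subseteq> A" by (simp add: permutes_image[OF p])
qed

proposition average_embeddings_upper:
  fixes \<eta> r :: real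
  assumes A: "finite A" and a: "a permutes A" and b: "b permutes A"
    and P: "P permutes A" and Q: "Q permutes A" and R: "R permutes A"
    and I: "finite I" and g: "g permutes I" and n: "2 * card I \<le> card A"
    and \<eta>: "0 \<le> \<eta>" "\<eta> \<le> 1" "1 \<le> \<eta> * r" "1 \<le> r" "r\<^sup>2 = card A"
    and few: "sparse_cycles \<eta> r A a" "sparse_cycles \<eta> r A b"
  shows "real (card A - 2 * card I) ^ (2 * card I) * (\<Sum>W1\<in>{W. W permutes A}. \<Sum>W2\<in>{W. W permutes A}.
      real (card (embeddings I g A (P \<circ> (inv W2 \<circ> a \<circ> W2) \<circ> Q \<circ> (inv W1 \<circ> b \<circ> W1) \<circ> R))))
    \<le> (fact (card A))\<^sup>2 * real (card A) ^ (2 * card I) * (1 + \<eta>\<^sup>2 * real (2 * card I + 1) ^ card I)"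
proof -
  let ?Z = "{u \<in> I \<rightarrow>\<^sub>E A. inj_on u I}"
  let ?B = "(fact (card A))\<^sup>2 * real (card A) ^ card I * (1 + \<eta>\<^sup>2 * real (2 * card I + 1) ^ card I)"
  have xy: "inj_on (R \<circ> u) I" "(R \<circ> u) ` I \<subseteq> A" "inj_on (inv P \<circ> u \<circ> g) I" "(inv P \<circ> u \<circ> g) ` I \<subseteq> A"
    if u: "u \<in> ?Z" for u
    using u permuted_injection[OF R permutes_id, of u I] permuted_injection[OF permutes_inv[OF P] g, of u]
    by auto
  have "(\<Sum>W1\<in>{W. W permutes A}. \<Sum>W2\<in>{W. W permutes A}.
      real (card (embeddings I g A (P \<circ> (inv W2 \<circ> a \<circ> W2) \<circ> Q \<circ> (inv W1 \<circ> b \<circ> W1) \<circ> R))))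
    = (\<Sum>u\<in>?Z. real (card (conj_pairs A a Q b I (R \<circ> u) (inv P \<circ> u \<circ> g))))"
    using arg_cong[OF sum_embeddings_eq_sum_conj_pairs[OF A I P, of g a Q b R], of real] by simp
  then have "real (card A - 2 * card I) ^ (2 * card I) * (\<Sum>W1\<in>{W. W permutes A}. \<Sum>W2\<in>{W. W permutes A}.
      real (card (embeddings I g A (P \<circ> (inv W2 \<circ> a \<circ> W2) \<circ> Q \<circ> (inv W1 \<circ> b \<circ> W1) \<circ> R))))
    = (\<Sum>u\<in>?Z. real (card A - 2 * card I) ^ (2 * card I)
        * real (card (conj_pairs A a Q b I (R \<circ> u) (inv P \<circ> u \<circ> g))))"
    by (simp add: sum_distrib_left)
  also have "\<dots> \<le> (\<Sum>u\<in>?Z. ?B)"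
    by (intro sum_mono card_conj_pairs_upper[OF A a b Q I n _ _ _ _ \<eta> few] xy)
  also have "\<dots> = card ?Z * ?B" by simp
  also have "\<dots> \<le> real (card A) ^ card I * ?B"
  proof (rule mult_right_mono)
    have "card ?Z \<le> card (I \<rightarrow>\<^sub>E A)" using A I by (intro card_mono finite_PiE) auto
    then show "real (card ?Z) \<le> real (card A) ^ card I"
      unfolding card_funcsetE[OF I] of_nat_power[symmetric] of_nat_le_iff .
  qed simp
  also have "\<dots> = (fact (card A))\<^sup>2 * real (card A) ^ (2 * card I) * (1 + \<eta>\<^sup>2 * real (2 * card I + 1) ^ card I)"
    unfolding mult_2 power_add by (simp only: mult_ac)
  finally show ?thesis .
qed

proposition average_embeddings_lower:
  fixes \<eta> r :: real
  assumes A: "finite A" and a: "a permutes A" and b: "b permutes A"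
    and P: "P permutes A" and Q: "Q permutes A" and R: "R permutes A"
    and I: "finite I" and g: "g permutes I" and n: "3 * card I \<le> card A"
    and \<eta>: "0 \<le> \<eta>" "\<eta> \<le> 1" "1 \<le> \<eta> * r" "1 \<le> r" "r \<le> card A"
    and few: "sparse_cycles \<eta> r A a" "sparse_cycles \<eta> r A b"
    and double: "\<forall>k\<le>card I. real (card A) ^ k \<le> 2 * real (card A - 2 * card I) ^ k"
    and small: "2 * real (card I) ^ 2 * \<eta> \<le> 1"
  shows "(fact (card A))\<^sup>2 * real (card A - 3 * card I) ^ (2 * card I) * (1 - 2 * real (card I) ^ 2 * \<eta>)\<^sup>2
    \<le> real (card A) ^ (2 * card I) * (\<Sum>W1\<in>{W. W permutes A}. \<Sum>W2\<in>{W. W permutes A}.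
      real (card (embeddings I g A (P \<circ> (inv W2 \<circ> a \<circ> W2) \<circ> Q \<circ> (inv W1 \<circ> b \<circ> W1) \<circ> R))))"
proof -
  let ?Z = "{u \<in> I \<rightarrow>\<^sub>E A. inj_on u I}"
  let ?B = "(fact (card A))\<^sup>2 * real (card A - 3 * card I) ^ card I * (1 - 2 * real (card I) ^ 2 * \<eta>)\<^sup>2"
  have xy: "inj_on (R \<circ> u) I" "(R \<circ> u) ` I \<subseteq> A" "inj_on (inv P \<circ> u \<circ> g) I" "(inv P \<circ> u \<circ> g) ` I \<subseteq> A"
    if u: "u \<in> ?Z" for u
    using u permuted_injection[OF R permutes_id, of u I] permuted_injection[OF permutes_inv[OF P] g, of u]
    by auto
  have "(fact (card A))\<^sup>2 * real (card A - 3 * card I) ^ (2 * card I) * (1 - 2 * real (card I) ^ 2 * \<eta>)\<^sup>2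
    = real (card A - 3 * card I) ^ card I * ?B"
    unfolding mult_2[of "card I"] power_add by (simp only: mult_ac)
  also have "\<dots> \<le> card ?Z * ?B"
  proof (rule mult_right_mono)
    have "(card A - 3 * card I) ^ card I \<le> card ?Z"
      using n by (intro card_injections_ge I A) auto
    then show "real (card A - 3 * card I) ^ card I \<le> real (card ?Z)"
      unfolding of_nat_power[symmetric] of_nat_le_iff .
  qed simp
  also have "\<dots> = (\<Sum>u\<in>?Z. ?B)" by simp
  also have "\<dots> \<le> (\<Sum>u\<in>?Z. real (card A) ^ (2 * card I)
        * real (card (conj_pairs A a Q b I (R \<circ> u) (inv P \<circ> u \<circ> g))))"
    by (intro sum_mono card_conj_pairs_lower[OF A a b Q I n _ _ _ _ \<eta> few double small] xy)
  also have "\<dots> = real (card A) ^ (2 * card I) * (\<Sum>W1\<in>{W. W permutes A}. \<Sum>W2\<in>{W. W permutes A}.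
      real (card (embeddings I g A (P \<circ> (inv W2 \<circ> a \<circ> W2) \<circ> Q \<circ> (inv W1 \<circ> b \<circ> W1) \<circ> R))))"
    using arg_cong[OF sum_embeddings_eq_sum_conj_pairs[OF A I P, of g a Q b R], of real]
    by (simp add: sum_distrib_left)
  finally show ?thesis .
qed

lemma ratio_power_tendsto_1:
  "(\<lambda>n. (real n / real (n - c)) ^ k) \<longlonglongrightarrow> 1"
  "(\<lambda>n. (real (n - c) / real n) ^ k) \<longlonglongrightarrow> 1"
proof -
  have ev: "\<forall>\<^sub>F n in sequentially. real (n - c) = real n - real c"
    using eventually_ge_at_top[of c] by eventually_elim (simp add: of_nat_diff)
  have "(\<lambda>n. real n / (real n - real c)) \<longlonglongrightarrow> 1" by real_asymp
  then have "(\<lambda>n. real n / real (n - c)) \<longlonglongrightarrow> 1"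
    by (rule Lim_transform_eventually) (use ev in eventually_elim, simp)
  from tendsto_power[OF this, of k] show "(\<lambda>n. (real n / real (n - c)) ^ k) \<longlonglongrightarrow> 1" by simp
  have "(\<lambda>n. (real n - real c) / real n) \<longlonglongrightarrow> 1" by real_asymp
  then have "(\<lambda>n. real (n - c) / real n) \<longlonglongrightarrow> 1"
    by (rule Lim_transform_eventually) (use ev in eventually_elim, simp)
  from tendsto_power[OF this, of k] show "(\<lambda>n. (real (n - c) / real n) ^ k) \<longlonglongrightarrow> 1" by simp
qed

text \<open>The limit is \<open>1\<close> because there are about \<open>n\<^sup>N\<close> injections, each of which is an embedding with
probability about \<open>n\<^sup>-\<^sup>N\<close>.  The rate depends on \<open>\<eta>\<close> and \<open>|I|\<close> only; uniformity in the permutations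
\<open>a\<close>, \<open>b\<close>, \<open>P\<close>, \<open>Q\<close>, \<open>R\<close> is what allows averaging over them later.\<close>

proposition average_embeddings_tendsto_1:
  fixes \<eta> :: "nat \<Rightarrow> real" and I :: "'i set"
  assumes \<eta>: "\<eta> \<longlonglongrightarrow> 0" "\<forall>n\<ge>1. 1 \<le> \<eta> n * sqrt n"
    and I: "finite I" and g: "g permutes I" and e: "e > 0"
  shows "\<forall>\<^sub>F n in sequentially. \<forall>a\<in>Perms n. \<forall>b\<in>Perms n. \<forall>P\<in>Perms n. \<forall>Q\<in>Perms n. \<forall>R\<in>Perms n.
    sparse_cycles (\<eta> n) (sqrt n) {1..n} a \<longrightarrow> sparse_cycles (\<eta> n) (sqrt n) {1..n} b \<longrightarrow>
    \<bar>(\<Sum>W1\<in>Perms n. \<Sum>W2\<in>Perms n.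
      real (card (embeddings I g {1..n} (P \<circ> (inv W2 \<circ> a \<circ> W2) \<circ> Q \<circ> (inv W1 \<circ> b \<circ> W1) \<circ> R))))
      / (fact n)\<^sup>2 - 1\<bar> \<le> e"
proof -
  define N where "N = card I"
  define U where "U n = (real n / real (n - 2 * N)) ^ (2 * N) * (1 + (\<eta> n)\<^sup>2 * real (2 * N + 1) ^ N)" for n
  define L where "L n = (real (n - 3 * N) / real n) ^ (2 * N) * (1 - 2 * real N ^ 2 * \<eta> n)\<^sup>2" for n
  have "U \<longlonglongrightarrow> 1 * (1 + 0\<^sup>2 * real (2 * N + 1) ^ N)"
    unfolding U_def by (intro tendsto_intros ratio_power_tendsto_1 \<eta>)
  then have U: "U \<longlonglongrightarrow> 1" by simp
  have "L \<longlonglongrightarrow> 1 * (1 - 2 * real N ^ 2 * 0)\<^sup>2"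
    unfolding L_def by (intro tendsto_intros ratio_power_tendsto_1 \<eta>)
  then have L: "L \<longlonglongrightarrow> 1" by simp
  have "(\<lambda>n. 2 * real N ^ 2 * \<eta> n) \<longlonglongrightarrow> 2 * real N ^ 2 * 0" by (intro tendsto_intros \<eta>)
  then have small: "\<forall>\<^sub>F n in sequentially. 2 * real N ^ 2 * \<eta> n < 1"
    by (rule order_tendstoD) simp
  have double: "\<forall>\<^sub>F n in sequentially. (real n / real (n - 2 * N)) ^ N < 2"
    by (rule order_tendstoD(2)[OF ratio_power_tendsto_1(1)]) simp
  have \<eta>1: "\<forall>\<^sub>F n in sequentially. \<eta> n < 1" by (rule order_tendstoD(2)[OF \<eta>(1)]) simp
  have Ue: "\<forall>\<^sub>F n in sequentially. U n < 1 + e" by (rule order_tendstoD(2)[OF U]) (use e in simp)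
  have Le: "\<forall>\<^sub>F n in sequentially. L n > 1 - e" by (rule order_tendstoD(1)[OF L]) (use e in simp)
  show ?thesis
    using small double \<eta>1 Ue Le eventually_gt_at_top[of "3 * N"] eventually_ge_at_top[of 1]
  proof (eventually_elim, intro ballI impI)
    fix n a b P Q R
    assume small: "2 * real N ^ 2 * \<eta> n < 1" and double: "(real n / real (n - 2 * N)) ^ N < 2"
      and \<eta>1: "\<eta> n < 1" and Ue: "U n < 1 + e" and Le: "1 - e < L n" and n: "3 * N < n" "1 \<le> n"
      and p: "a \<in> Perms n" "b \<in> Perms n" "P \<in> Perms n" "Q \<in> Perms n" "R \<in> Perms n"
      and few: "sparse_cycles (\<eta> n) (sqrt n) {1..n} a" "sparse_cycles (\<eta> n) (sqrt n) {1..n} b"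
    let ?S = "\<Sum>W1\<in>Perms n. \<Sum>W2\<in>Perms n.
      real (card (embeddings I g {1..n} (P \<circ> (inv W2 \<circ> a \<circ> W2) \<circ> Q \<circ> (inv W1 \<circ> b \<circ> W1) \<circ> R)))"
    have c: "card {1..n} = n" by simp
    have r: "1 \<le> sqrt n" "(sqrt n)\<^sup>2 = real n" using n by simp_all
    have rn: "sqrt n \<le> real n"
      using r mult_left_mono[of 1 "sqrt n" "sqrt n"] by (simp add: power2_eq_square)
    have \<eta>r: "1 \<le> \<eta> n * sqrt n" using \<eta>(2) n by simp
    have \<eta>0: "0 \<le> \<eta> n"
    proof (rule ccontr)
      assume "\<not> 0 \<le> \<eta> n"
      then have "\<eta> n * sqrt n \<le> 0" by (intro mult_nonpos_nonneg) auto
      then show False using \<eta>r by simp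
    qed
    have n2: "real (n - 2 * N) > 0" using n by simp
    have "real (n - 2 * N) ^ (2 * N) * ?S \<le> (fact n)\<^sup>2 * real n ^ (2 * N) * (1 + (\<eta> n)\<^sup>2 * real (2 * N + 1) ^ N)"
      using average_embeddings_upper[of "{1..n}" a b P Q R I g "\<eta> n" "sqrt n"]
        p I g \<eta>0 \<eta>1 \<eta>r r few n unfolding N_def by simp
    then have "?S / (fact n)\<^sup>2 \<le> U n"
      using n2 by (simp add: U_def field_simps)
    moreover have "(fact n)\<^sup>2 * real (n - 3 * N) ^ (2 * N) * (1 - 2 * real N ^ 2 * \<eta> n)\<^sup>2
        \<le> real n ^ (2 * N) * ?S"
    proof -
      have "real n ^ k \<le> 2 * real (n - 2 * N) ^ k" if k: "k \<le> N" for k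
      proof -
        have "1 \<le> real n / real (n - 2 * N)" using n2 by simp
        then have "(real n / real (n - 2 * N)) ^ k \<le> (real n / real (n - 2 * N)) ^ N"
          using k by (intro power_increasing)
        then have "(real n / real (n - 2 * N)) ^ k \<le> 2" using double by simp
        then show ?thesis using n2 by (simp add: power_divide divide_le_eq)
      qed
      then show ?thesis
        using average_embeddings_lower[of "{1..n}" a b P Q R I g "\<eta> n" "sqrt n"]
          p I g \<eta>0 \<eta>1 \<eta>r r rn few n small unfolding N_def by simp
    qed
    then have "L n \<le> ?S / (fact n)\<^sup>2"
      using n by (simp add: L_def field_simps)
    ultimately show "\<bar>?S / (fact n)\<^sup>2 - 1\<bar> \<le> e" using Ue Le by (simp add: abs_le_iff)
  qed
qed

text \<open>The point \<open>(d, i, j)\<close> is the \<open>j\<close>-th point of the \<open>i\<close>-th cycle of length \<open>d\<close>, so that the permutation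
below has exactly \<open>v d\<close> cycles of each length \<open>d \<le> k\<close>.\<close>

definition pattern_set :: "nat \<Rightarrow> (nat \<Rightarrow> nat) \<Rightarrow> (nat \<times> nat \<times> nat) set" where
  "pattern_set k v = {(d, i, j). d \<in> {1..k} \<and> i < v d \<and> j < d}"

definition pattern_perm :: "nat \<Rightarrow> (nat \<Rightarrow> nat) \<Rightarrow> nat \<times> nat \<times> nat \<Rightarrow> nat \<times> nat \<times> nat" where
  "pattern_perm k v = (\<lambda>(d, i, j). if (d, i, j) \<in> pattern_set k v then (d, i, (j + 1) mod d) else (d, i, j))"

lemma finite_pattern_set: "finite (pattern_set k v)"
proof -
  have "pattern_set k v = (SIGMA d:{1..k}. {..<v d} \<times> {..<d})" by (auto simp: pattern_set_def)
  then show ?thesis by simp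
qed

lemma pattern_perm_pow:
  assumes "(d, i, j) \<in> pattern_set k v"
  shows "(pattern_perm k v ^^ l) (d, i, j) = (d, i, (j + l) mod d)"
proof (induction l)
  case 0 then show ?case using assms by (simp add: pattern_set_def)
next
  case (Suc l)
  have "(d, i, (j + l) mod d) \<in> pattern_set k v" using assms by (auto simp: pattern_set_def)
  then show ?case using Suc by (simp add: pattern_perm_def mod_Suc_eq)
qed

lemma pattern_perm_permutes: "pattern_perm k v permutes pattern_set k v"
proof (rule bij_imp_permutes)
  have im: "pattern_perm k v ` pattern_set k v \<subseteq> pattern_set k v"
    by (auto simp: pattern_perm_def pattern_set_def)
  have "x \<in> pattern_perm k v ` pattern_set k v" if x: "x \<in> pattern_set k v" for x
  proof -
    obtain d i j where d: "x = (d, i, j)" by (cases x)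
    have y: "(d, i, (j + (d - 1)) mod d) \<in> pattern_set k v"
      using x by (auto simp: d pattern_set_def)
    have "pattern_perm k v (d, i, (j + (d - 1)) mod d) = (d, i, Suc (j + (d - 1)) mod d)"
      using y by (simp add: pattern_perm_def mod_Suc_eq)
    also have "\<dots> = x" using x by (auto simp: d pattern_set_def)
    finally show ?thesis using y by (metis image_eqI)
  qed
  then have "pattern_perm k v ` pattern_set k v = pattern_set k v" using im by blast
  then show "bij_betw (pattern_perm k v) (pattern_set k v) (pattern_set k v)"
    using finite_surj_inj[OF finite_pattern_set] by (simp add: bij_betw_def)
qed (auto simp: pattern_perm_def)

lemma card_orbit_pattern_perm:
  assumes x: "(d, i, j) \<in> pattern_set k v"
  shows "card (orbit (pattern_perm k v) (d, i, j)) = d"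
proof -
  have d: "d > 0" "j < d" using x by (auto simp: pattern_set_def)
  have per: "(pattern_perm k v ^^ d) (d, i, j) = (d, i, j)" using d by (simp add: pattern_perm_pow[OF x])
  have "orbit (pattern_perm k v) (d, i, j) = (\<lambda>l. (d, i, (j + l) mod d)) ` {..<d}"
    unfolding orbit_altdef_bounded[OF per d(1)] pattern_perm_pow[OF x] by auto
  moreover have "inj_on (\<lambda>l. (d, i, (j + l) mod d)) {..<d}"
  proof (rule inj_onI)
    fix l l' assume l: "l \<in> {..<d}" "l' \<in> {..<d}" "(d, i, (j + l) mod d) = (d, i, (j + l') mod d)"
    have "(j + q) mod d = (if j + q < d then j + q else j + q - d)" if "q < d" for q
      using that d by (simp add: mod_if)
    then show "l = l'" using l d by (simp split: if_splits)
  qed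
  ultimately show ?thesis by (simp add: card_image)
qed

lemma card_cycles_pattern_perm:
  assumes d: "d \<in> {1..k}"
  shows "card (cycles_of_length d (pattern_perm k v) (pattern_set k v)) = v d"
proof -
  have "period_pts d (pattern_perm k v) (pattern_set k v) = {d} \<times> {..<v d} \<times> {..<d}"
    using d by (auto simp: period_pts_def card_orbit_pattern_perm) (auto simp: pattern_set_def card_orbit_pattern_perm)
  then have "card (period_pts d (pattern_perm k v) (pattern_set k v)) = d * v d"
    by (simp add: card_cartesian_product)
  moreover have "card (period_pts d (pattern_perm k v) (pattern_set k v))
      = d * card (cycles_of_length d (pattern_perm k v) (pattern_set k v))"
    using d pattern_perm_permutes permutes_image[OF pattern_perm_permutes]
    by (intro card_period_pts finite_pattern_set permutation_of_permutes[OF pattern_perm_permutes]) auto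
  ultimately show ?thesis using d by simp
qed

lemma prod_diff_eq_fact_binomial: "(\<Prod>i<v. t - i) = fact v * (t choose v)"
proof (induction v)
  case (Suc v)
  have "(t choose v) * (t - v) = Suc v * (t choose Suc v)"
    by (metis binomial_absorb_comp binomial_absorption mult.commute)
  moreover have "(\<Prod>i<Suc v. t - i) = fact v * ((t choose v) * (t - v))" using Suc by simp
  ultimately show ?case by (simp only: fact_Suc of_nat_id mult_ac)
qed simp

text \<open>This is the link between embeddings and binomial moments; the constant is the reciprocal of the
binomial moment of the limit.\<close>

lemma card_embeddings_pattern:
  assumes p: "p \<in> Perms n"
  shows "card (embeddings (pattern_set k v) (pattern_perm k v) {1..n} p)
    = (\<Prod>d\<in>{1..k}. d ^ v d * fact (v d)) * (\<Prod>d\<in>{1..k}. num_cycles n d p choose v d)"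
proof -
  have "card (orbit (pattern_perm k v) x) \<in> {1..k}" if "x \<in> pattern_set k v" for x
    using that card_orbit_pattern_perm by (cases x) (auto simp: pattern_set_def)
  then have "card (embeddings (pattern_set k v) (pattern_perm k v) {1..n} p)
      = (\<Prod>d\<in>{1..k}. \<Prod>i<card (cycles_of_length d (pattern_perm k v) (pattern_set k v)).
          d * (card (cycles_of_length d p {1..n}) - i))"
    using p permutes_image[OF pattern_perm_permutes, of k v]
    by (intro card_embeddings finite_pattern_set permutation_of_permutes[OF pattern_perm_permutes]) auto
  also have "\<dots> = (\<Prod>d\<in>{1..k}. \<Prod>i<v d. d * (num_cycles n d p - i))"
    by (rule prod.cong[OF refl])
      (simp only: card_cycles_pattern_perm num_cycles_def cycles_of_length_def[of _ p])
  also have "\<dots> = (\<Prod>d\<in>{1..k}. d ^ v d * (fact (v d) * (num_cycles n d p choose v d)))"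
    by (simp add: prod.distrib prod_diff_eq_fact_binomial)
  also have "\<dots> = (\<Prod>d\<in>{1..k}. d ^ v d * fact (v d)) * (\<Prod>d\<in>{1..k}. num_cycles n d p choose v d)"
    by (simp add: prod.distrib mult_ac)
  finally show ?thesis .
qed

proposition average_binomial_moments:
  fixes \<eta> :: "nat \<Rightarrow> real"
  assumes \<eta>: "\<eta> \<longlonglongrightarrow> 0" "\<forall>n\<ge>1. 1 \<le> \<eta> n * sqrt n" and e: "e > 0"
  shows "\<forall>\<^sub>F n in sequentially. \<forall>a\<in>Perms n. \<forall>b\<in>Perms n. \<forall>P\<in>Perms n. \<forall>Q\<in>Perms n. \<forall>R\<in>Perms n.
    sparse_cycles (\<eta> n) (sqrt n) {1..n} a \<longrightarrow> sparse_cycles (\<eta> n) (sqrt n) {1..n} b \<longrightarrow>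
    \<bar>(\<Sum>W1\<in>Perms n. \<Sum>W2\<in>Perms n. \<Prod>d\<in>{1..k}.
      real (num_cycles n d (P \<circ> (inv W2 \<circ> a \<circ> W2) \<circ> Q \<circ> (inv W1 \<circ> b \<circ> W1) \<circ> R) choose v d))
      / (fact n)\<^sup>2 - (\<Prod>d\<in>{1..k}. (1 / real d) ^ v d / fact (v d))\<bar> \<le> e"
proof -
  define c :: real where "c = (\<Prod>d\<in>{1..k}. real d ^ v d * fact (v d))"
  have c: "c > 0" unfolding c_def by (intro prod_pos) auto
  have ic: "(\<Prod>d\<in>{1..k}. (1 / real d) ^ v d / fact (v d)) = 1 / c"
    unfolding c_def prod_dividef[symmetric, of "\<lambda>_. 1", simplified]
    by (simp add: power_one_over)
  show ?thesis
    using average_embeddings_tendsto_1[OF \<eta> finite_pattern_set pattern_perm_permutes, of "e * c" k v, OF mult_pos_pos[OF e c]]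
  proof (eventually_elim, intro ballI impI)
    fix n a b P Q R
    assume H: "\<forall>a\<in>Perms n. \<forall>b\<in>Perms n. \<forall>P\<in>Perms n. \<forall>Q\<in>Perms n. \<forall>R\<in>Perms n.
        sparse_cycles (\<eta> n) (sqrt n) {1..n} a \<longrightarrow> sparse_cycles (\<eta> n) (sqrt n) {1..n} b \<longrightarrow>
        \<bar>(\<Sum>W1\<in>Perms n. \<Sum>W2\<in>Perms n. real (card (embeddings (pattern_set k v) (pattern_perm k v) {1..n}
          (P \<circ> (inv W2 \<circ> a \<circ> W2) \<circ> Q \<circ> (inv W1 \<circ> b \<circ> W1) \<circ> R)))) / (fact n)\<^sup>2 - 1\<bar> \<le> e * c"
      and p: "a \<in> Perms n" "b \<in> Perms n" "P \<in> Perms n" "Q \<in> Perms n" "R \<in> Perms n"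
      and few: "sparse_cycles (\<eta> n) (sqrt n) {1..n} a" "sparse_cycles (\<eta> n) (sqrt n) {1..n} b"
    let ?\<pi> = "\<lambda>W1 W2. P \<circ> (inv W2 \<circ> a \<circ> W2) \<circ> Q \<circ> (inv W1 \<circ> b \<circ> W1) \<circ> R"
    let ?T = "\<Sum>W1\<in>Perms n. \<Sum>W2\<in>Perms n. \<Prod>d\<in>{1..k}. real (num_cycles n d (?\<pi> W1 W2) choose v d)"
    have "real (card (embeddings (pattern_set k v) (pattern_perm k v) {1..n} (?\<pi> W1 W2)))
        = c * (\<Prod>d\<in>{1..k}. real (num_cycles n d (?\<pi> W1 W2) choose v d))"
      if "W1 \<in> Perms n" "W2 \<in> Perms n" for W1 W2
    proof -
      have \<pi>: "?\<pi> W1 W2 \<in> Perms n" using p that by (simp add: permutes_compose permutes_inv)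
      then show ?thesis unfolding card_embeddings_pattern[OF \<pi>] c_def by simp
    qed
    then have eq: "(\<Sum>W1\<in>Perms n. \<Sum>W2\<in>Perms n. real (card (embeddings (pattern_set k v) (pattern_perm k v) {1..n}
        (?\<pi> W1 W2)))) = c * ?T"
      unfolding sum_distrib_left by (intro sum.cong refl) simp
    have "\<bar>c * ?T / (fact n)\<^sup>2 - 1\<bar> \<le> e * c"
      using H[rule_format, OF p few] unfolding eq .
    also have "c * ?T / (fact n)\<^sup>2 - 1 = c * (?T / (fact n)\<^sup>2 - 1 / c)" using c by (simp add: field_simps)
    finally have "c * \<bar>?T / (fact n)\<^sup>2 - 1 / c\<bar> \<le> c * e" using c by (simp add: abs_mult mult.commute)
    then show "\<bar>?T / (fact n)\<^sup>2 - (\<Prod>d\<in>{1..k}. (1 / real d) ^ v d / fact (v d))\<bar> \<le> e"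
      unfolding ic using c by simp
  qed
qed

section \<open>Poisson limits from binomial moments\<close>

text \<open>The inclusion-exclusion series for the indicator of \<open>t = v\<close> in terms of binomial coefficients of \<open>t\<close>,
stopped at order \<open>j\<close>.\<close>

definition bonferroni_sum :: "nat \<Rightarrow> nat \<Rightarrow> nat \<Rightarrow> real" where
  "bonferroni_sum v j t = (\<Sum>i\<le>j. (-1) ^ i * real ((v + i) choose v) * real (t choose (v + i)))"

text \<open>The alternating partial row sums of Pascal's triangle are again binomial coefficients up to sign, so
the error is at most the last term of the sum.\<close>

lemma bonferroni_inequality:
  "\<bar>of_bool (t = v) - bonferroni_sum v j t\<bar> \<le> real ((v + j) choose v) * real (t choose (v + j))"
proof (cases "v \<le> t")
  case False
  then show ?thesis by (simp add: bonferroni_sum_def binomial_eq_0)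
next
  case True
  have ch: "real ((v + i) choose v) * real (t choose (v + i)) = real (t choose v) * real ((t - v) choose i)" for i
  proof (cases "v + i \<le> t")
    case True
    then show ?thesis
      using choose_mult[of v "v + i" t] by (simp flip: of_nat_mult add: mult.commute)
  next
    case False
    then have "t < v + i" "t - v < i" using \<open>v \<le> t\<close> by linarith+
    then show ?thesis by (simp add: binomial_eq_0)
  qed
  have S: "bonferroni_sum v j t = real (t choose v) * (\<Sum>i\<le>j. (real (t - v) gchoose i) * (-1) ^ i)"
  proof -
    have "(-1) ^ i * real ((v + i) choose v) * real (t choose (v + i))
        = real (t choose v) * ((real (t - v) gchoose i) * (-1) ^ i)" for i
    proof -
      have "(-1) ^ i * real ((v + i) choose v) * real (t choose (v + i))
          = (-1) ^ i * (real (t choose v) * real ((t - v) choose i))"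
        unfolding ch[of i, symmetric] by (rule mult.assoc)
      then show ?thesis by (simp add: binomial_gbinomial)
    qed
    then show ?thesis unfolding bonferroni_sum_def sum_distrib_left by (intro sum.cong refl)
  qed
  show ?thesis
  proof (cases "t = v")
    case True
    have "(\<Sum>i\<le>j. (real (t - v) gchoose i) * (-1) ^ i) = 1"
      using True by (induction j) (simp_all add: gbinomial_0)
    then show ?thesis using True S by simp
  next
    case False
    then have tv: "t - v \<ge> 1" using \<open>v \<le> t\<close> by simp
    have "bonferroni_sum v j t = real (t choose v) * ((-1) ^ j * real ((t - v - 1) choose j))"
    proof -
      have "real (t - v) - 1 = real (t - v - 1)" using tv by (simp only: of_nat_diff of_nat_1)
      then show ?thesis by (simp only: S gbinomial_sum_lower_neg binomial_gbinomial)
    qed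
    then have "\<bar>of_bool (t = v) - bonferroni_sum v j t\<bar> = real (t choose v) * real ((t - v - 1) choose j)"
      using False by (simp add: abs_mult power_abs)
    also have "\<dots> \<le> real (t choose v) * real ((t - v) choose j)"
      by (intro mult_left_mono) (simp_all add: binomial_right_mono)
    finally show ?thesis by (simp add: ch)
  qed
qed

text \<open>Used with indicators \<open>a d\<close> and truncated series \<open>b d\<close>.  The bound is a polynomial in the errors, whose
expectation can again be read off from the binomial moments.\<close>

lemma abs_prod_diff_le:
  fixes a b \<epsilon> :: "'d \<Rightarrow> real"
  assumes "finite D" "\<And>d. d \<in> D \<Longrightarrow> \<bar>a d\<bar> \<le> 1" "\<And>d. d \<in> D \<Longrightarrow> \<bar>a d - b d\<bar> \<le> \<epsilon> d"
  shows "\<bar>(\<Prod>d\<in>D. a d) - (\<Prod>d\<in>D. b d)\<bar> \<le> (\<Prod>d\<in>D. 1 + \<epsilon> d) - 1"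
  using assms
proof (induction D rule: finite_induct)
  case (insert d D)
  let ?a = "\<Prod>d\<in>D. a d" and ?b = "\<Prod>d\<in>D. b d" and ?p = "\<Prod>d\<in>D. 1 + \<epsilon> d"
  have IH: "\<bar>?a - ?b\<bar> \<le> ?p - 1" using insert by simp
  have "\<bar>?a\<bar> \<le> 1" unfolding abs_prod using insert.prems by (intro prod_le_1) auto
  then have b: "\<bar>?b\<bar> \<le> ?p" using IH by linarith
  have "\<bar>a d * ?a - b d * ?b\<bar> = \<bar>a d * (?a - ?b) + (a d - b d) * ?b\<bar>" by (simp add: algebra_simps)
  also have "\<dots> \<le> \<bar>a d\<bar> * \<bar>?a - ?b\<bar> + \<bar>a d - b d\<bar> * \<bar>?b\<bar>"
    by (metis abs_mult abs_triangle_ineq)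
  also have "\<dots> \<le> 1 * (?p - 1) + \<epsilon> d * ?p"
    using insert.prems IH b order.trans[OF abs_ge_zero insert.prems(2)[of d]]
    by (intro add_mono mult_mono) auto
  finally show ?case using insert.hyps by (simp add: algebra_simps)
qed simp

lemma weighted_binomial_combination_tendsto:
  fixes \<Omega> :: "nat \<Rightarrow> 'x set" and w :: "nat \<Rightarrow> 'x \<Rightarrow> real" and T :: "nat \<Rightarrow> 'x \<Rightarrow> 'd \<Rightarrow> nat"
  assumes D: "finite D" and F: "finite F"
    and mom: "\<And>u. (\<lambda>n. \<Sum>x\<in>\<Omega> n. w n x * (\<Prod>d\<in>D. real (T n x d choose u d)))
      \<longlonglongrightarrow> (\<Prod>d\<in>D. \<rho> d ^ u d / fact (u d))"
  shows "(\<lambda>n. \<Sum>x\<in>\<Omega> n. w n x * (\<Prod>d\<in>D. \<Sum>i\<in>F. c d i * real (T n x d choose m d i)))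
    \<longlonglongrightarrow> (\<Prod>d\<in>D. \<Sum>i\<in>F. c d i * (\<rho> d ^ m d i / fact (m d i)))"
proof -
  have "(\<lambda>n. \<Sum>\<phi>\<in>D \<rightarrow>\<^sub>E F. (\<Prod>d\<in>D. c d (\<phi> d)) *
        (\<Sum>x\<in>\<Omega> n. w n x * (\<Prod>d\<in>D. real (T n x d choose m d (\<phi> d)))))
    \<longlonglongrightarrow> (\<Sum>\<phi>\<in>D \<rightarrow>\<^sub>E F. (\<Prod>d\<in>D. c d (\<phi> d)) * (\<Prod>d\<in>D. \<rho> d ^ m d (\<phi> d) / fact (m d (\<phi> d))))"
    by (intro tendsto_sum tendsto_mult tendsto_const mom[of "\<lambda>d. m d (\<phi> d)" for \<phi>])
  moreover have "(\<Sum>\<phi>\<in>D \<rightarrow>\<^sub>E F. (\<Prod>d\<in>D. c d (\<phi> d)) *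
        (\<Sum>x\<in>\<Omega> n. w n x * (\<Prod>d\<in>D. real (T n x d choose m d (\<phi> d)))))
    = (\<Sum>x\<in>\<Omega> n. w n x * (\<Prod>d\<in>D. \<Sum>i\<in>F. c d i * real (T n x d choose m d i)))" for n
  proof -
    have "(\<Sum>x\<in>\<Omega> n. w n x * (\<Prod>d\<in>D. \<Sum>i\<in>F. c d i * real (T n x d choose m d i)))
      = (\<Sum>x\<in>\<Omega> n. \<Sum>\<phi>\<in>D \<rightarrow>\<^sub>E F. (\<Prod>d\<in>D. c d (\<phi> d)) *
          (w n x * (\<Prod>d\<in>D. real (T n x d choose m d (\<phi> d)))))"
      using D F by (simp add: prod_sum_PiE sum_distrib_left prod.distrib mult_ac)
    also have "\<dots> = (\<Sum>\<phi>\<in>D \<rightarrow>\<^sub>E F. \<Sum>x\<in>\<Omega> n. (\<Prod>d\<in>D. c d (\<phi> d)) *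
          (w n x * (\<Prod>d\<in>D. real (T n x d choose m d (\<phi> d)))))"
      by (rule sum.swap)
    finally show ?thesis by (simp add: sum_distrib_left)
  qed
  moreover have "(\<Sum>\<phi>\<in>D \<rightarrow>\<^sub>E F. (\<Prod>d\<in>D. c d (\<phi> d)) * (\<Prod>d\<in>D. \<rho> d ^ m d (\<phi> d) / fact (m d (\<phi> d))))
    = (\<Prod>d\<in>D. \<Sum>i\<in>F. c d i * (\<rho> d ^ m d i / fact (m d i)))"
    using D F by (simp only: prod_sum_PiE prod.distrib)
  ultimately show ?thesis by simp
qed

text \<open>For a fixed order \<open>j\<close>, the product of the Bonferroni sums and the bound for its error are finite
combinations of binomial moments, whose limits are known.  As \<open>j\<close> grows, the former tends to the
Poisson probability and the latter to \<open>0\<close>.  The weights may be the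
restriction of a probability to an event.\<close>

proposition poisson_limit_of_binomial_moments:
  fixes \<Omega> :: "nat \<Rightarrow> 'x set" and w :: "nat \<Rightarrow> 'x \<Rightarrow> real" and T :: "nat \<Rightarrow> 'x \<Rightarrow> 'd \<Rightarrow> nat"
  assumes D: "finite D" and w: "\<And>n x. x \<in> \<Omega> n \<Longrightarrow> 0 \<le> w n x"
    and mom: "\<And>u. (\<lambda>n. \<Sum>x\<in>\<Omega> n. w n x * (\<Prod>d\<in>D. real (T n x d choose u d)))
      \<longlonglongrightarrow> (\<Prod>d\<in>D. \<rho> d ^ u d / fact (u d))"
  shows "(\<lambda>n. \<Sum>x\<in>\<Omega> n. w n x * of_bool (\<forall>d\<in>D. T n x d = v d))
    \<longlonglongrightarrow> (\<Prod>d\<in>D. \<rho> d ^ v d / fact (v d) * exp (- \<rho> d))"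
proof -
  define p where "p = (\<Prod>d\<in>D. \<rho> d ^ v d / fact (v d) * exp (- \<rho> d))"
  define P where "P n = (\<Sum>x\<in>\<Omega> n. w n x * of_bool (\<forall>d\<in>D. T n x d = v d))" for n
  define S where "S j n = (\<Sum>x\<in>\<Omega> n. w n x * (\<Prod>d\<in>D. bonferroni_sum (v d) j (T n x d)))" for j n
  define err where "err j d t = real ((v d + j) choose v d) * real (t choose (v d + j))" for j d t
  define E where "E j n = (\<Sum>x\<in>\<Omega> n. w n x * (\<Prod>d\<in>D. 1 + err j d (T n x d)))" for j n
  define W where "W n = (\<Sum>x\<in>\<Omega> n. w n x)" for n
  define \<alpha> where "\<alpha> j = (\<Prod>d\<in>D. \<Sum>i\<le>j. \<rho> d ^ v d / fact (v d) * ((- \<rho> d) ^ i / fact i))" for j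
  define \<beta> where "\<beta> j = (\<Prod>d\<in>D. 1 + \<rho> d ^ v d / fact (v d) * (\<rho> d ^ j / fact j))" for j
  have coef: "real ((v d + i) choose v d) * (\<rho> d ^ (v d + i) / fact (v d + i))
      = \<rho> d ^ v d / fact (v d) * (\<rho> d ^ i / fact i)" for d i
    by (simp add: binomial_fact power_add)
  have S: "S j \<longlonglongrightarrow> \<alpha> j" for j
  proof -
    have "(\<lambda>n. S j n) \<longlonglongrightarrow> (\<Prod>d\<in>D. \<Sum>i\<le>j. (-1) ^ i * real ((v d + i) choose v d) *
        (\<rho> d ^ (v d + i) / fact (v d + i)))"
      unfolding S_def bonferroni_sum_def
      by (rule weighted_binomial_combination_tendsto[OF D _ mom]) simp
    moreover have "(-1) ^ i * real ((v d + i) choose v d) * (\<rho> d ^ (v d + i) / fact (v d + i))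
        = \<rho> d ^ v d / fact (v d) * ((- \<rho> d) ^ i / fact i)" for d i
    proof -
      have "(-1) ^ i * real ((v d + i) choose v d) * (\<rho> d ^ (v d + i) / fact (v d + i))
          = (-1) ^ i * (\<rho> d ^ v d / fact (v d) * (\<rho> d ^ i / fact i))"
        unfolding coef[of d i, symmetric] by (rule mult.assoc)
      then show ?thesis by (simp add: power_minus[of "\<rho> d"] mult_ac)
    qed
    ultimately show ?thesis by (simp add: \<alpha>_def)
  qed
  have E: "E j \<longlonglongrightarrow> \<beta> j" for j
  proof -
    have "(\<lambda>n. \<Sum>x\<in>\<Omega> n. w n x * (\<Prod>d\<in>D. \<Sum>i\<in>{0, 1 :: nat}.
          (if i = 0 then 1 else real ((v d + j) choose v d)) * real (T n x d choose (if i = 0 then 0 else v d + j))))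
        \<longlonglongrightarrow> (\<Prod>d\<in>D. \<Sum>i\<in>{0, 1 :: nat}. (if i = 0 then 1 else real ((v d + j) choose v d)) *
          (\<rho> d ^ (if i = 0 then 0 else v d + j) / fact (if i = 0 then 0 else v d + j)))"
      by (rule weighted_binomial_combination_tendsto[OF D _ mom]) simp
    then show ?thesis unfolding E_def err_def \<beta>_def using coef[of _ j] by simp
  qed
  have W: "W \<longlonglongrightarrow> 1"
    using mom[of "\<lambda>_. 0"] by (simp add: W_def[abs_def])
  have bound: "\<bar>P n - S j n\<bar> \<le> E j n - W n" for n j
  proof -
    have "\<bar>of_bool (\<forall>d\<in>D. T n x d = v d) - (\<Prod>d\<in>D. bonferroni_sum (v d) j (T n x d))\<bar>
        \<le> (\<Prod>d\<in>D. 1 + err j d (T n x d)) - 1" for x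
    proof -
      have "of_bool (\<forall>d\<in>D. T n x d = v d) = (\<Prod>d\<in>D. of_bool (T n x d = v d) :: real)"
        using D by (induction D rule: finite_induct) auto
      then show ?thesis
        unfolding err_def using bonferroni_inequality
        by (simp only:) (intro abs_prod_diff_le D, auto)
    qed
    note pw = this
    have "\<bar>P n - S j n\<bar> = \<bar>\<Sum>x\<in>\<Omega> n. w n x *
        (of_bool (\<forall>d\<in>D. T n x d = v d) - (\<Prod>d\<in>D. bonferroni_sum (v d) j (T n x d)))\<bar>"
      by (simp add: P_def S_def sum_subtractf right_diff_distrib)
    also have "\<dots> \<le> (\<Sum>x\<in>\<Omega> n. w n x * ((\<Prod>d\<in>D. 1 + err j d (T n x d)) - 1))"
      by (intro sum_abs[THEN order.trans] sum_mono)
        (simp add: abs_mult w pw mult_left_mono)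
    also have "\<dots> = E j n - W n" by (simp add: E_def W_def sum_subtractf right_diff_distrib)
    finally show ?thesis .
  qed
  have \<alpha>: "\<alpha> \<longlonglongrightarrow> p"
  proof -
    have "(\<lambda>j. \<Sum>i\<le>j. (- \<rho> d) ^ i / fact i) \<longlonglongrightarrow> exp (- \<rho> d)" for d
      using exp_converges[of "- \<rho> d"] by (simp add: sums_def_le divide_inverse mult.commute)
    then show ?thesis
      unfolding \<alpha>_def p_def sum_distrib_left[symmetric] by (intro tendsto_intros)
  qed
  have \<beta>: "\<beta> \<longlonglongrightarrow> 1"
  proof -
    have "(\<lambda>j. \<rho> d ^ j / fact j) \<longlonglongrightarrow> 0" for d
      using summable_LIMSEQ_zero[OF summable_exp[of "\<rho> d"]] by (simp add: divide_inverse mult.commute)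
    then have "(\<lambda>j. \<Prod>d\<in>D. 1 + \<rho> d ^ v d / fact (v d) * (\<rho> d ^ j / fact j))
        \<longlonglongrightarrow> (\<Prod>d\<in>D. 1 + \<rho> d ^ v d / fact (v d) * 0)"
      by (intro tendsto_intros)
    then show ?thesis unfolding \<beta>_def by simp
  qed
  have "P \<longlonglongrightarrow> p"
  proof (rule tendstoI)
    fix e :: real assume e: "e > 0"
    have "\<forall>\<^sub>F j in sequentially. dist (\<alpha> j) p < e / 3" "\<forall>\<^sub>F j in sequentially. \<beta> j < 1 + e / 3"
      using tendstoD[OF \<alpha>, of "e / 3"] order_tendstoD(2)[OF \<beta>, of "1 + e / 3"] e by auto
    then obtain j where j: "dist (\<alpha> j) p < e / 3" "\<beta> j < 1 + e / 3"
      using eventually_happens'[OF sequentially_bot eventually_conj] by blast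
    have "(\<lambda>n. E j n - W n) \<longlonglongrightarrow> \<beta> j - 1" by (intro tendsto_intros E W)
    then have "\<forall>\<^sub>F n in sequentially. E j n - W n < e / 3"
      by (rule order_tendstoD) (use j in simp)
    moreover have "\<forall>\<^sub>F n in sequentially. dist (S j n) (\<alpha> j) < e / 3"
      using tendstoD[OF S, of "e / 3" j] e by simp
    ultimately show "\<forall>\<^sub>F n in sequentially. dist (P n) p < e"
    proof eventually_elim
      case (elim n)
      then show ?case using bound[of n j] j unfolding dist_real_def by linarith
    qed
  qed
  then show ?thesis by (simp add: P_def[abs_def] p_def)
qed

text \<open>No mass escapes to infinity: the point probabilities in a large box have limits whose sum is close to
\<open>1\<close>, so both the restriction to \<open>G n\<close> and the restriction to the box change the average by little.
The number \<open>L\<close> plays the role of the integral of \<open>f\<close> with respect to the limit law, and is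
characterized by its approximation on boxes.\<close>

proposition weighted_average_tendsto:
  fixes \<Omega> G :: "nat \<Rightarrow> 'x set" and w :: "nat \<Rightarrow> 'x \<Rightarrow> real" and T :: "nat \<Rightarrow> 'x \<Rightarrow> 'd \<Rightarrow> nat"
    and f :: "('d \<Rightarrow> nat) \<Rightarrow> real"
  assumes D: "finite D" and w: "\<And>n x. x \<in> \<Omega> n \<Longrightarrow> 0 \<le> w n x"
    and \<Omega>: "\<And>n. finite (\<Omega> n)" "\<And>n. G n \<subseteq> \<Omega> n" "\<forall>\<^sub>F n in sequentially. (\<Sum>x\<in>\<Omega> n. w n x) = 1"
    and p: "\<And>v. (\<lambda>n. \<Sum>x\<in>G n. w n x * of_bool (\<forall>d\<in>D. T n x d = v d)) \<longlonglongrightarrow> (\<Prod>d\<in>D. q d (v d))"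
    and q: "\<And>d. d \<in> D \<Longrightarrow> q d sums 1"
    and f: "\<And>v. \<bar>f v\<bar> \<le> B"
    and L: "\<And>R. \<bar>L - (\<Sum>v\<in>D \<rightarrow>\<^sub>E {..R}. (\<Prod>d\<in>D. q d (v d)) * f v)\<bar>
      \<le> B * (1 - (\<Sum>v\<in>D \<rightarrow>\<^sub>E {..R}. \<Prod>d\<in>D. q d (v d)))"
  shows "(\<lambda>n. \<Sum>x\<in>\<Omega> n. w n x * f (restrict (T n x) D)) \<longlonglongrightarrow> L"
proof -
  define K where "K R = D \<rightarrow>\<^sub>E {..R :: nat}" for R
  define P where "P n v = (\<Sum>x\<in>G n. w n x * of_bool (\<forall>d\<in>D. T n x d = v d))" for n v
  define pv where "pv v = (\<Prod>d\<in>D. q d (v d))" for v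
  have finK: "finite (K R)" for R unfolding K_def by (intro finite_PiE D) auto
  have B: "B \<ge> 0" using f[of "\<lambda>_. 0"] by linarith
  have "(\<lambda>R. \<Prod>d\<in>D. \<Sum>i\<le>R. q d i) \<longlonglongrightarrow> (\<Prod>d\<in>D. 1)"
    using q by (intro tendsto_prod) (simp add: sums_def_le)
  moreover have "(\<Sum>v\<in>K R. pv v) = (\<Prod>d\<in>D. \<Sum>i\<le>R. q d i)" for R
    unfolding K_def pv_def using prod_sum_PiE[OF D, of "\<lambda>_. {..R}" q] by simp
  ultimately have mass: "(\<lambda>R. \<Sum>v\<in>K R. pv v) \<longlonglongrightarrow> 1" by simp
  have approx: "\<bar>(\<Sum>x\<in>\<Omega> n. w n x * f (restrict (T n x) D)) - (\<Sum>v\<in>K R. P n v * f v)\<bar>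
      \<le> B * (1 - (\<Sum>v\<in>K R. P n v))" if n: "(\<Sum>x\<in>\<Omega> n. w n x) = 1" for n R
  proof -
    define H where "H = {x \<in> G n. restrict (T n x) D \<in> K R}"
    have H: "H \<subseteq> \<Omega> n" using \<Omega>(2) by (auto simp: H_def)
    have finG: "finite (G n)" using finite_subset[OF \<Omega>(2) \<Omega>(1)] .
    have sumK: "(\<Sum>v\<in>K R. P n v * g v) = (\<Sum>x\<in>H. w n x * g (restrict (T n x) D))" for g :: "('d \<Rightarrow> nat) \<Rightarrow> real"
    proof -
      have eq: "(\<forall>d\<in>D. T n x d = v d) \<longleftrightarrow> v = restrict (T n x) D" if "v \<in> K R" for x v
        using that by (auto simp: K_def PiE_def extensional_def fun_eq_iff restrict_def)
      have "(\<Sum>v\<in>K R. P n v * g v)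
          = (\<Sum>v\<in>K R. \<Sum>x\<in>G n. if v = restrict (T n x) D then w n x * g v else 0)"
        unfolding P_def sum_distrib_right by (intro sum.cong refl) (simp only: eq of_bool_def if_distrib, simp)
      also have "\<dots> = (\<Sum>x\<in>G n. \<Sum>v\<in>K R. if v = restrict (T n x) D then w n x * g v else 0)"
        by (rule sum.swap)
      also have "\<dots> = (\<Sum>x\<in>G n. if restrict (T n x) D \<in> K R then w n x * g (restrict (T n x) D) else 0)"
        using finK by simp
      also have "\<dots> = (\<Sum>x\<in>H. w n x * g (restrict (T n x) D))"
        unfolding H_def using finG by (simp add: sum.inter_filter)
      finally show ?thesis .
    qed
    have "(\<Sum>x\<in>\<Omega> n. w n x * f (restrict (T n x) D)) - (\<Sum>v\<in>K R. P n v * f v)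
        = (\<Sum>x\<in>\<Omega> n - H. w n x * f (restrict (T n x) D))"
      unfolding sumK sum.subset_diff[OF H \<Omega>(1)] by simp
    also have "\<bar>\<dots>\<bar> \<le> (\<Sum>x\<in>\<Omega> n - H. w n x * B)"
      using f w by (intro sum_abs[THEN order.trans] sum_mono) (auto simp: abs_mult intro!: mult_left_mono)
    also have "\<dots> = (\<Sum>x\<in>\<Omega> n - H. w n x) * B" by (rule sum_distrib_right[symmetric])
    also have "\<dots> = B * (1 - (\<Sum>x\<in>H. w n x))"
      using n sum.subset_diff[OF H \<Omega>(1), of "w n"] by simp
    also have "(\<Sum>x\<in>H. w n x) = (\<Sum>v\<in>K R. P n v)" using sumK[of "\<lambda>_. 1"] by simp
    finally show ?thesis .
  qed
  show ?thesis
  proof (rule tendstoI)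
    fix e :: real assume e: "e > 0"
    have "(\<lambda>R. B * (1 - (\<Sum>v\<in>K R. pv v))) \<longlonglongrightarrow> B * (1 - 1)" by (intro tendsto_intros mass)
    then have "\<forall>\<^sub>F R in sequentially. B * (1 - (\<Sum>v\<in>K R. pv v)) < e / 3"
      by (rule order_tendstoD) (use e in simp)
    then obtain R where R: "B * (1 - (\<Sum>v\<in>K R. pv v)) < e / 3"
      using eventually_happens'[OF sequentially_bot] by blast
    have Pt: "(\<lambda>n. P n v) \<longlonglongrightarrow> pv v" for v unfolding P_def pv_def by (rule p)
    have "(\<lambda>n. B * (1 - (\<Sum>v\<in>K R. P n v))) \<longlonglongrightarrow> B * (1 - (\<Sum>v\<in>K R. pv v))"
      by (intro tendsto_intros Pt)
    then have "\<forall>\<^sub>F n in sequentially. B * (1 - (\<Sum>v\<in>K R. P n v)) < e / 3"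
      by (rule order_tendstoD) (rule R)
    moreover have "(\<lambda>n. \<Sum>v\<in>K R. P n v * f v) \<longlonglongrightarrow> (\<Sum>v\<in>K R. pv v * f v)"
      by (intro tendsto_intros Pt)
    then have "\<forall>\<^sub>F n in sequentially. dist (\<Sum>v\<in>K R. P n v * f v) (\<Sum>v\<in>K R. pv v * f v) < e / 3"
      by (rule tendstoD) (use e in simp)
    ultimately show "\<forall>\<^sub>F n in sequentially. dist (\<Sum>x\<in>\<Omega> n. w n x * f (restrict (T n x) D)) L < e"
      using \<Omega>(3)
    proof eventually_elim
      case (elim n)
      then show ?case
        using approx[of n R] L[of R] R unfolding dist_real_def K_def[symmetric] pv_def[symmetric] by linarith
    qed
  qed
qed

section \<open>The limiting law on Euclidean space\<close>

lemma integral_approx_by_atoms: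
  fixes f :: "'b \<Rightarrow> real"
  assumes "prob_space \<nu>" and f: "f \<in> borel_measurable \<nu>" and B: "\<And>x. x \<in> space \<nu> \<Longrightarrow> \<bar>f x\<bar> \<le> B"
    and K: "finite K" "\<And>v. v \<in> K \<Longrightarrow> {v} \<in> sets \<nu>"
  shows "\<bar>integral\<^sup>L \<nu> f - (\<Sum>v\<in>K. measure \<nu> {v} * f v)\<bar> \<le> B * (1 - (\<Sum>v\<in>K. measure \<nu> {v}))"
proof -
  interpret prob_space \<nu> by fact
  have KS: "K \<in> sets \<nu>" using K sets.finite_UN[of K "\<lambda>v. {v}"] by simp
  have int: "integrable \<nu> f"
    using B by (intro integrable_const_bound[of _ B] f) auto
  have intK: "integrable \<nu> (\<lambda>x. f x * indicator K x)"
    using integrable_mult_indicator[OF KS int] by (simp add: mult.commute)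
  have mK: "(\<Sum>v\<in>K. measure \<nu> {v}) = prob K"
    using K by (intro finite_measure_eq_sum_singleton[symmetric]) auto
  have "(\<integral>x. f x * indicator K x \<partial>\<nu>) = (\<integral>x. (\<Sum>v\<in>K. f v * indicator {v} x) \<partial>\<nu>)"
  proof (rule Bochner_Integration.integral_cong[OF refl])
    fix x
    show "f x * indicator K x = (\<Sum>v\<in>K. f v * indicator {v} x)"
      using K(1) by (simp add: indicator_def if_distrib cong: if_cong)
  qed
  also have "\<dots> = (\<Sum>v\<in>K. f v * measure \<nu> {v})"
  proof -
    have "integrable \<nu> (indicator {v} :: 'b \<Rightarrow> real)" if "v \<in> K" for v
      using K(2)[OF that] by (intro integrable_real_indicator) (auto simp: emeasure_eq_measure)
    then show ?thesis using K by (subst Bochner_Integration.integral_sum) auto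
  qed
  finally have eK: "(\<integral>x. f x * indicator K x \<partial>\<nu>) = (\<Sum>v\<in>K. measure \<nu> {v} * f v)"
    by (simp add: mult.commute)
  have "\<bar>integral\<^sup>L \<nu> f - (\<Sum>v\<in>K. measure \<nu> {v} * f v)\<bar> = \<bar>\<integral>x. f x - f x * indicator K x \<partial>\<nu>\<bar>"
    unfolding eK[symmetric] by (simp add: int intK)
  also have "\<dots> \<le> (\<integral>x. B * indicator (space \<nu> - K) x \<partial>\<nu>)"
  proof (rule order.trans)
    show "\<bar>\<integral>x. f x - f x * indicator K x \<partial>\<nu>\<bar> \<le> (\<integral>x. \<bar>f x - f x * indicator K x\<bar> \<partial>\<nu>)"
      by (rule integral_abs_bound)
    show "(\<integral>x. \<bar>f x - f x * indicator K x\<bar> \<partial>\<nu>) \<le> (\<integral>x. B * indicator (space \<nu> - K) x \<partial>\<nu>)"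
    proof (rule integral_mono)
      show "integrable \<nu> (\<lambda>x. \<bar>f x - f x * indicator K x\<bar>)" using int intK by simp
      show "integrable \<nu> (\<lambda>x. B * indicator (space \<nu> - K) x)"
        using KS by (intro integrable_mult_right integrable_real_indicator) (auto simp: emeasure_eq_measure)
      fix x assume "x \<in> space \<nu>"
      then show "\<bar>f x - f x * indicator K x\<bar> \<le> B * indicator (space \<nu> - K) x"
        using B[of x] by (auto simp: indicator_def)
    qed
  qed
  also have "\<dots> = B * prob (space \<nu> - K)" using KS by simp
  also have "\<dots> = B * (1 - (\<Sum>v\<in>K. measure \<nu> {v}))" using prob_compl[OF KS] mK by simp
  finally show ?thesis .
qed

text \<open>For functions on all of \<open>nat \<Rightarrow> real\<close> the Borel sets of the product topology are the product
\<open>\<sigma>\<close>-algebra.  The finite-dimensional space is a retract of it, by restriction and extension by zero.\<close>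

lemma continuous_map_Rk_measurable:
  fixes f :: "(nat \<Rightarrow> real) \<Rightarrow> real"
  assumes f: "continuous_map (Rk_top k) euclideanreal f"
  shows "f \<in> borel_measurable (Rk_borel k)"
proof -
  let ?I = "{1..k}"
  define h where "h = (\<lambda>x :: nat \<Rightarrow> real. f (restrict x ?I))"
  define ext where "ext = (\<lambda>x :: nat \<Rightarrow> real. \<lambda>i. if i \<in> ?I then x i else 0)"
  have "continuous_map euclidean (Rk_top k) (\<lambda>x :: nat \<Rightarrow> real. restrict x ?I)"
    unfolding continuous_map_componentwise
    by (auto intro: continuous_on_product_coordinates)
  then have "continuous_map euclidean euclideanreal h"
    unfolding h_def by (rule continuous_map_compose[OF _ f, unfolded comp_def])
  then have "continuous_on UNIV h" by simp
  then have h: "h \<in> borel_measurable borel" by (rule borel_measurable_continuous_onI)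
  have "ext \<in> measurable (Rk_borel k) (PiM UNIV (\<lambda>_. borel))"
  proof (rule measurable_PiM_single')
    fix i
    show "(\<lambda>x. ext x i) \<in> borel_measurable (Rk_borel k)"
      unfolding ext_def by (cases "i \<in> ?I") (simp_all only: if_True if_False, simp_all)
  qed simp
  then have "ext \<in> measurable (Rk_borel k) borel"
    using measurable_cong_sets[OF refl sets_PiM_equal_borel] by blast
  then have "(\<lambda>x. h (ext x)) \<in> borel_measurable (Rk_borel k)"
    using h by (rule measurable_compose)
  moreover have "h (ext x) = f x" if "x \<in> space (Rk_borel k)" for x
  proof -
    have "restrict (ext x) ?I = x"
      using that by (auto simp: space_PiM PiE_def extensional_def ext_def fun_eq_iff)
    then show ?thesis by (simp add: h_def)
  qed
  ultimately show ?thesis by (subst measurable_cong[of _ f "\<lambda>x. h (ext x)"]) simp_all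
qed

lemma singleton_restrict_eq_PiE: "{restrict g I} = (\<Pi>\<^sub>E i\<in>I. {g i})"
proof -
  have "(\<Pi>\<^sub>E i\<in>I. {restrict g I i}) = {restrict g I}" by (rule PiE_singleton) (rule restrict_extensional)
  moreover have "(\<Pi>\<^sub>E i\<in>I. {restrict g I i}) = (\<Pi>\<^sub>E i\<in>I. {g i})" by (rule PiE_cong) simp
  ultimately show ?thesis by simp
qed

lemma poisson_vector_law_props:
  shows "prob_space (poisson_vector_law k)"
    and "sets (poisson_vector_law k) = sets (Rk_borel k)"
    and "v \<in> {1..k} \<rightarrow>\<^sub>E UNIV \<Longrightarrow> measure (poisson_vector_law k) {\<lambda>d\<in>{1..k}. real (v d)}
      = (\<Prod>d\<in>{1..k}. (1 / real d) ^ v d / fact (v d) * exp (- (1 / real d)))"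
proof -
  let ?P = "\<lambda>d. distr (measure_pmf (poisson_pmf (1 / real d))) borel real"
  have pr: "prob_space (?P d)" for d
    by (intro prob_space.prob_space_distr measure_pmf.prob_space_axioms) simp
  interpret P: product_prob_space ?P "{1..k}"
    by (intro product_prob_spaceI pr)
  show "prob_space (poisson_vector_law k)"
    unfolding poisson_vector_law_def by (rule prob_space_PiM[OF pr])
  show "sets (poisson_vector_law k) = sets (Rk_borel k)"
    unfolding poisson_vector_law_def by (rule sets_PiM_cong) auto
  have "{\<lambda>d\<in>{1..k}. real (v d)} = (\<Pi>\<^sub>E d\<in>{1..k}. {real (v d)})"
    by (rule singleton_restrict_eq_PiE)
  then have "measure (poisson_vector_law k) {\<lambda>d\<in>{1..k}. real (v d)} = (\<Prod>d\<in>{1..k}. measure (?P d) {real (v d)})"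
    unfolding poisson_vector_law_def using P.measure_PiM_emb[of "{1..k}" "\<lambda>d. {real (v d)}"]
    by (simp add: prod_emb_PiE_same_index)
  also have "\<dots> = (\<Prod>d\<in>{1..k}. (1 / real d) ^ v d / fact (v d) * exp (- (1 / real d)))"
  proof (rule prod.cong[OF refl])
    fix d assume "d \<in> {1..k}"
    then have d: "0 < 1 / real d" by simp
    have "measure (?P d) {real (v d)} = pmf (poisson_pmf (1 / real d)) (v d)"
      by (subst measure_distr) (auto simp: vimage_def measure_pmf_single)
    then show "measure (?P d) {real (v d)} = (1 / real d) ^ v d / fact (v d) * exp (- (1 / real d))"
      using d by simp
  qed
  finally show "measure (poisson_vector_law k) {\<lambda>d\<in>{1..k}. real (v d)}
      = (\<Prod>d\<in>{1..k}. (1 / real d) ^ v d / fact (v d) * exp (- (1 / real d)))" .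
qed

lemma poisson_vector_integral_approx:
  fixes f :: "(nat \<Rightarrow> real) \<Rightarrow> real"
  assumes f: "continuous_map (Rk_top k) euclideanreal f" and B: "\<And>x. x \<in> topspace (Rk_top k) \<Longrightarrow> \<bar>f x\<bar> \<le> B"
  defines "q \<equiv> \<lambda>d i. (1 / real d) ^ i / fact i * exp (- (1 / real d))"
  shows "\<bar>integral\<^sup>L (poisson_vector_law k) f
      - (\<Sum>v\<in>{1..k} \<rightarrow>\<^sub>E {..R}. (\<Prod>d\<in>{1..k}. q d (v d)) * f (\<lambda>d\<in>{1..k}. real (v d)))\<bar>
    \<le> B * (1 - (\<Sum>v\<in>{1..k} \<rightarrow>\<^sub>E {..R}. \<Prod>d\<in>{1..k}. q d (v d)))"
proof -
  let ?\<nu> = "poisson_vector_law k"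
  define \<iota> where "\<iota> v = (\<lambda>d\<in>{1..k}. real (v d))" for v
  define K where "K = {1..k} \<rightarrow>\<^sub>E {..R}"
  have finK: "finite K" unfolding K_def by (intro finite_PiE) auto
  have inj: "inj_on \<iota> K"
  proof (rule inj_onI)
    fix u v assume uv: "u \<in> K" "v \<in> K" "\<iota> u = \<iota> v"
    show "u = v"
    proof (rule PiE_ext)
      show "u \<in> {1..k} \<rightarrow>\<^sub>E {..R}" "v \<in> {1..k} \<rightarrow>\<^sub>E {..R}" using uv by (simp_all add: K_def)
      fix d assume d: "d \<in> {1..k}"
      have "\<iota> u d = \<iota> v d" using uv by simp
      then show "u d = v d" using d by (simp add: \<iota>_def)
    qed
  qed
  have sp: "space ?\<nu> = topspace (Rk_top k)"
    unfolding poisson_vector_law_def by (simp add: space_PiM)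
  have fm: "f \<in> borel_measurable ?\<nu>"
    using continuous_map_Rk_measurable[OF f] measurable_cong_sets[OF poisson_vector_law_props(2) refl] by blast
  have at: "{w} \<in> sets ?\<nu>" if "w \<in> \<iota> ` K" for w
  proof -
    from that obtain v where "w = \<iota> v" by blast
    then have "{w} = (\<Pi>\<^sub>E d\<in>{1..k}. {real (v d)})"
      unfolding \<iota>_def by (simp only: singleton_restrict_eq_PiE)
    also have "\<dots> \<in> sets (Rk_borel k)" by (rule sets_PiM_I_finite) auto
    finally show ?thesis unfolding poisson_vector_law_props(2) .
  qed
  have m: "measure ?\<nu> {\<iota> v} = (\<Prod>d\<in>{1..k}. q d (v d))" if "v \<in> K" for v
    unfolding \<iota>_def q_def by (rule poisson_vector_law_props(3)) (use that in \<open>auto simp: K_def\<close>)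
  have "\<bar>integral\<^sup>L ?\<nu> f - (\<Sum>w\<in>\<iota> ` K. measure ?\<nu> {w} * f w)\<bar>
      \<le> B * (1 - (\<Sum>w\<in>\<iota> ` K. measure ?\<nu> {w}))"
    by (rule integral_approx_by_atoms[OF poisson_vector_law_props(1) fm]) (use B sp finK at in auto)
  moreover have "(\<Sum>w\<in>\<iota> ` K. measure ?\<nu> {w} * f w) = (\<Sum>v\<in>K. (\<Prod>d\<in>{1..k}. q d (v d)) * f (\<iota> v))"
    "(\<Sum>w\<in>\<iota> ` K. measure ?\<nu> {w}) = (\<Sum>v\<in>K. \<Prod>d\<in>{1..k}. q d (v d))"
    using m by (simp_all add: sum.reindex[OF inj])
  ultimately show ?thesis by (simp only: K_def \<iota>_def)
qed

section \<open>Conjugation invariance and independence\<close>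

definition conj_by :: "('a \<Rightarrow> 'a) \<Rightarrow> ('a \<Rightarrow> 'a) \<Rightarrow> 'a \<Rightarrow> 'a" where
  "conj_by \<sigma> q = inv \<sigma> \<circ> q \<circ> \<sigma>"

lemma conj_by_permutes: "\<sigma> permutes A \<Longrightarrow> q permutes A \<Longrightarrow> conj_by \<sigma> q permutes A"
  unfolding conj_by_def by (intro permutes_compose permutes_inv)

lemma conj_by_inv:
  assumes "\<sigma> permutes A"
  shows "conj_by \<sigma> (conj_by (inv \<sigma>) q) = q" "conj_by (inv \<sigma>) (conj_by \<sigma> q) = q"
  using permutes_inverses[OF assms] by (simp_all add: conj_by_def fun_eq_iff permutes_inv_inv[OF assms])

text \<open>The map \<open>\<sigma>\<close> carries the cycles of \<open>\<sigma>\<^sup>-\<^sup>1 q \<sigma>\<close> to those of \<open>q\<close>.\<close>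

lemma cycles_of_length_conj_by:
  assumes \<sigma>: "\<sigma> permutes A"
  shows "card (cycles_of_length d (conj_by \<sigma> q) A) = card (cycles_of_length d q A)"
proof -
  have im: "\<tau> ` C \<in> cycles_of_length d r A"
    if "C \<in> cycles_of_length d (conj_by \<tau> r) A" "\<tau> permutes A" for C \<tau> r
  proof -
    have C: "C \<subseteq> A" "cyclic_on (conj_by \<tau> r) C" "card C = d"
      using that(1) by (auto simp: cycles_of_length_def)
    have "cyclic_on r (\<tau> ` C)"
      by (rule cyclic_on_image[OF C(2)]) (simp add: conj_by_def permutes_inverses[OF that(2)])
    moreover have "card (\<tau> ` C) = d"
      using C(3) inj_on_subset[OF permutes_inj[OF that(2)], of C] by (simp add: card_image)
    moreover have "\<tau> ` C \<subseteq> A" using C(1) permutes_image[OF that(2)] by blast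
    ultimately show ?thesis by (simp add: cycles_of_length_def)
  qed
  have 1: "\<sigma> ` C \<in> cycles_of_length d q A" if "C \<in> cycles_of_length d (conj_by \<sigma> q) A" for C
    by (rule im[OF that \<sigma>])
  have 2: "inv \<sigma> ` C \<in> cycles_of_length d (conj_by \<sigma> q) A" if "C \<in> cycles_of_length d q A" for C
    by (rule im[OF _ permutes_inv[OF \<sigma>]]) (use that in \<open>simp add: conj_by_inv[OF \<sigma>]\<close>)
  have "inv \<sigma> ` \<sigma> ` C = C" "\<sigma> ` inv \<sigma> ` C = C" for C
    by (simp_all add: image_image permutes_inverses[OF \<sigma>])
  then have "bij_betw (image \<sigma>) (cycles_of_length d (conj_by \<sigma> q) A) (cycles_of_length d q A)"
    using 1 2 by (intro bij_betw_byWitness[where f' = "image (inv \<sigma>)"] ballI image_subsetI)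
  then show ?thesis by (rule bij_betw_same_card)
qed

lemma num_cycles_conj_by:
  assumes "\<sigma> \<in> Perms n"
  shows "num_cycles n d (conj_by \<sigma> q) = num_cycles n d q"
  using cycles_of_length_conj_by[of \<sigma> "{1..n}" d q] assms by (simp add: num_cycles_def cycles_of_length_def)

lemma card_period_pts_num_cycles:
  assumes "q \<in> Perms n" "d \<ge> 1"
  shows "card (period_pts d q {1..n}) = d * num_cycles n d q"
  using card_period_pts[of q "{1..n}" d] assms permutes_image[of q "{1..n}"] permutation_of_permutes[of q "{1..n}"]
  by (simp add: num_cycles_def cycles_of_length_def)

lemma sparse_cycles_conj_by:
  assumes "\<sigma> \<in> Perms n" "q \<in> Perms n"
  shows "sparse_cycles \<eta> r {1..n} (conj_by \<sigma> q) \<longleftrightarrow> sparse_cycles \<eta> r {1..n} q"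
proof -
  have "card (period_pts d (conj_by \<sigma> q) {1..n}) = card (period_pts d q {1..n})" if "d \<ge> 1" for d
  proof -
    have "conj_by \<sigma> q \<in> Perms n" using assms conj_by_permutes[of \<sigma> "{1..n}" q] by simp
    then show ?thesis
      using card_period_pts_num_cycles[OF _ that] assms(2) num_cycles_conj_by[OF assms(1)] by metis
  qed
  then show ?thesis by (simp add: sparse_cycles_def)
qed

text \<open>For \<open>d \<ge> 3\<close> the required bound is at least \<open>n\<close>, which is where \<open>1 \<le> \<eta> \<surd>n\<close> enters.\<close>

lemma sparse_cycles_of_few_short_cycles:
  assumes q: "q \<in> Perms n" and n: "n \<ge> 1" and \<eta>: "1 \<le> \<eta> * sqrt n"
    and 1: "real (num_cycles n 1 q) / sqrt n \<le> \<eta>" and 2: "2 * real (num_cycles n 2 q) / n \<le> \<eta>"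
  shows "sparse_cycles \<eta> (sqrt n) {1..n} q"
  unfolding sparse_cycles_def
proof (intro allI impI)
  fix d :: nat assume d: "d \<ge> 1"
  have s: "sqrt n > 0" "sqrt n \<ge> 1" "sqrt n ^ 2 = real n" using n by simp_all
  consider "d = 1" | "d = 2" | "d \<ge> 3" using d by linarith
  then show "real (card (period_pts d q {1..n})) \<le> \<eta> * sqrt n ^ d"
  proof cases
    case 1
    then show ?thesis
      using assms(4) s unfolding card_period_pts_num_cycles[OF q d] by (simp add: divide_le_eq)
  next
    case 2
    then show ?thesis
      using assms(5) s n unfolding card_period_pts_num_cycles[OF q d] by (simp add: divide_le_eq)
  next
    case 3
    have "card (period_pts d q {1..n}) \<le> card {1..n}"
      by (intro card_mono) (auto simp: period_pts_def)
    then have "real (card (period_pts d q {1..n})) \<le> 1 * sqrt n ^ 2" using s(3) by simp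
    also have "\<dots> \<le> (\<eta> * sqrt n) * sqrt n ^ (d - 1)"
      using \<eta> s 3 by (intro mult_mono power_increasing) auto
    also have "\<dots> = \<eta> * sqrt n ^ d" using d by (cases d) simp_all
    finally show ?thesis .
  qed
qed

lemma foldr_comp_permutes:
  "(\<And>l. l \<in> set ls \<Longrightarrow> p l permutes A) \<Longrightarrow> foldr (\<circ>) (map p ls) id permutes A"
  by (induction ls) (auto intro!: permutes_compose permutes_id)

lemma perm_prod_cong: "(\<And>l. l \<in> {1..m} \<Longrightarrow> p l = q l) \<Longrightarrow> perm_prod m p = perm_prod m q"
  unfolding perm_prod_def by (intro arg_cong[where f = "\<lambda>xs. foldr (\<circ>) xs id"] map_cong) auto

lemma perm_prod_conj_by:
  assumes \<sigma>: "\<sigma> permutes A"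
  shows "perm_prod m (\<lambda>l. conj_by \<sigma> (p l)) = conj_by \<sigma> (perm_prod m p)"
proof -
  have "foldr (\<circ>) (map (\<lambda>l. conj_by \<sigma> (p l)) ls) id = conj_by \<sigma> (foldr (\<circ>) (map p ls) id)" for ls
    by (induction ls) (simp_all add: conj_by_def fun_eq_iff permutes_inverses[OF \<sigma>])
  then show ?thesis by (simp add: perm_prod_def)
qed

lemma perm_prod_split:
  fixes p :: "nat \<Rightarrow> nat \<Rightarrow> nat"
  assumes ij: "1 \<le> i" "i < j" "j \<le> m" and p: "\<And>l. l \<in> {1..m} \<Longrightarrow> p l permutes A"
  shows "\<exists>P Q R. P permutes A \<and> Q permutes A \<and> R permutes A \<and>
    (\<forall>a b. perm_prod m (p(i := a, j := b)) = P \<circ> a \<circ> Q \<circ> b \<circ> R)"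
proof -
  let ?f = "\<lambda>ls. foldr (\<circ>) (map p ls) id"
  have foldr_id: "foldr (\<circ>) xs g = foldr (\<circ>) xs id \<circ> g" for xs and g :: "nat \<Rightarrow> nat"
    by (induction xs) (simp_all add: comp_assoc)
  have perms: "?f [1..<i] permutes A" "?f [Suc i..<j] permutes A" "?f [Suc j..<Suc m] permutes A"
    using ij by (auto intro!: foldr_comp_permutes p simp del: upt_Suc)
  have l: "[1..<Suc m] = [1..<i] @ i # [Suc i..<j] @ j # [Suc j..<Suc m]"
  proof -
    have "[1..<Suc m] = [1..<i] @ [i..<Suc m]"
      using ij upt_add_eq_append[of 1 i "Suc m - i"] by simp
    also have "[i..<Suc m] = [i..<j] @ [j..<Suc m]"
      using ij upt_add_eq_append[of i j "Suc m - j"] by simp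
    also have "[i..<j] = i # [Suc i..<j]" using ij by (simp add: upt_conv_Cons)
    also have "[j..<Suc m] = j # [Suc j..<Suc m]" using ij by (simp add: upt_conv_Cons del: upt_Suc)
    finally show ?thesis by simp
  qed
  have m1: "map (p(i := a, j := b)) [1..<i] = map p [1..<i]"
    "map (p(i := a, j := b)) [Suc i..<j] = map p [Suc i..<j]"
    "map (p(i := a, j := b)) [Suc j..<Suc m] = map p [Suc j..<Suc m]" for a b
    using ij by (auto simp del: upt_Suc)
  have "perm_prod m (p(i := a, j := b)) = ?f [1..<i] \<circ> a \<circ> ?f [Suc i..<j] \<circ> b \<circ> ?f [Suc j..<Suc m]" for a b
  proof -
    have "(p(i := a, j := b)) i = a" "(p(i := a, j := b)) j = b" using ij by simp_all
    then have "perm_prod m (p(i := a, j := b))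
        = foldr (\<circ>) (map p [1..<i]) (a \<circ> foldr (\<circ>) (map p [Suc i..<j]) (b \<circ> ?f [Suc j..<Suc m]))"
      unfolding perm_prod_def l map_append list.map m1 foldr_append foldr_Cons o_apply by (simp only:)
    also have "\<dots> = ?f [1..<i] \<circ> (a \<circ> (?f [Suc i..<j] \<circ> (b \<circ> ?f [Suc j..<Suc m])))"
      by (subst foldr_id[of "map p [1..<i]"], subst foldr_id[of "map p [Suc i..<j]"]) (rule refl)
    finally show ?thesis by (simp only: comp_assoc)
  qed
  with perms show ?thesis by (intro exI conjI allI)
qed

lemma sum_product_weights_bij:
  fixes \<mu> :: "'l \<Rightarrow> 'q \<Rightarrow> real"
  assumes \<phi>: "\<And>l q. l \<in> I \<Longrightarrow> q \<in> A \<Longrightarrow> \<phi> l q \<in> A \<and> \<psi> l q \<in> A \<and> \<psi> l (\<phi> l q) = q \<and> \<phi> l (\<psi> l q) = q"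
    and \<mu>: "\<And>l q. l \<in> I \<Longrightarrow> q \<in> A \<Longrightarrow> \<mu> l (\<phi> l q) = \<mu> l q"
  shows "(\<Sum>p\<in>I \<rightarrow>\<^sub>E A. (\<Prod>l\<in>I. \<mu> l (p l)) * H (\<lambda>l\<in>I. \<phi> l (p l)))
    = (\<Sum>p\<in>I \<rightarrow>\<^sub>E A. (\<Prod>l\<in>I. \<mu> l (p l)) * H p)"
proof (rule sum.reindex_bij_witness[where i = "\<lambda>p. \<lambda>l\<in>I. \<psi> l (p l)" and j = "\<lambda>p. \<lambda>l\<in>I. \<phi> l (p l)"])
  fix p assume p: "p \<in> I \<rightarrow>\<^sub>E A"
  then have pl: "p l \<in> A" if "l \<in> I" for l using that by auto
  show "(\<lambda>l\<in>I. \<phi> l (p l)) \<in> I \<rightarrow>\<^sub>E A" "(\<lambda>l\<in>I. \<psi> l (p l)) \<in> I \<rightarrow>\<^sub>E A"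
    using \<phi> pl by auto
  show "(\<lambda>l\<in>I. \<psi> l ((\<lambda>l\<in>I. \<phi> l (p l)) l)) = p" "(\<lambda>l\<in>I. \<phi> l ((\<lambda>l\<in>I. \<psi> l (p l)) l)) = p"
    using p \<phi> pl by (auto simp: fun_eq_iff PiE_def extensional_def)
  show "(\<Prod>l\<in>I. \<mu> l ((\<lambda>l\<in>I. \<phi> l (p l)) l)) * H (\<lambda>l\<in>I. \<phi> l (p l)) =
      (\<Prod>l\<in>I. \<mu> l (p l)) * H (\<lambda>l\<in>I. \<phi> l (p l))"
    using \<mu> pl by (simp cong: prod.cong)
qed

lemma sum_conj_by_one_factor:
  fixes \<mu> :: "'l \<Rightarrow> ('a \<Rightarrow> 'a) \<Rightarrow> real"
  assumes \<mu>: "\<forall>l\<in>I - {l0}. \<forall>\<sigma> q. \<sigma> permutes A \<longrightarrow> q permutes A \<longrightarrow> \<mu> l (conj_by \<sigma> q) = \<mu> l q"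
    and l: "l \<in> I" "l \<noteq> l0" and \<sigma>: "\<sigma> permutes A"
  shows "(\<Sum>p\<in>I \<rightarrow>\<^sub>E {q. q permutes A}. (\<Prod>l\<in>I. \<mu> l (p l)) * H (p(l := conj_by \<sigma> (p l))))
    = (\<Sum>p\<in>I \<rightarrow>\<^sub>E {q. q permutes A}. (\<Prod>l\<in>I. \<mu> l (p l)) * H p)"
proof -
  let ?\<phi> = "\<lambda>k q. if k = l then conj_by \<sigma> q else q" and ?\<psi> = "\<lambda>k q. if k = l then conj_by (inv \<sigma>) q else q"
  have "(\<lambda>k\<in>I. ?\<phi> k (p k)) = p(l := conj_by \<sigma> (p l))" if "p \<in> I \<rightarrow>\<^sub>E {q. q permutes A}" for p
    using that l(1) by (auto simp: fun_eq_iff PiE_def extensional_def)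
  then have "(\<Sum>p\<in>I \<rightarrow>\<^sub>E {q. q permutes A}. (\<Prod>l\<in>I. \<mu> l (p l)) * H (p(l := conj_by \<sigma> (p l))))
    = (\<Sum>p\<in>I \<rightarrow>\<^sub>E {q. q permutes A}. (\<Prod>l\<in>I. \<mu> l (p l)) * H (\<lambda>k\<in>I. ?\<phi> k (p k)))"
    by simp
  also have "\<dots> = (\<Sum>p\<in>I \<rightarrow>\<^sub>E {q. q permutes A}. (\<Prod>l\<in>I. \<mu> l (p l)) * H p)"
    using \<mu> l \<sigma> by (intro sum_product_weights_bij[where \<psi> = ?\<psi>])
      (auto simp: conj_by_permutes permutes_inv conj_by_inv[OF \<sigma>])
  finally show ?thesis .
qed

text \<open>Conjugating the exceptional factor by \<open>\<sigma>\<close> has the same effect on a class function as conjugating all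
other factors by \<open>\<sigma>\<^sup>-\<^sup>1\<close>, and their laws are invariant.\<close>

lemma sum_conj_by_exceptional_factor:
  fixes \<mu> :: "'l \<Rightarrow> ('a \<Rightarrow> 'a) \<Rightarrow> real"
  assumes \<mu>: "\<forall>l\<in>I - {l0}. \<forall>\<sigma> q. \<sigma> permutes A \<longrightarrow> q permutes A \<longrightarrow> \<mu> l (conj_by \<sigma> q) = \<mu> l q"
    and H: "\<forall>\<sigma>. \<sigma> permutes A \<longrightarrow> (\<forall>p\<in>I \<rightarrow>\<^sub>E {q. q permutes A}. H (\<lambda>l\<in>I. conj_by \<sigma> (p l)) = H p)"
    and l0: "l0 \<in> I" and \<sigma>: "\<sigma> permutes A"
  shows "(\<Sum>p\<in>I \<rightarrow>\<^sub>E {q. q permutes A}. (\<Prod>l\<in>I. \<mu> l (p l)) * H (p(l0 := conj_by \<sigma> (p l0))))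
    = (\<Sum>p\<in>I \<rightarrow>\<^sub>E {q. q permutes A}. (\<Prod>l\<in>I. \<mu> l (p l)) * H p)"
proof -
  let ?\<phi> = "\<lambda>k q. if k = l0 then q else conj_by (inv \<sigma>) q" and ?\<psi> = "\<lambda>k q. if k = l0 then q else conj_by \<sigma> q"
  have "H (p(l0 := conj_by \<sigma> (p l0))) = H (\<lambda>k\<in>I. ?\<phi> k (p k))" if p: "p \<in> I \<rightarrow>\<^sub>E {q. q permutes A}" for p
  proof -
    have "p(l0 := conj_by \<sigma> (p l0)) \<in> I \<rightarrow>\<^sub>E {q. q permutes A}"
      using p l0 \<sigma> conj_by_permutes[OF \<sigma>, of "p l0"] by (auto simp: PiE_iff extensional_def)
    from H[rule_format, OF permutes_inv[OF \<sigma>] this]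
    have "H (p(l0 := conj_by \<sigma> (p l0))) = H (\<lambda>k\<in>I. conj_by (inv \<sigma>) ((p(l0 := conj_by \<sigma> (p l0))) k))" ..
    also have "(\<lambda>k\<in>I. conj_by (inv \<sigma>) ((p(l0 := conj_by \<sigma> (p l0))) k)) = (\<lambda>k\<in>I. ?\<phi> k (p k))"
      by (simp add: fun_eq_iff conj_by_inv[OF \<sigma>] restrict_def)
    finally show ?thesis .
  qed
  then have "(\<Sum>p\<in>I \<rightarrow>\<^sub>E {q. q permutes A}. (\<Prod>l\<in>I. \<mu> l (p l)) * H (p(l0 := conj_by \<sigma> (p l0))))
    = (\<Sum>p\<in>I \<rightarrow>\<^sub>E {q. q permutes A}. (\<Prod>l\<in>I. \<mu> l (p l)) * H (\<lambda>k\<in>I. ?\<phi> k (p k)))"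
    by simp
  also have "\<dots> = (\<Sum>p\<in>I \<rightarrow>\<^sub>E {q. q permutes A}. (\<Prod>l\<in>I. \<mu> l (p l)) * H p)"
    using \<mu> l0 \<sigma> by (intro sum_product_weights_bij[where \<psi> = ?\<psi>])
      (auto simp: conj_by_permutes permutes_inv conj_by_inv[OF \<sigma>])
  finally show ?thesis .
qed

text \<open>At most one of \<open>i\<close>, \<open>j\<close> is exceptional.  The conjugation at the other one is undone first: this
step works for arbitrary functions of the factors, in particular for those in which the exceptional factor is
still conjugated.  What remains is the case of a single factor.\<close>

lemma sum_conj_by_two_factors:
  fixes \<mu> :: "'l \<Rightarrow> ('a \<Rightarrow> 'a) \<Rightarrow> real"
  assumes \<mu>: "\<forall>l\<in>I - {l0}. \<forall>\<sigma> q. \<sigma> permutes A \<longrightarrow> q permutes A \<longrightarrow> \<mu> l (conj_by \<sigma> q) = \<mu> l q"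
    and H: "\<forall>\<sigma>. \<sigma> permutes A \<longrightarrow> (\<forall>p\<in>I \<rightarrow>\<^sub>E {q. q permutes A}. H (\<lambda>l\<in>I. conj_by \<sigma> (p l)) = H p)"
    and ij: "i \<in> I" "j \<in> I" "i \<noteq> j" and \<sigma>: "\<sigma> permutes A" "\<tau> permutes A"
  shows "(\<Sum>p\<in>I \<rightarrow>\<^sub>E {q. q permutes A}. (\<Prod>l\<in>I. \<mu> l (p l)) * H (p(i := conj_by \<sigma> (p i), j := conj_by \<tau> (p j))))
    = (\<Sum>p\<in>I \<rightarrow>\<^sub>E {q. q permutes A}. (\<Prod>l\<in>I. \<mu> l (p l)) * H p)"
proof -
  have one: "(\<Sum>p\<in>I \<rightarrow>\<^sub>E {q. q permutes A}. (\<Prod>l\<in>I. \<mu> l (p l)) * H (p(l := conj_by \<rho> (p l))))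
    = (\<Sum>p\<in>I \<rightarrow>\<^sub>E {q. q permutes A}. (\<Prod>l\<in>I. \<mu> l (p l)) * H p)"
    if "l \<in> I" "\<rho> permutes A" for l \<rho>
  proof (cases "l = l0")
    case True
    show ?thesis unfolding True
      by (rule sum_conj_by_exceptional_factor[OF \<mu> H]) (use that True in auto)
  next
    case False
    then show ?thesis by (rule sum_conj_by_one_factor[OF \<mu> that(1) _ that(2)])
  qed
  have two: "(\<Sum>p\<in>I \<rightarrow>\<^sub>E {q. q permutes A}. (\<Prod>l\<in>I. \<mu> l (p l)) * H (p(k := conj_by \<rho> (p k), l := conj_by \<rho>' (p l))))
    = (\<Sum>p\<in>I \<rightarrow>\<^sub>E {q. q permutes A}. (\<Prod>l\<in>I. \<mu> l (p l)) * H p)"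
    if "l \<in> I" "l \<noteq> l0" "k \<in> I" "k \<noteq> l" "\<rho> permutes A" "\<rho>' permutes A" for k l \<rho> \<rho>'
  proof -
    let ?H = "\<lambda>p. H (p(k := conj_by \<rho> (p k)))"
    have "p(k := conj_by \<rho> (p k), l := conj_by \<rho>' (p l))
        = (p(l := conj_by \<rho>' (p l)))(k := conj_by \<rho> ((p(l := conj_by \<rho>' (p l))) k))" for p :: "'l \<Rightarrow> 'a \<Rightarrow> 'a"
      using that(4) by (auto simp: fun_eq_iff)
    then show ?thesis
      using sum_conj_by_one_factor[OF \<mu> that(1,2,6), where H = ?H] one[OF that(3,5)] by simp
  qed
  show ?thesis
  proof (cases "j = l0")
    case False
    then show ?thesis using two ij \<sigma> by simp
  next
    case True
    then have "(\<Sum>p\<in>I \<rightarrow>\<^sub>E {q. q permutes A}. (\<Prod>l\<in>I. \<mu> l (p l)) * H (p(j := conj_by \<tau> (p j), i := conj_by \<sigma> (p i))))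
      = (\<Sum>p\<in>I \<rightarrow>\<^sub>E {q. q permutes A}. (\<Prod>l\<in>I. \<mu> l (p l)) * H p)"
      using two ij \<sigma> by simp
    then show ?thesis using ij(3) by (simp add: fun_upd_twist)
  qed
qed

context prob_space
begin

lemma tuple_measurable:
  assumes I: "finite I" "I \<noteq> {}" and A: "finite A"
    and X: "\<And>l. l \<in> I \<Longrightarrow> X l \<in> measurable M (count_space A)"
  shows "(\<lambda>\<omega>. \<lambda>l\<in>I. X l \<omega>) \<in> measurable M (count_space (I \<rightarrow>\<^sub>E A))"
proof (subst measurable_count_space_eq2, intro finite_PiE I A, intro conjI ballI)
  have XA: "X l \<omega> \<in> A" if "l \<in> I" "\<omega> \<in> space M" for l \<omega>
    using measurable_space[OF X[OF that(1)] that(2)] by simp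
  then show "(\<lambda>\<omega>. \<lambda>l\<in>I. X l \<omega>) \<in> space M \<rightarrow> (I \<rightarrow>\<^sub>E A)" by auto
  fix p assume p: "p \<in> I \<rightarrow>\<^sub>E A"
  have "(\<lambda>\<omega>. \<lambda>l\<in>I. X l \<omega>) -` {p} \<inter> space M = (\<Inter>l\<in>I. X l -` {p l} \<inter> space M)"
    using p I by (auto simp: fun_eq_iff PiE_def extensional_def restrict_def)
  moreover have "X l -` {p l} \<inter> space M \<in> sets M" if "l \<in> I" for l
    using p that by (intro measurable_sets[OF X]) auto
  then have "(\<Inter>l\<in>I. X l -` {p l} \<inter> space M) \<in> sets M"
    using I by (intro sets.finite_INT)
  ultimately show "(\<lambda>\<omega>. \<lambda>l\<in>I. X l \<omega>) -` {p} \<inter> space M \<in> sets M" by (simp only:)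
qed

lemma expectation_independent_tuple:
  fixes F :: "('l \<Rightarrow> 'b) \<Rightarrow> real"
  assumes I: "finite I" "I \<noteq> {}" and A: "finite A"
    and X: "\<And>l. l \<in> I \<Longrightarrow> X l \<in> measurable M (count_space A)"
    and indep: "indep_vars (\<lambda>_. count_space A) X I"
  shows "expectation (\<lambda>\<omega>. F (\<lambda>l\<in>I. X l \<omega>))
    = (\<Sum>p\<in>I \<rightarrow>\<^sub>E A. (\<Prod>l\<in>I. prob (X l -` {p l} \<inter> space M)) * F p)"
proof -
  let ?T = "\<lambda>\<omega>. \<lambda>l\<in>I. X l \<omega>" and ?\<Omega> = "I \<rightarrow>\<^sub>E A"
  define E where "E p = (\<Inter>l\<in>I. X l -` {p l} \<inter> space M)" for p
  have fin: "finite ?\<Omega>" using I A by (intro finite_PiE) auto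
  have XA: "X l \<omega> \<in> A" if "l \<in> I" "\<omega> \<in> space M" for l \<omega>
    using measurable_space[OF X[OF that(1)] that(2)] by simp
  have "X l -` {p l} \<inter> space M \<in> sets M" if "l \<in> I" "p \<in> ?\<Omega>" for l p
    using that by (intro measurable_sets[OF X]) auto
  then have Em: "E p \<in> sets M" if "p \<in> ?\<Omega>" for p
    unfolding E_def using I that by (intro sets.finite_INT) auto
  have Emem: "\<omega> \<in> E p \<longleftrightarrow> p = ?T \<omega>" if "p \<in> ?\<Omega>" "\<omega> \<in> space M" for p \<omega>
    using that I by (auto simp: E_def fun_eq_iff PiE_def extensional_def restrict_def)
  have "expectation (\<lambda>\<omega>. F (?T \<omega>)) = expectation (\<lambda>\<omega>. \<Sum>p\<in>?\<Omega>. F p * indicator (E p) \<omega>)"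
  proof (rule Bochner_Integration.integral_cong[OF refl])
    fix \<omega> assume \<omega>: "\<omega> \<in> space M"
    have "?T \<omega> \<in> ?\<Omega>" using XA \<omega> by auto
    have "(\<Sum>p\<in>?\<Omega>. F p * indicator (E p) \<omega>) = (\<Sum>p\<in>?\<Omega>. if p = ?T \<omega> then F p else 0)"
      by (intro sum.cong refl) (simp add: indicator_def Emem[OF _ \<omega>])
    also have "\<dots> = F (?T \<omega>)" using fin \<open>?T \<omega> \<in> ?\<Omega>\<close> by simp
    finally show "F (?T \<omega>) = (\<Sum>p\<in>?\<Omega>. F p * indicator (E p) \<omega>)" ..
  qed
  also have "\<dots> = (\<Sum>p\<in>?\<Omega>. expectation (\<lambda>\<omega>. F p * indicator (E p) \<omega>))"
    using Em by (intro Bochner_Integration.integral_sum integrable_mult_right integrable_real_indicator)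
      (auto simp: emeasure_eq_measure)
  also have "\<dots> = (\<Sum>p\<in>?\<Omega>. prob (E p) * F p)"
    using Em sets.sets_into_space by (intro sum.cong refl) (simp add: Int_absorb2 mult.commute)
  also have "\<dots> = (\<Sum>p\<in>?\<Omega>. (\<Prod>l\<in>I. prob (X l -` {p l} \<inter> space M)) * F p)"
  proof (intro sum.cong refl arg_cong2[where f = "(*)"])
    fix p assume "p \<in> ?\<Omega>"
    then show "prob (E p) = (\<Prod>l\<in>I. prob (X l -` {p l} \<inter> space M))"
      unfolding E_def by (intro indep_varsD_finite[OF indep I(2,1)]) auto
  qed
  finally show ?thesis .
qed

lemma prob_conjugate_eq:
  assumes X: "X \<in> measurable M (count_space (Perms n))" and inv: "conjugation_invariant M n X"
    and \<sigma>: "\<sigma> \<in> Perms n" and q: "q \<in> Perms n"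
  shows "prob (X -` {conj_by \<sigma> q} \<inter> space M) = prob (X -` {q} \<inter> space M)"
proof -
  have \<sigma>p: "\<sigma> permutes {1..n}" using \<sigma> by simp
  let ?Y = "\<lambda>\<omega>. conj_by \<sigma> (X \<omega>)"
  have "(\<lambda>q. conj_by \<sigma> q) \<in> measurable (count_space (Perms n)) (count_space (Perms n))"
    using conj_by_permutes[OF \<sigma>p] by auto
  then have Y: "?Y \<in> measurable M (count_space (Perms n))" by (rule measurable_compose[OF X])
  have c: "conj_by \<sigma> q \<in> Perms n" using conj_by_permutes[OF \<sigma>p] q by simp
  have "distr M (count_space (Perms n)) ?Y = distr M (count_space (Perms n)) X"
    using inv \<sigma> unfolding conjugation_invariant_def conj_by_def by blast
  moreover have "measure (distr M (count_space (Perms n)) ?Y) {conj_by \<sigma> q}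
      = prob (?Y -` {conj_by \<sigma> q} \<inter> space M)"
    by (rule measure_distr[OF Y]) (use c in simp)
  moreover have "measure (distr M (count_space (Perms n)) X) {conj_by \<sigma> q}
      = prob (X -` {conj_by \<sigma> q} \<inter> space M)"
    by (rule measure_distr[OF X]) (use c in simp)
  ultimately have "prob (?Y -` {conj_by \<sigma> q} \<inter> space M) = prob (X -` {conj_by \<sigma> q} \<inter> space M)"
    by simp
  moreover have "?Y -` {conj_by \<sigma> q} = X -` {q}"
  proof -
    have "conj_by \<sigma> r = conj_by \<sigma> q \<longleftrightarrow> r = q" for r
      using conj_by_inv(2)[OF \<sigma>p] by metis
    then show ?thesis by auto
  qed
  ultimately show ?thesis by simp
qed

end

section \<open>Truncation and the limit theorem\<close>

text \<open>Restricting to the tuples for which the factors \<open>i\<close> and \<open>j\<close> have sparse cycles keeps the summand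
invariant under simultaneous conjugation, so both factors may be conjugated by arbitrary permutations
and the result averaged over them.\<close>

lemma truncated_binomial_moment_close:
  fixes \<mu> :: "nat \<Rightarrow> (nat \<Rightarrow> nat) \<Rightarrow> real" and v :: "nat \<Rightarrow> nat" and c e :: real
  assumes ij: "1 \<le> i" "i < j" "j \<le> m"
    and pos: "\<And>l q. 0 \<le> \<mu> l q"
    and \<mu>: "\<forall>l\<in>{1..m} - {l0}. \<forall>\<sigma> q. \<sigma> permutes {1..n} \<longrightarrow> q permutes {1..n} \<longrightarrow> \<mu> l (conj_by \<sigma> q) = \<mu> l q"
    and avg: "\<forall>a\<in>Perms n. \<forall>b\<in>Perms n. \<forall>P\<in>Perms n. \<forall>Q\<in>Perms n. \<forall>R\<in>Perms n.
      sparse_cycles \<eta> r {1..n} a \<longrightarrow> sparse_cycles \<eta> r {1..n} b \<longrightarrow>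
      \<bar>(\<Sum>W1\<in>Perms n. \<Sum>W2\<in>Perms n. \<Prod>d\<in>{1..k}.
        real (num_cycles n d (P \<circ> (inv W2 \<circ> a \<circ> W2) \<circ> Q \<circ> (inv W1 \<circ> b \<circ> W1) \<circ> R) choose v d))
        / (fact n)\<^sup>2 - c\<bar> \<le> e"
  defines "G \<equiv> {p \<in> {1..m} \<rightarrow>\<^sub>E Perms n. sparse_cycles \<eta> r {1..n} (p i) \<and> sparse_cycles \<eta> r {1..n} (p j)}"
    and "w \<equiv> \<lambda>p. \<Prod>l\<in>{1..m}. \<mu> l (p l)"
  shows "\<bar>(\<Sum>p\<in>G. w p * (\<Prod>d\<in>{1..k}. real (num_cycles n d (perm_prod m p) choose v d))) - c * (\<Sum>p\<in>G. w p)\<bar>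
    \<le> e * (\<Sum>p\<in>G. w p)"
proof -
  define \<Omega> where "\<Omega> = {1..m} \<rightarrow>\<^sub>E Perms n"
  define good where "good p \<longleftrightarrow> sparse_cycles \<eta> r {1..n} (p i) \<and> sparse_cycles \<eta> r {1..n} (p j)"
    for p :: "nat \<Rightarrow> nat \<Rightarrow> nat"
  define B where "B q = (\<Prod>d\<in>{1..k}. real (num_cycles n d q choose v d))" for q
  define H where "H p = (if good p then B (perm_prod m p) else 0)" for p
  have I: "i \<in> {1..m}" "j \<in> {1..m}" "i \<noteq> j" using ij by auto
  have fin: "finite \<Omega>" unfolding \<Omega>_def by (intro finite_PiE) (auto intro: finite_permutations)
  have G: "G = {p \<in> \<Omega>. good p}" by (simp add: G_def \<Omega>_def good_def)
  have w0: "w p \<ge> 0" for p unfolding w_def by (intro prod_nonneg pos ballI)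
  have pl: "p l permutes {1..n}" if "p \<in> \<Omega>" "l \<in> {1..m}" for p l
    using that by (auto simp: \<Omega>_def PiE_iff)
  have Hinv: "\<forall>\<sigma>. \<sigma> permutes {1..n} \<longrightarrow> (\<forall>p\<in>{1..m} \<rightarrow>\<^sub>E Perms n. H (\<lambda>l\<in>{1..m}. conj_by \<sigma> (p l)) = H p)"
  proof (intro allI impI ballI)
    fix \<sigma> p assume \<sigma>: "\<sigma> permutes {1..n}" and p: "p \<in> {1..m} \<rightarrow>\<^sub>E Perms n"
    have p': "p i \<in> Perms n" "p j \<in> Perms n" using p I by auto
    have "perm_prod m (\<lambda>l\<in>{1..m}. conj_by \<sigma> (p l)) = perm_prod m (\<lambda>l. conj_by \<sigma> (p l))"
      by (rule perm_prod_cong) simp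
    also have "\<dots> = conj_by \<sigma> (perm_prod m p)" by (rule perm_prod_conj_by[OF \<sigma>])
    finally have "B (perm_prod m (\<lambda>l\<in>{1..m}. conj_by \<sigma> (p l))) = B (perm_prod m p)"
      using \<sigma> by (simp add: B_def num_cycles_conj_by)
    moreover have "good (\<lambda>l\<in>{1..m}. conj_by \<sigma> (p l)) = good p"
      using I p' \<sigma> by (simp add: good_def sparse_cycles_conj_by del: One_nat_def)
    ultimately show "H (\<lambda>l\<in>{1..m}. conj_by \<sigma> (p l)) = H p" by (simp add: H_def)
  qed
  define D where "D p = (\<Sum>W1\<in>Perms n. \<Sum>W2\<in>Perms n. H (p(i := conj_by W2 (p i), j := conj_by W1 (p j))))" for p
  have cardP: "card (Perms n) = fact n" by (intro card_permutations) simp_all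
  have "(fact n)\<^sup>2 * (\<Sum>p\<in>\<Omega>. w p * H p) = (\<Sum>W1\<in>Perms n. \<Sum>W2\<in>Perms n. \<Sum>p\<in>\<Omega>. w p * H p)"
    unfolding sum_constant cardP by (simp add: power2_eq_square)
  also have "\<dots> = (\<Sum>W1\<in>Perms n. \<Sum>W2\<in>Perms n. \<Sum>p\<in>\<Omega>.
      w p * H (p(i := conj_by W2 (p i), j := conj_by W1 (p j))))"
    unfolding \<Omega>_def w_def
    by (intro sum.cong refl sum_conj_by_two_factors[symmetric, OF \<mu> Hinv I]) simp_all
  also have "\<dots> = (\<Sum>W1\<in>Perms n. \<Sum>p\<in>\<Omega>. \<Sum>W2\<in>Perms n.
      w p * H (p(i := conj_by W2 (p i), j := conj_by W1 (p j))))"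
    by (intro sum.cong refl sum.swap)
  also have "\<dots> = (\<Sum>p\<in>\<Omega>. \<Sum>W1\<in>Perms n. \<Sum>W2\<in>Perms n.
      w p * H (p(i := conj_by W2 (p i), j := conj_by W1 (p j))))"
    by (rule sum.swap)
  also have "\<dots> = (\<Sum>p\<in>\<Omega>. w p * D p)" by (simp add: D_def sum_distrib_left)
  also have "\<dots> = (\<Sum>p\<in>G. w p * D p)"
  proof (rule sum.mono_neutral_right[OF fin])
    show "\<forall>p\<in>\<Omega> - G. w p * D p = 0"
    proof
      fix p assume p: "p \<in> \<Omega> - G"
      have "H (p(i := conj_by W2 (p i), j := conj_by W1 (p j))) = 0"
        if "W1 \<in> Perms n" "W2 \<in> Perms n" for W1 W2
        using p that I pl[of p i] pl[of p j] by (auto simp: H_def good_def G sparse_cycles_conj_by simp del: One_nat_def)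
      then show "w p * D p = 0" by (simp add: D_def)
    qed
  qed (auto simp: G)
  finally have "(fact n)\<^sup>2 * (\<Sum>p\<in>\<Omega>. w p * H p) = (\<Sum>p\<in>G. w p * D p)" .
  moreover have "(\<Sum>p\<in>\<Omega>. w p * H p) = (\<Sum>p\<in>G. w p * B (perm_prod m p))"
    unfolding G H_def using fin by (simp add: sum.inter_filter if_distrib cong: if_cong)
  ultimately have eq: "(\<Sum>p\<in>G. w p * B (perm_prod m p)) = (\<Sum>p\<in>G. w p * (D p / (fact n)\<^sup>2))"
    by (simp add: sum_divide_distrib[symmetric] field_simps)
  have close: "\<bar>D p / (fact n)\<^sup>2 - c\<bar> \<le> e" if p: "p \<in> G" for p
  proof -
    have p\<Omega>: "p \<in> \<Omega>" and gp: "good p" using p by (auto simp: G)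
    obtain P Q R where PQR: "P permutes {1..n}" "Q permutes {1..n}" "R permutes {1..n}"
      and prod: "\<And>a b. perm_prod m (p(i := a, j := b)) = P \<circ> a \<circ> Q \<circ> b \<circ> R"
      using perm_prod_split[OF ij, where p = p, OF pl[OF p\<Omega>]] by blast
    have "H (p(i := conj_by W2 (p i), j := conj_by W1 (p j)))
        = B (P \<circ> (inv W2 \<circ> p i \<circ> W2) \<circ> Q \<circ> (inv W1 \<circ> p j \<circ> W1) \<circ> R)"
      if "W1 \<in> Perms n" "W2 \<in> Perms n" for W1 W2
    proof -
      have "good (p(i := conj_by W2 (p i), j := conj_by W1 (p j)))"
        using gp that I pl[OF p\<Omega>] by (simp add: good_def sparse_cycles_conj_by del: One_nat_def)
      then show ?thesis by (simp add: H_def prod conj_by_def)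
    qed
    then have "D p = (\<Sum>W1\<in>Perms n. \<Sum>W2\<in>Perms n.
        B (P \<circ> (inv W2 \<circ> p i \<circ> W2) \<circ> Q \<circ> (inv W1 \<circ> p j \<circ> W1) \<circ> R))"
      unfolding D_def by (intro sum.cong refl)
    then show ?thesis
      using avg[rule_format, of "p i" "p j" P Q R] PQR pl[OF p\<Omega>] I gp
      unfolding good_def B_def by simp
  qed
  have "(\<Sum>p\<in>G. w p * B (perm_prod m p)) - c * (\<Sum>p\<in>G. w p) = (\<Sum>p\<in>G. w p * (D p / (fact n)\<^sup>2 - c))"
    unfolding eq by (simp add: sum_subtractf right_diff_distrib sum_distrib_left mult.commute)
  also have "\<bar>\<dots>\<bar> \<le> (\<Sum>p\<in>G. w p * e)"
    using close w0 by (intro sum_abs[THEN order.trans] sum_mono) (auto simp: abs_mult intro!: mult_left_mono)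
  also have "\<dots> = e * (\<Sum>p\<in>G. w p)" by (simp add: sum_distrib_left mult.commute)
  finally show ?thesis unfolding B_def .
qed

lemma weight_outside_le:
  fixes w X :: "'x \<Rightarrow> real"
  assumes "finite \<Omega>" "G \<subseteq> \<Omega>" "\<And>x. x \<in> \<Omega> \<Longrightarrow> 0 \<le> w x" "\<And>x. x \<in> \<Omega> \<Longrightarrow> 0 \<le> X x"
    and "\<And>x. x \<in> \<Omega> - G \<Longrightarrow> t \<le> X x" and t: "t > 0"
  shows "(\<Sum>x\<in>\<Omega> - G. w x) \<le> (\<Sum>x\<in>\<Omega>. w x * X x) / t"
proof -
  have "t * (\<Sum>x\<in>\<Omega> - G. w x) = (\<Sum>x\<in>\<Omega> - G. w x * t)" by (simp add: sum_distrib_left mult.commute)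
  also have "\<dots> \<le> (\<Sum>x\<in>\<Omega> - G. w x * X x)" using assms by (intro sum_mono mult_left_mono) auto
  also have "\<dots> \<le> (\<Sum>x\<in>\<Omega>. w x * X x)" using assms by (intro sum_mono2) auto
  finally show ?thesis using t by (simp add: field_simps)
qed

theorem theorem2:
  fixes m :: nat
    and M :: "nat \<Rightarrow> 'a measure"
    and S :: "nat \<Rightarrow> nat \<Rightarrow> 'a \<Rightarrow> nat \<Rightarrow> nat"
  assumes m: "m \<ge> 2"
    and prob: "\<And>n. n \<ge> 1 \<Longrightarrow> prob_space (M n)"
    and random_perm: "\<And>l n. l \<in> {1..m} \<Longrightarrow> n \<ge> 1 \<Longrightarrow>
          S l n \<in> measurable (M n) (count_space (Perms n))"
    and indep: "\<And>n. n \<ge> 1 \<Longrightarrow>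
          prob_space.indep_vars (M n) (\<lambda>_. count_space (Perms n)) (\<lambda>l. S l n) {1..m}"
    and invariant: "\<exists>l0\<in>{1..m}. \<forall>l\<in>{1..m} - {l0}. \<forall>n\<ge>1. conjugation_invariant (M n) n (S l n)"
    and few_cycles: "\<exists>i j. 1 \<le> i \<and> i < j \<and> j \<le> m \<and>
          (\<forall>l\<in>{i, j}.
             (\<forall>k::nat. k \<ge> 1 \<longrightarrow>
                (\<lambda>n. \<integral>\<omega>. (real (num_cycles n 1 (S l n \<omega>)) / sqrt (real n)) ^ k \<partial>M n)
                  \<longlonglongrightarrow> 0) \<and>
             (\<lambda>n. (\<integral>\<omega>. real (num_cycles n 2 (S l n \<omega>)) \<partial>M n) / real n) \<longlonglongrightarrow> 0)"
  shows "\<forall>k\<ge>1. weak_conv_top (Rk_top k)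
           (\<lambda>n. distr (M n) (Rk_borel k)
                  (\<lambda>\<omega>. cycle_vector n k (perm_prod m (\<lambda>l. S l n \<omega>))))
           (poisson_vector_law k)"
proof (intro allI impI)
  fix k :: nat assume "k \<ge> 1"
  obtain l0 where l0: "\<forall>l\<in>{1..m} - {l0}. \<forall>n\<ge>1. conjugation_invariant (M n) n (S l n)"
    using invariant by blast
  obtain i j where ij: "1 \<le> i" "i < j" "j \<le> m"
    and few: "\<forall>l\<in>{i, j}. (\<forall>k::nat. k \<ge> 1 \<longrightarrow>
                (\<lambda>n. \<integral>\<omega>. (real (num_cycles n 1 (S l n \<omega>)) / sqrt (real n)) ^ k \<partial>M n) \<longlonglongrightarrow> 0) \<and>
             (\<lambda>n. (\<integral>\<omega>. real (num_cycles n 2 (S l n \<omega>)) \<partial>M n) / real n) \<longlonglongrightarrow> 0"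
    using few_cycles by blast
  have I: "i \<in> {1..m}" "j \<in> {1..m}" and I0: "finite {1..m}" "{1..m} \<noteq> {}" using ij by auto
  define \<mu> where "\<mu> n l q = measure (M n) (S l n -` {q} \<inter> space (M n))" for n l q
  define w where "w n p = (\<Prod>l\<in>{1..m}. \<mu> n l (p l))" for n p
  define \<Omega> where "\<Omega> n = {1..m} \<rightarrow>\<^sub>E Perms n" for n
  have finP: "finite (Perms n)" for n by (rule finite_permutations) simp
  have fin\<Omega>: "finite (\<Omega> n)" for n unfolding \<Omega>_def using finP by (intro finite_PiE) auto
  have \<mu>0: "0 \<le> \<mu> n l q" for n l q by (simp add: \<mu>_def)
  have w0: "0 \<le> w n p" for n p unfolding w_def by (intro prod_nonneg ballI \<mu>0)
  have expect: "(\<integral>\<omega>. F (\<lambda>l\<in>{1..m}. S l n \<omega>) \<partial>M n) = (\<Sum>p\<in>\<Omega> n. w n p * F p)" if n: "n \<ge> 1" for n F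
    unfolding w_def \<mu>_def \<Omega>_def
    by (rule prob_space.expectation_independent_tuple[OF prob[OF n] I0 finP random_perm[OF _ n] indep[OF n]])
  have total: "(\<Sum>p\<in>\<Omega> n. w n p) = 1" if n: "n \<ge> 1" for n
    using expect[OF n, of "\<lambda>_. 1"] prob_space.prob_space[OF prob[OF n]] by simp
  have \<mu>_inv: "\<forall>l\<in>{1..m} - {l0}. \<forall>\<sigma> q. \<sigma> permutes {1..n} \<longrightarrow> q permutes {1..n} \<longrightarrow>
      \<mu> n l (conj_by \<sigma> q) = \<mu> n l q" if n: "n \<ge> 1" for n
  proof (intro ballI allI impI)
    fix l \<sigma> q assume "l \<in> {1..m} - {l0}" "\<sigma> permutes {1..n}" "q permutes {1..n}"
    then show "\<mu> n l (conj_by \<sigma> q) = \<mu> n l q"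
      unfolding \<mu>_def using l0 n
      by (intro prob_space.prob_conjugate_eq[OF prob[OF n] random_perm[OF _ n]]) auto
  qed
  define X where "X n p = real (num_cycles n 1 (p i)) / sqrt n + real (num_cycles n 1 (p j)) / sqrt n
    + 2 * real (num_cycles n 2 (p i)) / n + 2 * real (num_cycles n 2 (p j)) / n" for n p
  define \<epsilon> where "\<epsilon> n = (\<integral>\<omega>. (real (num_cycles n 1 (S i n \<omega>)) / sqrt n) ^ 1 \<partial>M n)
    + (\<integral>\<omega>. (real (num_cycles n 1 (S j n \<omega>)) / sqrt n) ^ 1 \<partial>M n)
    + 2 * ((\<integral>\<omega>. real (num_cycles n 2 (S i n \<omega>)) \<partial>M n) / n)
    + 2 * ((\<integral>\<omega>. real (num_cycles n 2 (S j n \<omega>)) \<partial>M n) / n)" for n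
  have "\<epsilon> \<longlonglongrightarrow> 0 + 0 + 2 * 0 + 2 * 0"
    unfolding \<epsilon>_def using few by (intro tendsto_intros) auto
  then have \<epsilon>: "\<epsilon> \<longlonglongrightarrow> 0" by simp
  have \<epsilon>X: "\<epsilon> n = (\<Sum>p\<in>\<Omega> n. w n p * X n p)" if n: "n \<ge> 1" for n
  proof -
    have 1: "(\<integral>\<omega>. (real (num_cycles n 1 (S l n \<omega>)) / sqrt n) ^ 1 \<partial>M n)
        = (\<Sum>p\<in>\<Omega> n. w n p * (real (num_cycles n 1 (p l)) / sqrt n))" if "l \<in> {1..m}" for l
      using expect[OF n, of "\<lambda>p. real (num_cycles n 1 (p l)) / sqrt n"] that by simp
    have 2: "(\<integral>\<omega>. real (num_cycles n 2 (S l n \<omega>)) \<partial>M n)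
        = (\<Sum>p\<in>\<Omega> n. w n p * real (num_cycles n 2 (p l)))" if "l \<in> {1..m}" for l
      using expect[OF n, of "\<lambda>p. real (num_cycles n 2 (p l))"] that by simp
    show ?thesis
      unfolding \<epsilon>_def X_def 1[OF I(1)] 1[OF I(2)] 2[OF I(1)] 2[OF I(2)]
      by (simp add: sum.distrib distrib_left sum_distrib_left sum_divide_distrib mult_ac)
  qed
  \<comment> \<open>The square root balances \<open>\<eta> \<longlonglongrightarrow> 0\<close> against Markov's bound \<open>\<epsilon> / \<eta>\<close>; the second term ensures
    \<open>1 \<le> \<eta> \<surd>n\<close>.\<close>
  define \<eta> where "\<eta> n = sqrt (\<epsilon> n) + 1 / sqrt n" for n
  have "\<eta> \<longlonglongrightarrow> sqrt 0 + 0"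
    unfolding \<eta>_def by (intro tendsto_intros \<epsilon>) real_asymp
  then have \<eta>: "\<eta> \<longlonglongrightarrow> 0" by simp
  have X0: "0 \<le> X n p" for n p by (simp add: X_def)
  have \<epsilon>0: "0 \<le> \<epsilon> n" if "n \<ge> 1" for n
    unfolding \<epsilon>X[OF that] by (intro sum_nonneg mult_nonneg_nonneg w0 X0)
  have \<eta>1: "\<forall>n\<ge>1. 1 \<le> \<eta> n * sqrt n"
    using \<epsilon>0 by (simp add: \<eta>_def distrib_right)
  define G where "G n = {p \<in> \<Omega> n. sparse_cycles (\<eta> n) (sqrt n) {1..n} (p i) \<and>
    sparse_cycles (\<eta> n) (sqrt n) {1..n} (p j)}" for n
  have G\<Omega>: "G n \<subseteq> \<Omega> n" for n by (auto simp: G_def)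
  have bad: "(\<Sum>p\<in>\<Omega> n - G n. w n p) \<le> sqrt (\<epsilon> n)" if n: "n \<ge> 1" for n
  proof -
    have \<eta>pos: "\<eta> n > 0" using \<epsilon>0[OF n] n by (simp add: \<eta>_def add_nonneg_pos)
    have "\<eta> n \<le> X n p" if p: "p \<in> \<Omega> n - G n" for p
    proof (rule ccontr)
      assume neg: "\<not> \<eta> n \<le> X n p"
      have p': "p i \<in> Perms n" "p j \<in> Perms n" using p I by (auto simp: \<Omega>_def)
      have nn: "0 \<le> real (num_cycles n 1 q) / sqrt n" "0 \<le> 2 * real (num_cycles n 2 q) / n" for q
        by simp_all
      have le: "real (num_cycles n 1 (p i)) / sqrt n \<le> \<eta> n" "2 * real (num_cycles n 2 (p i)) / n \<le> \<eta> n"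
        "real (num_cycles n 1 (p j)) / sqrt n \<le> \<eta> n" "2 * real (num_cycles n 2 (p j)) / n \<le> \<eta> n"
        using neg nn[of "p i"] nn[of "p j"] unfolding X_def by linarith+
      have "1 \<le> \<eta> n * sqrt n" using \<eta>1 n by blast
      then have "sparse_cycles (\<eta> n) (sqrt n) {1..n} (p i)" "sparse_cycles (\<eta> n) (sqrt n) {1..n} (p j)"
        using sparse_cycles_of_few_short_cycles[OF p'(1) n _ le(1,2)]
          sparse_cycles_of_few_short_cycles[OF p'(2) n _ le(3,4)] by blast+
      then show False using p by (simp add: G_def)
    qed
    then have "(\<Sum>p\<in>\<Omega> n - G n. w n p) \<le> \<epsilon> n / \<eta> n"
      unfolding \<epsilon>X[OF n] by (intro weight_outside_le fin\<Omega> G\<Omega> w0 X0 \<eta>pos)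
    also have "\<dots> \<le> sqrt (\<epsilon> n)"
    proof -
      have "\<epsilon> n = sqrt (\<epsilon> n) * sqrt (\<epsilon> n)" using \<epsilon>0[OF n] by simp
      also have "\<dots> \<le> sqrt (\<epsilon> n) * \<eta> n"
        using \<epsilon>0[OF n] by (intro mult_left_mono) (simp_all add: \<eta>_def)
      finally show ?thesis using \<eta>pos by (simp add: divide_le_eq)
    qed
    finally show ?thesis .
  qed
  have wG: "(\<lambda>n. \<Sum>p\<in>G n. w n p) \<longlonglongrightarrow> 1"
  proof (rule tendsto_sandwich)
    have eq: "(\<Sum>p\<in>G n. w n p) = 1 - (\<Sum>p\<in>\<Omega> n - G n. w n p)" if "n \<ge> 1" for n
      using total[OF that] sum.subset_diff[OF G\<Omega> fin\<Omega>, of "w n" n] by simp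
    show "\<forall>\<^sub>F n in sequentially. 1 - sqrt (\<epsilon> n) \<le> (\<Sum>p\<in>G n. w n p)"
      using eventually_ge_at_top[of 1] by eventually_elim (simp add: eq bad)
    show "\<forall>\<^sub>F n in sequentially. (\<Sum>p\<in>G n. w n p) \<le> 1"
      using eventually_ge_at_top[of 1] by eventually_elim (simp add: eq sum_nonneg w0)
    have "(\<lambda>n. 1 - sqrt (\<epsilon> n)) \<longlonglongrightarrow> 1 - sqrt 0" by (intro tendsto_intros \<epsilon>)
    then show "(\<lambda>n. 1 - sqrt (\<epsilon> n)) \<longlonglongrightarrow> 1" by simp
  qed simp
  have mom: "(\<lambda>n. \<Sum>p\<in>G n. w n p * (\<Prod>d\<in>{1..k}. real (num_cycles n d (perm_prod m p) choose v d)))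
      \<longlonglongrightarrow> (\<Prod>d\<in>{1..k}. (1 / real d) ^ v d / fact (v d))" for v
  proof -
    let ?c = "\<Prod>d\<in>{1..k}. (1 / real d) ^ v d / fact (v d)"
    let ?T = "\<lambda>n. \<Sum>p\<in>G n. w n p * (\<Prod>d\<in>{1..k}. real (num_cycles n d (perm_prod m p) choose v d))"
    have "(\<lambda>n. ?T n - ?c * (\<Sum>p\<in>G n. w n p)) \<longlonglongrightarrow> 0"
    proof (rule tendstoI)
      fix e :: real assume e: "e > 0"
      then have "e / 2 > 0" by simp
      from average_binomial_moments[OF \<eta> \<eta>1 this, where k = k and v = v] eventually_ge_at_top[of 1]
      show "\<forall>\<^sub>F n in sequentially. dist (?T n - ?c * (\<Sum>p\<in>G n. w n p)) 0 < e"
      proof eventually_elim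
        case (elim n)
        have "\<bar>?T n - ?c * (\<Sum>p\<in>G n. w n p)\<bar> \<le> e / 2 * (\<Sum>p\<in>G n. w n p)"
          unfolding G_def \<Omega>_def w_def
          by (rule truncated_binomial_moment_close[OF ij \<mu>0 \<mu>_inv[OF elim(2)] elim(1)])
        also have "\<dots> \<le> e / 2 * (\<Sum>p\<in>\<Omega> n. w n p)"
          using e G\<Omega> fin\<Omega> w0 by (intro mult_left_mono sum_mono2) auto
        also have "\<dots> < e" using total[OF elim(2)] e by simp
        finally show ?case by simp
      qed
    qed
    moreover have "(\<lambda>n. ?c * (\<Sum>p\<in>G n. w n p)) \<longlonglongrightarrow> ?c * 1" by (intro tendsto_intros wG)
    ultimately have "(\<lambda>n. (?T n - ?c * (\<Sum>p\<in>G n. w n p)) + ?c * (\<Sum>p\<in>G n. w n p)) \<longlonglongrightarrow> 0 + ?c * 1"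
      by (rule tendsto_add)
    then show ?thesis by simp
  qed
  define q where "q d a = (1 / real d) ^ a / fact a * exp (- (1 / real d))" for d a :: nat
  have point: "(\<lambda>n. \<Sum>p\<in>G n. w n p * of_bool (\<forall>d\<in>{1..k}. num_cycles n d (perm_prod m p) = v d))
      \<longlonglongrightarrow> (\<Prod>d\<in>{1..k}. q d (v d))" for v
    unfolding q_def by (rule poisson_limit_of_binomial_moments[OF _ w0 mom]) simp
  have qsum: "q d sums 1" for d
  proof -
    have "(\<lambda>a. (1 / real d) ^ a / fact a * exp (- (1 / real d))) sums (exp (1 / real d) * exp (- (1 / real d)))"
      using exp_converges[of "1 / real d"] by (intro sums_mult2) (simp add: divide_inverse mult.commute)
    then show ?thesis by (simp add: q_def[abs_def] exp_minus_inverse)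
  qed
  show "weak_conv_top (Rk_top k) (\<lambda>n. distr (M n) (Rk_borel k)
      (\<lambda>\<omega>. cycle_vector n k (perm_prod m (\<lambda>l. S l n \<omega>)))) (poisson_vector_law k)"
    unfolding weak_conv_top_def
  proof (intro allI impI)
    fix f :: "(nat \<Rightarrow> real) \<Rightarrow> real"
    assume f: "continuous_map (Rk_top k) euclideanreal f \<and> bounded (f ` topspace (Rk_top k))"
    obtain B where B: "\<And>x. x \<in> topspace (Rk_top k) \<Longrightarrow> \<bar>f x\<bar> \<le> B"
      using f unfolding bounded_iff by auto
    define f' where "f' v = f (\<lambda>d\<in>{1..k}. real (v d))" for v :: "nat \<Rightarrow> nat"
    have fB: "\<bar>f' v\<bar> \<le> B" for v unfolding f'_def by (rule B) simp
    have "(\<lambda>n. \<Sum>p\<in>\<Omega> n. w n p * f' (restrict (\<lambda>d. num_cycles n d (perm_prod m p)) {1..k}))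
        \<longlonglongrightarrow> integral\<^sup>L (poisson_vector_law k) f"
    proof (rule weighted_average_tendsto[OF _ w0 fin\<Omega> G\<Omega> _ point qsum fB])
      show "\<forall>\<^sub>F n in sequentially. (\<Sum>p\<in>\<Omega> n. w n p) = 1"
        using eventually_ge_at_top[of 1] by eventually_elim (rule total)
      show "\<bar>integral\<^sup>L (poisson_vector_law k) f - (\<Sum>v\<in>{1..k} \<rightarrow>\<^sub>E {..R}. (\<Prod>d\<in>{1..k}. q d (v d)) * f' v)\<bar>
          \<le> B * (1 - (\<Sum>v\<in>{1..k} \<rightarrow>\<^sub>E {..R}. \<Prod>d\<in>{1..k}. q d (v d)))" for R
        unfolding q_def f'_def using f B by (intro poisson_vector_integral_approx) auto
    qed simp
    moreover have "\<forall>\<^sub>F n in sequentially.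
        (\<Sum>p\<in>\<Omega> n. w n p * f' (restrict (\<lambda>d. num_cycles n d (perm_prod m p)) {1..k}))
        = integral\<^sup>L (distr (M n) (Rk_borel k) (\<lambda>\<omega>. cycle_vector n k (perm_prod m (\<lambda>l. S l n \<omega>)))) f"
      using eventually_ge_at_top[of 1]
    proof eventually_elim
      case (elim n)
      have cv: "cycle_vector n k (perm_prod m (\<lambda>l. S l n \<omega>))
          = cycle_vector n k (perm_prod m (\<lambda>l\<in>{1..m}. S l n \<omega>))" for \<omega>
        by (intro arg_cong[where f = "cycle_vector n k"] perm_prod_cong) simp
      have "(\<lambda>p. cycle_vector n k (perm_prod m p)) \<in> measurable (count_space (\<Omega> n)) (Rk_borel k)"
        by (simp add: space_PiM cycle_vector_def)
      from measurable_compose[OF prob_space.tuple_measurable[OF prob[OF elim] I0 finP random_perm[OF _ elim]]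
          this[unfolded \<Omega>_def]]
      have meas: "(\<lambda>\<omega>. cycle_vector n k (perm_prod m (\<lambda>l. S l n \<omega>))) \<in> measurable (M n) (Rk_borel k)"
        unfolding cv .
      have "integral\<^sup>L (distr (M n) (Rk_borel k) (\<lambda>\<omega>. cycle_vector n k (perm_prod m (\<lambda>l. S l n \<omega>)))) f
        = (\<integral>\<omega>. f (cycle_vector n k (perm_prod m (\<lambda>l\<in>{1..m}. S l n \<omega>))) \<partial>M n)"
        using integral_distr[OF meas continuous_map_Rk_measurable[of k f]] f unfolding cv by blast
      also have "\<dots> = (\<Sum>p\<in>\<Omega> n. w n p * f (cycle_vector n k (perm_prod m p)))"
        by (rule expect[OF elim])
      also have "\<dots> = (\<Sum>p\<in>\<Omega> n. w n p * f' (restrict (\<lambda>d. num_cycles n d (perm_prod m p)) {1..k}))"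
        by (simp add: f'_def cycle_vector_def restrict_def cong: if_cong)
      finally show ?case ..
    qed
    ultimately show "(\<lambda>n. integral\<^sup>L (distr (M n) (Rk_borel k)
        (\<lambda>\<omega>. cycle_vector n k (perm_prod m (\<lambda>l. S l n \<omega>)))) f) \<longlonglongrightarrow> integral\<^sup>L (poisson_vector_law k) f"
      by (rule Lim_transform_eventually)
  qed
qed

end
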